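(* For every Young diagram $\mu$, $\omega(Fs_\mu)=Fs_{\mu'}$, where $\mu'$ is the transposed diagram, $Fs_\mu\in\Lambda$ is the Frobenius--Schur function, and $\omega:\Lambda\to\Lambda$ is the algebra isomorphism with $\omega(\mathbf p_k)=(-1)^{k-1}\mathbf p_k$ for all $k\ge1$.
   Context: The base field is $\mathbb C$. $\Lambda=\mathbb C[\mathbf p_1,\mathbf p_2,\dots]$ is the algebra of symmetric functions (polynomial ring in the power sums). Its elements $h_k$ are defined by $H(u)=1+\sum_{k\ge1}h_ku^{-k}=\exp\big(\sum_{k\ge1}\mathbf p_ku^{-k}/k\big)\in\Lambda[[u^{-1}]]$. Shifted symmetric functions: $\Lambda^*_n\subset\mathbb C[x_1,\dots,x_n]$ is the algebra of polynomials symmetric in the variables $x_j-j$, and $\Lambda^*=\varprojlim\Lambda^*_n$ is the projective limit in filtered algebras (filtration by degree) under the maps $x_n=0$. Put $x^{\downarrow m}=x(x-1)\cdots(x-m+1)$, $x^{\downarrow0}=1$. The shifted Schur function $s^*_\mu\in\Lambda^*$ is given for $n\ge\ell(\mu)$ by $$s^*_\mu(x_1,\dots,x_n)=\frac{\det[(x_i+n-i)^{\downarrow(\mu_j+n-j)}]_{i,j=1}^n}{\det[(x_i+n-i)^{\downarrow(n-j)}]_{i,j=1}^n}$$ (these are compatible for varying $n$). Put $h^*_k=s^*_{(k)}$ and $H^*(u)=1+\sum_{k\ge1}h^*_k/u^{\downarrow k}\in\Lambda^*[[u^{-1}]]$. $\Lambda^*$ is the polynomial algebra in $h_1^*,h_2^*,\dots$,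 and $\varphi:\Lambda^*\to\Lambda$ is the algebra isomorphism defined (coefficientwise in $u^{-1}$) by $\varphi(H^*(u))=H(u+\tfrac12)$. The Frobenius--Schur function is $Fs_\mu=\varphi(s^*_\mu)$. *)

theory Defs
  imports
    "HOL-Computational_Algebra.Formal_Power_Series"
    "HOL-Library.Poly_Mapping"
    "HOL-Library.Function_Algebras"
    "HOL-Library.FuncSet"
    "HOL-Combinatorics.Permutations"
    "Jordan_Normal_Form.Determinant"
begin

section \<open>Polynomials over the complex numbers in countably many variables\<close>

text \<open>Monomials are finitely supported exponent functions. The variables are numbered from 0.\<close>

type_synonym cpoly = "(nat \<Rightarrow>\<^sub>0 nat) \<Rightarrow>\<^sub>0 complex"

definition Con :: "complex \<Rightarrow> cpoly" where
  "Con c = Poly_Mapping.single 0 c"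

definition X :: "nat \<Rightarrow> cpoly" where
  "X i = Poly_Mapping.single (Poly_Mapping.single i 1) 1"

definition vars :: "cpoly \<Rightarrow> nat set" where
  "vars f = (\<Union>m\<in>Poly_Mapping.keys f. Poly_Mapping.keys m)"

definition mdeg :: "(nat \<Rightarrow>\<^sub>0 nat) \<Rightarrow> nat" where
  "mdeg m = (\<Sum>i\<in>Poly_Mapping.keys m. Poly_Mapping.lookup m i)"

definition degree_le :: "cpoly \<Rightarrow> nat \<Rightarrow> bool" where
  "degree_le f d \<longleftrightarrow> (\<forall>m\<in>Poly_Mapping.keys f. mdeg m \<le> d)"

text \<open>The algebra endomorphism that replaces the variable \<open>X i\<close> by \<open>\<sigma> i\<close>; see
  the lemmas \<open>psubst_Con\<close>, \<open>psubst_X\<close>, \<open>psubst_add\<close>, \<open>psubst_mult\<close>.\<close>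

definition psubst :: "(nat \<Rightarrow> cpoly) \<Rightarrow> cpoly \<Rightarrow> cpoly" where
  "psubst \<sigma> f = (\<Sum>m\<in>Poly_Mapping.keys f. Con (Poly_Mapping.lookup f m) *
      (\<Prod>i\<in>Poly_Mapping.keys m. \<sigma> i ^ Poly_Mapping.lookup m i))"

lemma Con_add: "Con (a + b) = Con a + Con b"
  by (simp add: Con_def single_add)

lemma Con_mult: "Con (a * b) = Con a * Con b"
  by (simp add: Con_def mult_single)

lemma Con_0 [simp]: "Con 0 = 0" and Con_1 [simp]: "Con 1 = 1"
  by (simp_all add: Con_def)

lemma psubst_Con: "psubst \<sigma> (Con c) = Con c"
  by (cases "c = 0") (simp_all add: psubst_def Con_def)

lemma psubst_X: "psubst \<sigma> (X i) = \<sigma> i"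
  by (simp add: psubst_def X_def)

lemma psubst_superset:
  assumes "finite A" "Poly_Mapping.keys f \<subseteq> A"
  shows "psubst \<sigma> f = (\<Sum>m\<in>A. Con (Poly_Mapping.lookup f m) *
      (\<Prod>i\<in>Poly_Mapping.keys m. \<sigma> i ^ Poly_Mapping.lookup m i))"
  unfolding psubst_def by (rule sum.mono_neutral_left) (use assms in \<open>auto simp: in_keys_iff\<close>)

lemma psubst_add: "psubst \<sigma> (f + g) = psubst \<sigma> f + psubst \<sigma> g"
proof -
  let ?A = "Poly_Mapping.keys f \<union> Poly_Mapping.keys g"
  have "finite ?A" "Poly_Mapping.keys (f + g) \<subseteq> ?A"
    by (simp, rule keys_add)
  then show ?thesis
    by (simp add: psubst_superset[of ?A] lookup_add Con_add distrib_right sum.distrib)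
qed

lemma psubst_zero: "psubst \<sigma> 0 = 0"
  by (simp add: psubst_def)

lemma psubst_single:
  "psubst \<sigma> (Poly_Mapping.single m c) =
    Con c * (\<Prod>i\<in>Poly_Mapping.keys m. \<sigma> i ^ Poly_Mapping.lookup m i)"
  by (cases "c = 0") (simp_all add: psubst_def)

lemma prod_lookup_superset:
  assumes "finite A" "Poly_Mapping.keys m \<subseteq> A"
  shows "(\<Prod>i\<in>Poly_Mapping.keys m. \<sigma> i ^ Poly_Mapping.lookup m i) =
    (\<Prod>i\<in>A. (\<sigma> i :: cpoly) ^ Poly_Mapping.lookup m i)"
  by (rule prod.mono_neutral_left) (use assms in \<open>auto simp: in_keys_iff\<close>)

lemma prod_lookup_add:
  "(\<Prod>i\<in>Poly_Mapping.keys (m + k). (\<sigma> i :: cpoly) ^ Poly_Mapping.lookup (m + k) i) =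
    (\<Prod>i\<in>Poly_Mapping.keys m. \<sigma> i ^ Poly_Mapping.lookup m i) *
    (\<Prod>i\<in>Poly_Mapping.keys k. \<sigma> i ^ Poly_Mapping.lookup k i)"
proof -
  let ?A = "Poly_Mapping.keys m \<union> Poly_Mapping.keys k"
  have "finite ?A" "Poly_Mapping.keys (m + k) \<subseteq> ?A"
    by (simp, rule keys_add)
  then show ?thesis
    using prod_lookup_superset[of ?A "m + k" \<sigma>] prod_lookup_superset[of ?A m \<sigma>]
      prod_lookup_superset[of ?A k \<sigma>]
    by (simp add: lookup_add power_add prod.distrib)
qed

lemma cpoly_induct [case_names single add]:
  fixes f :: cpoly
  assumes single: "\<And>m c. P (Poly_Mapping.single m c)"
    and add: "\<And>f g. P f \<Longrightarrow> P g \<Longrightarrow> P (f + g)"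
  shows "P f"
proof (induction f rule: update_induct)
  case const
  show ?case using single[of 0 0] by simp
next
  case (update f m c)
  have "Poly_Mapping.update m c f = f + Poly_Mapping.single m c"
    by (rule poly_mapping_eqI)
      (use update in \<open>auto simp: lookup_update lookup_add lookup_single when_def in_keys_iff\<close>)
  then show ?case using update add single by simp
qed

lemma psubst_mult: "psubst \<sigma> (f * g) = psubst \<sigma> f * psubst \<sigma> g"
proof (induction f rule: cpoly_induct)
  case (single m c)
  show ?case
  proof (induction g rule: cpoly_induct)
    case (single k d)
    show ?case
      by (simp add: mult_single psubst_single Con_mult prod_lookup_add mult_ac)
  qed (simp add: distrib_left psubst_add)
qed (simp add: distrib_right psubst_add)


section \<open>Young diagrams\<close>

text \<open>A diagram is given by its row lengths, so \<open>\<mu> i\<close> is the length of row \<open>i + 1\<close>.\<close>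

definition young_diagram :: "(nat \<Rightarrow> nat) \<Rightarrow> bool" where
  "young_diagram \<mu> \<longleftrightarrow> antimono \<mu> \<and> finite {i. \<mu> i \<noteq> 0}"

definition num_rows :: "(nat \<Rightarrow> nat) \<Rightarrow> nat" where
  "num_rows \<mu> = card {i. \<mu> i \<noteq> 0}"

definition transposed :: "(nat \<Rightarrow> nat) \<Rightarrow> nat \<Rightarrow> nat" where
  "transposed \<mu> j = card {i. j < \<mu> i}"

definition one_row :: "nat \<Rightarrow> nat \<Rightarrow> nat" where
  "one_row k i = (if i = 0 then k else 0)"


section \<open>The algebra of symmetric functions\<close>

text \<open>The algebra of symmetric functions is the polynomial algebra in the power sums, i.e. the
  type \<^typ>\<open>cpoly\<close>, with \<open>X i\<close> standing for the power sum of degree \<open>i + 1\<close>.\<close>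

definition power_sum :: "nat \<Rightarrow> cpoly" where
  "power_sum k = X (k - 1)"

definition omega :: "cpoly \<Rightarrow> cpoly" where
  "omega = psubst (\<lambda>i. Con ((-1) ^ i) * X i)"

lemma omega_power_sum: "k \<ge> 1 \<Longrightarrow> omega (power_sum k) = Con ((-1) ^ (k - 1)) * power_sum k"
  by (simp add: omega_def power_sum_def psubst_X)

text \<open>Series in \<open>u\<^sup>-\<^sup>1\<close> are formal power series whose variable is \<open>u\<^sup>-\<^sup>1\<close>.\<close>

definition exp_series :: "cpoly fps" where
  "exp_series = Abs_fps (\<lambda>n. Con (1 / fact n))"

definition H :: "cpoly fps" where
  "H = fps_compose exp_series
    (Abs_fps (\<lambda>k. if k = 0 then 0 else Con (1 / of_nat k) * power_sum k))"

text \<open>\<open>(u + 1/2)\<^sup>-\<^sup>1\<close> expanded in \<open>u\<^sup>-\<^sup>1\<close>, and \<open>H(u + 1/2)\<close>.\<close>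

definition shift_half :: "cpoly fps" where
  "shift_half = Abs_fps (\<lambda>n. if n = 0 then 0 else Con ((- 1 / 2) ^ (n - 1)))"

definition H_shifted :: "cpoly fps" where
  "H_shifted = fps_compose H shift_half"


section \<open>The algebra of shifted symmetric functions\<close>

text \<open>In \<open>\<complex>[x\<^sub>1,\<dots>,x\<^sub>n]\<close> the variable \<open>x\<^sub>j\<close> is \<open>X (j - 1)\<close>, so \<open>x\<^sub>j - j\<close> is
  \<open>X i - Con (of_nat (i + 1))\<close> with \<open>i = j - 1\<close>.\<close>

definition symmetric_polys :: "nat \<Rightarrow> cpoly set" where
  "symmetric_polys n = {g. vars g \<subseteq> {..<n} \<and>
     (\<forall>\<pi>. \<pi> permutes {..<n} \<longrightarrow> psubst (\<lambda>i. X (\<pi> i)) g = g)}"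

definition shifted_symmetric_polys :: "nat \<Rightarrow> cpoly set" where
  "shifted_symmetric_polys n =
     psubst (\<lambda>i. X i - Con (of_nat (i + 1))) ` symmetric_polys n"

text \<open>The projective limit of filtered algebras: compatible sequences of bounded degree, as a
  subalgebra of \<^typ>\<open>nat \<Rightarrow> cpoly\<close> with the pointwise operations.\<close>

type_synonym cpoly_seq = "nat \<Rightarrow> cpoly"

definition shifted_symmetric :: "cpoly_seq set" where
  "shifted_symmetric = {f.
     (\<forall>n. f n \<in> shifted_symmetric_polys n) \<and>
     (\<forall>n. psubst (\<lambda>i. if i = n then 0 else X i) (f (Suc n)) = f n) \<and>
     (\<exists>d. \<forall>n. degree_le (f n) d)}"

definition Con_seq :: "complex \<Rightarrow> cpoly_seq" where
  "Con_seq c = (\<lambda>n. Con c)"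

definition ffact :: "nat \<Rightarrow> cpoly \<Rightarrow> cpoly" where
  "ffact m x = (\<Prod>i<m. x - of_nat i)"

definition shifted_alternant :: "nat \<Rightarrow> (nat \<Rightarrow> nat) \<Rightarrow> cpoly" where
  "shifted_alternant n \<mu> = det (mat n n (\<lambda>(i, j).
     ffact (\<mu> j + (n - 1 - j)) (X i + of_nat (n - 1 - i))))"

definition shifted_schur_poly :: "nat \<Rightarrow> (nat \<Rightarrow> nat) \<Rightarrow> cpoly" where
  "shifted_schur_poly n \<mu> =
     (THE q. q * shifted_alternant n (\<lambda>_. 0) = shifted_alternant n \<mu>)"

text \<open>The quotient of determinants gives the components with \<open>n \<ge> \<ell>(\<mu>)\<close>. The finitely many
  components with \<open>n < \<ell>(\<mu>)\<close> are forced by compatibility: they arise from the component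
  number \<open>\<ell>(\<mu>)\<close> by setting the last variables to 0.\<close>

definition shifted_schur :: "(nat \<Rightarrow> nat) \<Rightarrow> cpoly_seq" where
  "shifted_schur \<mu> = (\<lambda>n.
     if num_rows \<mu> \<le> n then shifted_schur_poly n \<mu>
     else psubst (\<lambda>i. if i < n then X i else 0) (shifted_schur_poly (num_rows \<mu>) \<mu>))"

definition h_star :: "nat \<Rightarrow> cpoly_seq" where
  "h_star k = shifted_schur (one_row k)"

text \<open>\<open>1 / (u (u - 1) \<dots> (u - k + 1))\<close> expanded in \<open>u\<^sup>-\<^sup>1\<close>; the expansion starts in degree \<open>k\<close>,
  so each coefficient of \<open>H_star\<close> is a finite sum.\<close>

definition inv_falling :: "nat \<Rightarrow> complex fps" where
  "inv_falling k = fps_X ^ k * inverse (\<Prod>i<k. 1 - fps_const (of_nat i) * fps_X)"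

definition H_star :: "cpoly_seq fps" where
  "H_star = Abs_fps (\<lambda>m. if m = 0 then 1
     else (\<Sum>k=1..m. Con_seq (fps_nth (inv_falling k) m) * h_star k))"


section \<open>Frobenius--Schur functions\<close>

definition is_algebra_iso :: "(cpoly_seq \<Rightarrow> cpoly) \<Rightarrow> bool" where
  "is_algebra_iso \<phi> \<longleftrightarrow>
     bij_betw \<phi> shifted_symmetric UNIV \<and>
     (\<forall>c. \<phi> (Con_seq c) = Con c) \<and>
     (\<forall>f\<in>shifted_symmetric. \<forall>g\<in>shifted_symmetric. \<phi> (f + g) = \<phi> f + \<phi> g) \<and>
     (\<forall>f\<in>shifted_symmetric. \<forall>g\<in>shifted_symmetric. \<phi> (f * g) = \<phi> f * \<phi> g)"

text \<open>Outside \<^const>\<open>shifted_symmetric\<close>, where the isomorphism is not defined, its value is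
  fixed by membership in \<^const>\<open>extensional\<close> so that it is unique as a HOL function.\<close>

definition phi :: "cpoly_seq \<Rightarrow> cpoly" where
  "phi = (THE \<phi>. \<phi> \<in> extensional shifted_symmetric \<and> is_algebra_iso \<phi> \<and>
     (\<forall>m. \<phi> (fps_nth H_star m) = fps_nth H_shifted m))"

definition Fs :: "(nat \<Rightarrow> nat) \<Rightarrow> cpoly" where
  "Fs \<mu> = phi (shifted_schur \<mu>)"

end

theory Submission
  imports Defs
    "HOL-Computational_Algebra.Fundamental_Theorem_Algebra"
    "HOL-Computational_Algebra.Polynomial_FPS"
begin

text \<open>
  Elements of both algebras are functions on Young diagrams. A shifted symmetric function is
  evaluated at the row lengths of a diagram \<open>\<nu>\<close>. A symmetric function is evaluated by giving the power
  sum of degree \<open>k\<close> the value \<open>\<Sum>\<^sub>i (\<nu>\<^sub>i - i + 1/2)\<^sup>k - (- i + 1/2)\<^sup>k\<close>, and the isomorphism of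
  the two algebras preserves values. In this picture duality has two halves.

  The first half concerns \<open>omega\<close>. The sum above telescopes along the rows of \<open>\<nu>\<close> to a sum over boxes
  of \<open>(c + 1/2)\<^sup>k - (c - 1/2)\<^sup>k\<close>, where \<open>c\<close> is the content. Transposition changes the sign of all
  contents and so multiplies the value by \<open>(-1)\<^sup>k\<^sup>-\<^sup>1\<close>: the value of \<open>omega g\<close> at \<open>\<nu>\<close> is the value of \<open>g\<close>
  at the transposed diagram (\<open>ev_omega\<close>).

  The second half says that the value of \<open>s\<^sup>*\<^sub>\<mu>\<close> at \<open>\<nu>\<close> does not change when both diagrams are transposed
  (\<open>schur_value_transposed\<close>). For fixed \<open>\<nu>\<close> these values satisfy a Pieri rule: the sum of
  \<open>s\<^sup>*\<^sub>\<kappa>(\<nu>)\<close> over the diagrams \<open>\<kappa>\<close> with one box more than \<open>\<mu>\<close> is \<open>(|\<nu>| - |\<mu>|) s\<^sup>*\<^sub>\<mu>(\<nu>)\<close>. They vanish if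
  \<open>|\<mu>| \<ge> |\<nu>|\<close> and \<open>\<mu> \<noteq> \<nu>\<close>. Hence the recursion determines them up to the single factor \<open>s\<^sup>*\<^sub>\<nu>(\<nu>)\<close>, and
  this factor is determined in turn by the value 1 at the empty diagram. All these conditions are
  invariant under transposition.

  Since partitions are Zariski dense, the two halves give the theorem once \<open>phi\<close> is understood. The
  proof works with the inverse map \<open>psi\<close> out of the free algebra on the power sums. It is surjective,
  because a symmetric polynomial of degree \<open>d\<close> in \<open>d\<close> variables is a polynomial in power sums, and a
  shifted symmetric function of degree \<open>d\<close> is determined by its component in \<open>d\<close> variables
  (\<open>psi_surj\<close>). It is injective, because power sums of \<open>n\<close> complex numbers take all values
  (\<open>psi_inj\<close>). It maps \<open>H(u + 1/2)\<close> to \<open>H\<^sup>*(u)\<close>, because in \<open>n\<close> variables both are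
  \<open>\<Prod>\<^sub>i (u + i) / (u + i - x\<^sub>i)\<close>; this is proved as a common recursion in \<open>n\<close> (\<open>psi_H_shifted\<close>).
  Finally \<open>phi\<close> is unique, because the coefficients of \<open>H(u + 1/2)\<close> generate the symmetric functions
  (\<open>phi_psi\<close>).

  The shifted Schur polynomials themselves are handled through Newton interpolation. Expanding the
  falling factorials \<open>x\<^sup>\<down>\<^sup>m\<close> at the nodes \<open>x\<^sub>i + n - i\<close> factors the alternant into the
  Vandermonde determinant and the determinant of the divided differences \<open>dd\<close>. This gives existence
  of the quotient, its degree, and \<open>h\<^sup>*\<^sub>k\<close> as a single divided difference.
\<close>

section \<open>Substitution, evaluation, variables and degree\<close>

interpretation psubst: comm_ring_hom "psubst \<sigma>" for \<sigma>
  by unfold_locales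
    (simp_all add: psubst_add psubst_mult psubst_zero psubst_Con flip: Con_1)

interpretation Con: comm_ring_hom Con
  by unfold_locales (simp_all add: Con_add Con_mult)

lemma psubst_of_nat [simp]: "psubst \<sigma> (of_nat k) = of_nat k"
  by (rule psubst.hom_of_nat)

lemma single_eq_Con_prod:
  "Poly_Mapping.single m c =
    Con c * (\<Prod>i\<in>Poly_Mapping.keys m. X i ^ Poly_Mapping.lookup m i)"
proof -
  have pow: "X i ^ e = Poly_Mapping.single (Poly_Mapping.single i e) 1" for i e
    by (induction e) (simp_all add: X_def mult_single flip: single_add)
  have "(\<Prod>i\<in>A. X i ^ Poly_Mapping.lookup m i) =
      Poly_Mapping.single (\<Sum>i\<in>A. Poly_Mapping.single i (Poly_Mapping.lookup m i)) 1" for A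
    by (induction A rule: infinite_finite_induct) (simp_all add: pow mult_single)
  moreover have "(\<Sum>i\<in>Poly_Mapping.keys m. Poly_Mapping.single i (Poly_Mapping.lookup m i)) = m"
    by (rule poly_mapping_eqI)
      (simp add: lookup_sum lookup_single when_def in_keys_iff)
  ultimately show ?thesis
    by (simp add: Con_def mult_single)
qed

lemma cpoly_induct_ring [case_names Con X add mult]:
  assumes Con: "\<And>c. P (Con c)" and X: "\<And>i. P (X i)"
    and add: "\<And>f g. P f \<Longrightarrow> P g \<Longrightarrow> P (f + g)"
    and mult: "\<And>f g. P f \<Longrightarrow> P g \<Longrightarrow> P (f * g)"
  shows "P f"
proof (induction f rule: cpoly_induct)
  case (single m c)
  have one: "P 1"
    using Con[of 1] by simp
  have pow: "P (X i ^ e)" for i e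
    by (induction e) (use one X mult in auto)
  have "P (\<Prod>i\<in>A. X i ^ Poly_Mapping.lookup m i)" for A
    by (induction A rule: infinite_finite_induct) (use one pow mult in auto)
  then show ?case
    using Con mult by (simp add: single_eq_Con_prod)
qed (use add in auto)

lemma psubst_psubst: "psubst \<sigma> (psubst \<tau> f) = psubst (\<lambda>i. psubst \<sigma> (\<tau> i)) f"
  by (induction f rule: cpoly_induct_ring) (simp_all add: psubst_Con psubst_X psubst_add psubst_mult)

lemma psubst_ident [simp]: "psubst X f = f"
  by (induction f rule: cpoly_induct_ring) (simp_all add: psubst_Con psubst_X psubst_add psubst_mult)

lemma psubst_cong:
  assumes "\<And>i. i \<in> vars f \<Longrightarrow> \<sigma> i = \<tau> i"
  shows "psubst \<sigma> f = psubst \<tau> f"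
  unfolding psubst_def
  by (intro sum.cong refl arg_cong2[of _ _ _ _ "(*)"] prod.cong) (use assms in \<open>force simp: vars_def\<close>)+

text \<open>Evaluation at a point of affine space, read off from a substitution by constants, so that
  it inherits multiplicativity from \<^const>\<open>psubst\<close>.\<close>

definition ev :: "(nat \<Rightarrow> complex) \<Rightarrow> cpoly \<Rightarrow> complex" where
  "ev a f = Poly_Mapping.lookup (psubst (\<lambda>i. Con (a i)) f) 0"

lemma Con_ev: "Con (ev a f) = psubst (\<lambda>i. Con (a i)) f"
proof -
  have "\<exists>c. psubst (\<lambda>i. Con (a i)) f = Con c"
    by (induction f rule: cpoly_induct_ring)
      (metis psubst_Con, metis psubst_X, metis psubst_add Con_add, metis psubst_mult Con_mult)
  then show ?thesis
    by (auto simp: ev_def Con_def)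
qed

lemma Con_eq_iff [simp]: "Con a = Con b \<longleftrightarrow> a = b"
  by (metis Con_def lookup_single_eq)

lemma Con_eq_0_iff [simp]: "Con a = 0 \<longleftrightarrow> a = 0"
  using Con_eq_iff[of a 0] by (simp del: Con_eq_iff)

lemma ev_add: "ev a (f + g) = ev a f + ev a g"
  and ev_mult: "ev a (f * g) = ev a f * ev a g"
  by (simp_all add: Con_ev psubst_add psubst_mult Con_add Con_mult flip: Con_eq_iff)

lemma ev_Con [simp]: "ev a (Con c) = c" and ev_X [simp]: "ev a (X i) = a i"
  by (simp_all add: Con_ev psubst_Con psubst_X flip: Con_eq_iff)

interpretation ev: comm_ring_hom "ev a" for a
  by unfold_locales (simp_all add: ev_add ev_mult flip: Con_1 Con_0)

lemma ev_psubst: "ev a (psubst \<sigma> f) = ev (\<lambda>i. ev a (\<sigma> i)) f"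
  by (simp add: Con_ev psubst_psubst flip: Con_eq_iff)

lemma ev_cong: "(\<And>i. i \<in> vars f \<Longrightarrow> a i = b i) \<Longrightarrow> ev a f = ev b f"
  unfolding ev_def by (metis (no_types, lifting) psubst_cong)

lemma ev_altdef:
  "ev a f = (\<Sum>m\<in>Poly_Mapping.keys f. Poly_Mapping.lookup f m *
      (\<Prod>i\<in>Poly_Mapping.keys m. a i ^ Poly_Mapping.lookup m i))"
proof -
  have "Con (ev a f) = Con (\<Sum>m\<in>Poly_Mapping.keys f. Poly_Mapping.lookup f m *
      (\<Prod>i\<in>Poly_Mapping.keys m. a i ^ Poly_Mapping.lookup m i))"
    unfolding Con_ev psubst_def
    by (simp add: Con.hom_sum Con.hom_prod Con_mult Con.hom_power)
  then show ?thesis by simp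
qed

lemma vars_Con [simp]: "vars (Con c) = {}"
  by (cases "c = 0") (auto simp: vars_def Con_def)

lemma vars_of_nat [simp]: "vars (of_nat k) = {}"
  using vars_Con[of "of_nat k"] by (simp add: Con.hom_of_nat)

lemma vars_0 [simp]: "vars 0 = {}" and vars_1 [simp]: "vars 1 = {}"
  using vars_Con[of 0] vars_Con[of 1] by simp_all

lemma vars_X [simp]: "vars (X i) = {i}"
  by (auto simp: vars_def X_def)

lemma vars_add: "vars (f + g) \<subseteq> vars f \<union> vars g"
  using keys_add[of f g] by (fastforce simp: vars_def)

lemma vars_diff: "vars (f - g) \<subseteq> vars f \<union> vars g"
  using keys_diff[of f g] by (fastforce simp: vars_def)

lemma vars_mult: "vars (f * g) \<subseteq> vars f \<union> vars g"
proof
  fix i assume "i \<in> vars (f * g)"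
  then obtain m where m: "m \<in> Poly_Mapping.keys (f * g)" "i \<in> Poly_Mapping.keys m"
    by (auto simp: vars_def)
  with keys_mult[of f g] obtain a b where
    "m = a + b" "a \<in> Poly_Mapping.keys f" "b \<in> Poly_Mapping.keys g" by auto
  with m keys_add[of a b] show "i \<in> vars f \<union> vars g"
    by (auto simp: vars_def)
qed

lemma vars_addI: "vars f \<subseteq> S \<Longrightarrow> vars g \<subseteq> S \<Longrightarrow> vars (f + g) \<subseteq> S"
  and vars_diffI: "vars f \<subseteq> S \<Longrightarrow> vars g \<subseteq> S \<Longrightarrow> vars (f - g) \<subseteq> S"
  and vars_multI: "vars f \<subseteq> S \<Longrightarrow> vars g \<subseteq> S \<Longrightarrow> vars (f * g) \<subseteq> S"
  using vars_add[of f g] vars_diff[of f g] vars_mult[of f g] by blast+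

lemma vars_sumI: "(\<And>x. x \<in> A \<Longrightarrow> vars (f x) \<subseteq> S) \<Longrightarrow> vars (sum f A) \<subseteq> S"
  by (induction A rule: infinite_finite_induct) (simp_all add: vars_addI)

lemma vars_prodI: "(\<And>x. x \<in> A \<Longrightarrow> vars (f x) \<subseteq> S) \<Longrightarrow> vars (prod f A) \<subseteq> S"
  by (induction A rule: infinite_finite_induct) (simp_all add: vars_multI)

lemma vars_powerI: "vars f \<subseteq> S \<Longrightarrow> vars (f ^ k) \<subseteq> S"
  by (induction k) (simp_all add: vars_multI)

lemma vars_psubstI:
  assumes "\<And>i. i \<in> vars f \<Longrightarrow> vars (\<sigma> i) \<subseteq> S"
  shows "vars (psubst \<sigma> f) \<subseteq> S"
  unfolding psubst_def
proof (intro vars_sumI vars_multI vars_prodI vars_powerI)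
  fix m i assume "m \<in> Poly_Mapping.keys f" "i \<in> Poly_Mapping.keys m"
  then show "vars (\<sigma> i) \<subseteq> S"
    by (intro assms) (auto simp: vars_def)
qed simp

lemma finite_vars [simp]: "finite (vars f)"
  by (simp add: vars_def)

lemma mdeg_add: "mdeg (a + b) = mdeg a + mdeg b"
proof -
  let ?A = "Poly_Mapping.keys a \<union> Poly_Mapping.keys b"
  have *: "mdeg m = (\<Sum>i\<in>?A. Poly_Mapping.lookup m i)" if "Poly_Mapping.keys m \<subseteq> ?A" for m
    unfolding mdeg_def by (rule sum.mono_neutral_left) (use that in \<open>auto simp: in_keys_iff\<close>)
  show ?thesis
    using keys_add[of a b] by (simp add: * lookup_add sum.distrib)
qed

lemma degree_le_Con [simp]: "degree_le (Con c) d"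
  by (cases "c = 0") (auto simp: degree_le_def Con_def mdeg_def)

lemma degree_le_0 [simp]: "degree_le 0 d" and degree_le_1 [simp]: "degree_le 1 d"
  using degree_le_Con[of 0] degree_le_Con[of 1] by simp_all

lemma degree_le_of_nat [simp]: "degree_le (of_nat k) d"
  using degree_le_Con[of "of_nat k"] by (simp add: Con.hom_of_nat)

lemma degree_le_X [simp]: "degree_le (X i) 1"
  by (auto simp: degree_le_def X_def mdeg_def)

lemma degree_le_mono: "degree_le f d \<Longrightarrow> d \<le> e \<Longrightarrow> degree_le f e"
  by (force simp: degree_le_def)

lemma degree_le_add: "degree_le f d \<Longrightarrow> degree_le g d \<Longrightarrow> degree_le (f + g) d"
  using keys_add[of f g] by (fastforce simp: degree_le_def)

lemma degree_le_diff: "degree_le f d \<Longrightarrow> degree_le g d \<Longrightarrow> degree_le (f - g) d"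
  using keys_diff[of f g] by (fastforce simp: degree_le_def)

lemma degree_le_mult: "degree_le f d \<Longrightarrow> degree_le g e \<Longrightarrow> degree_le (f * g) (d + e)"
  using keys_mult[of f g] by (fastforce simp: degree_le_def mdeg_add intro: add_mono)

lemma degree_le_sum: "(\<And>x. x \<in> A \<Longrightarrow> degree_le (f x) d) \<Longrightarrow> degree_le (sum f A) d"
  by (induction A rule: infinite_finite_induct) (auto intro: degree_le_add)

lemma degree_le_prod:
  "(\<And>x. x \<in> A \<Longrightarrow> degree_le (f x) (d x)) \<Longrightarrow> degree_le (prod f A) (sum d A)"
  by (induction A rule: infinite_finite_induct) (auto intro: degree_le_mult)

lemma degree_le_power: "degree_le f d \<Longrightarrow> degree_le (f ^ k) (k * d)"
  by (induction k) (auto intro: degree_le_mult)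

lemma degree_le_psubst:
  assumes "degree_le f d" "\<And>i. degree_le (\<sigma> i) 1"
  shows "degree_le (psubst \<sigma> f) d"
  unfolding psubst_def
proof (rule degree_le_sum)
  fix m assume m: "m \<in> Poly_Mapping.keys f"
  have "degree_le (Con (Poly_Mapping.lookup f m) *
      (\<Prod>i\<in>Poly_Mapping.keys m. \<sigma> i ^ Poly_Mapping.lookup m i)) (0 + mdeg m)"
    unfolding mdeg_def
    using degree_le_power[OF assms(2)] by (intro degree_le_mult degree_le_prod) auto
  moreover have "mdeg m \<le> d"
    using assms(1) m by (auto simp: degree_le_def)
  ultimately show "degree_le (Con (Poly_Mapping.lookup f m) *
      (\<Prod>i\<in>Poly_Mapping.keys m. \<sigma> i ^ Poly_Mapping.lookup m i)) d"
    using degree_le_mono by fastforce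
qed

section \<open>Divided differences of falling factorials\<close>

definition falling :: "nat \<Rightarrow> 'a::comm_ring_1 \<Rightarrow> 'a" where
  "falling m x = (\<Prod>i<m. x - of_nat i)"

lemma falling_0 [simp]: "falling 0 x = 1"
  by (simp add: falling_def)

lemma falling_Suc: "falling (Suc m) x = falling m x * (x - of_nat m)"
  by (simp add: falling_def)

lemma ffact_eq_falling: "ffact = falling"
  by (intro ext) (simp add: ffact_def falling_def)

text \<open>\<open>dd v l m\<close> is the divided difference of \<open>\<lambda>t. falling m t\<close> at the nodes \<open>v 0, \<dots>, v l\<close>; the
  recursion is the Leibniz rule for the product of \<open>falling m t\<close> and \<open>t - m\<close>.\<close>

fun dd :: "(nat \<Rightarrow> 'a::comm_ring_1) \<Rightarrow> nat \<Rightarrow> nat \<Rightarrow> 'a" where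
  "dd v l 0 = (if l = 0 then 1 else 0)"
| "dd v 0 (Suc m) = (v 0 - of_nat m) * dd v 0 m"
| "dd v (Suc l) (Suc m) = (v (Suc l) - of_nat m) * dd v (Suc l) m + dd v l m"

lemma dd_eq_0: "m < l \<Longrightarrow> dd v l m = 0"
  by (induction v l m rule: dd.induct) auto

lemma dd_diag [simp]: "dd v m m = 1"
proof (induction m)
  case (Suc m)
  then show ?case by (simp add: dd_eq_0)
qed simp

lemma dd_cong: "(\<And>i. i \<le> l \<Longrightarrow> v i = w i) \<Longrightarrow> dd v l m = dd w l m"
  by (induction v l m rule: dd.induct) auto

text \<open>Newton interpolation; the expansion is exact, because divided differences of order above the
  degree vanish.\<close>

lemma falling_newton: "falling m t = (\<Sum>l\<le>m. dd v l m * (\<Prod>k<l. t - v k))"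
proof (induction m)
  case (Suc m)
  let ?N = "\<lambda>l. \<Prod>k<l. t - v k"
  have "falling (Suc m) t = (\<Sum>l\<le>m. dd v l m * ?N l * (t - of_nat m))"
    by (simp add: falling_Suc Suc sum_distrib_right)
  also have "\<dots> = (\<Sum>l\<le>m. dd v l m * ?N (Suc l) + (v l - of_nat m) * dd v l m * ?N l)"
    by (intro sum.cong) (simp_all add: algebra_simps)
  also have "\<dots> = (\<Sum>l\<le>m. dd v l m * ?N (Suc l)) + (\<Sum>l\<le>m. (v l - of_nat m) * dd v l m * ?N l)"
    by (simp add: sum.distrib)
  also have "(\<Sum>l\<le>m. (v l - of_nat m) * dd v l m * ?N l) =
      (\<Sum>l\<le>Suc m. (v l - of_nat m) * dd v l m * ?N l)"
    by (simp add: dd_eq_0)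
  also have "\<dots> = (v 0 - of_nat m) * dd v 0 m +
      (\<Sum>l\<le>m. (v (Suc l) - of_nat m) * dd v (Suc l) m * ?N (Suc l))"
    by (subst sum.atMost_Suc_shift) simp
  finally have "falling (Suc m) t = (v 0 - of_nat m) * dd v 0 m +
      (\<Sum>l\<le>m. dd v (Suc l) (Suc m) * ?N (Suc l))"
    by (simp add: sum.distrib distrib_right del: prod.lessThan_Suc)
  then show ?case
    by (subst sum.atMost_Suc_shift) simp
qed simp

definition falling_det :: "nat \<Rightarrow> (nat \<Rightarrow> 'a::comm_ring_1) \<Rightarrow> (nat \<Rightarrow> nat) \<Rightarrow> 'a" where
  "falling_det n v m = det (mat n n (\<lambda>(i, j). falling (m j) (v i)))"

definition dd_det :: "nat \<Rightarrow> (nat \<Rightarrow> 'a::comm_ring_1) \<Rightarrow> (nat \<Rightarrow> nat) \<Rightarrow> 'a" where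
  "dd_det n v m = det (mat n n (\<lambda>(l, j). dd v (n - Suc l) (m j)))"

lemma falling_det_newton:
  assumes "\<And>i. i < n \<Longrightarrow> \<exists>k<n. v i = w k"
  shows "falling_det n v m =
    det (mat n n (\<lambda>(i, l). \<Prod>k<n - Suc l. v i - w k)) * dd_det n w m"
proof -
  let ?N = "\<lambda>i l. \<Prod>k<l. v i - w k"
  let ?A = "mat n n (\<lambda>(i, l). ?N i (n - Suc l))"
  let ?B = "mat n n (\<lambda>(l, j). dd w (n - Suc l) (m j))"
  have "mat n n (\<lambda>(i, j). falling (m j) (v i)) = ?A * ?B"
  proof (rule eq_matI)
    fix i j assume ij: "i < dim_row (?A * ?B)" "j < dim_col (?A * ?B)"
    have N0: "?N i l = 0" if "l \<ge> n" for l
    proof -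
      from ij assms obtain k where "k < n" "v i = w k" by auto
      then show ?thesis
        using that by (intro prod_zero) auto
    qed
    have "falling (m j) (v i) = (\<Sum>l\<le>m j. dd w l (m j) * ?N i l)"
      by (rule falling_newton)
    also have "\<dots> = (\<Sum>l<max n (Suc (m j)). dd w l (m j) * ?N i l)"
      by (rule sum.mono_neutral_left) (auto simp: dd_eq_0)
    also have "\<dots> = (\<Sum>l<n. dd w l (m j) * ?N i l)"
      by (rule sum.mono_neutral_right) (auto simp: N0)
    also have "\<dots> = (\<Sum>l<n. dd w (n - Suc l) (m j) * ?N i (n - Suc l))"
      by (rule sum.nat_diff_reindex [symmetric])
    finally show "mat n n (\<lambda>(i, j). falling (m j) (v i)) $$ (i, j) = (?A * ?B) $$ (i, j)"
      using ij by (simp add: scalar_prod_def lessThan_atLeast0 mult.commute)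
  qed simp_all
  then show ?thesis
    unfolding falling_det_def dd_det_def by (simp add: det_mult[of _ n])
qed

lemma prod_list_eq_1: "(\<And>x. x \<in> set xs \<Longrightarrow> x = (1::'a::comm_monoid_mult)) \<Longrightarrow> prod_list xs = 1"
  by (induction xs) auto

lemma dd_det_staircase: "dd_det n v (\<lambda>j. n - Suc j) = 1"
  unfolding dd_det_def
  by (subst det_lower_triangular[where n = n])
    (auto simp: dd_eq_0 diag_mat_def intro!: prod_list_eq_1)

text \<open>A single row \<open>k\<close> changes only the first column of the unitriangular staircase matrix,
  so the matrix stays triangular and only its first diagonal entry differs from 1.\<close>

lemma dd_det_one_row:
  assumes "n > 0"
  shows "dd_det n v (\<lambda>j. one_row k j + (n - Suc j)) = dd v (n - 1) (k + (n - 1))"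
proof -
  have "dd_det n v (\<lambda>j. one_row k j + (n - Suc j)) =
      (\<Prod>i\<leftarrow>[0..<n]. dd v (n - Suc i) (one_row k i + (n - Suc i)))"
    unfolding dd_det_def
    by (subst det_lower_triangular[where n = n])
      (auto simp: dd_eq_0 diag_mat_def one_row_def intro!: arg_cong[of _ _ prod_list])
  also have "\<dots> = dd v (n - 1) (k + (n - 1))"
  proof -
    have "(\<Prod>i\<leftarrow>[1..<n]. dd v (n - Suc i) (one_row k i + (n - Suc i))) = 1"
      by (rule prod_list_eq_1) (auto simp: one_row_def)
    then show ?thesis
      using assms by (subst upt_conv_Cons) (auto simp: one_row_def)
  qed
  finally show ?thesis .
qed

text \<open>Taking the points themselves as nodes of the Newton expansion shows that the Vandermonde
  determinant divides every other alternant, with quotient \<^const>\<open>dd_det\<close>.\<close>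

lemma falling_det_eq:
  "falling_det n v m = falling_det n v (\<lambda>j. n - Suc j) * dd_det n v m"
proof -
  have *: "falling_det n v m = det (mat n n (\<lambda>(i, l). \<Prod>k<n - Suc l. v i - v k)) * dd_det n v m" for m
    by (rule falling_det_newton) auto
  show ?thesis
    unfolding *[of m] *[of "\<lambda>j. n - Suc j"] by (simp add: dd_det_staircase)
qed

text \<open>Taking the nodes in reverse order makes the first factor triangular as well.\<close>

lemma falling_det_vandermonde:
  "falling_det n v (\<lambda>j. n - Suc j) = (\<Prod>i<n. \<Prod>k<n - Suc i. v i - v (n - Suc k))"
proof -
  let ?w = "\<lambda>k. v (n - Suc k)"
  let ?A = "mat n n (\<lambda>(i, l). \<Prod>k<n - Suc l. v i - ?w k)"
  have "\<exists>k<n. v i = ?w k" if "i < n" for i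
    using that by (intro exI[of _ "n - Suc i"]) auto
  then have "falling_det n v (\<lambda>j. n - Suc j) = det ?A"
    by (subst falling_det_newton[of n v ?w]) (simp_all add: dd_det_staircase del: One_nat_def)
  also have "\<dots> = prod_list (diag_mat ?A)"
  proof (rule det_upper_triangular[of _ n])
    show "upper_triangular ?A"
    proof
      fix i l assume "l < i" "i < dim_row ?A"
      then have "(\<Prod>k<n - Suc l. v i - ?w k) = 0"
        by (intro prod_zero bexI[of _ "n - Suc i"]) auto
      with \<open>l < i\<close> \<open>i < dim_row ?A\<close> show "?A $$ (i, l) = 0" by simp
    qed
  qed simp
  also have "\<dots> = (\<Prod>i<n. \<Prod>k<n - Suc i. v i - ?w k)"
    by (simp add: diag_mat_def prod.list_conv_set_nth lessThan_atLeast0)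
  finally show ?thesis .
qed

lemma falling_det_nonzero:
  fixes v :: "nat \<Rightarrow> 'a::idom"
  assumes "inj_on v {..<n}"
  shows "falling_det n v (\<lambda>j. n - Suc j) \<noteq> 0"
proof -
  have "v i \<noteq> v (n - Suc k)" if "i < n" "k < n - Suc i" for i k
    using inj_onD[OF assms, of i "n - Suc k"] that by auto
  then show ?thesis
    by (simp add: falling_det_vandermonde)
qed

lemma (in comm_ring_hom) hom_falling: "hom (falling m x) = falling m (hom x)"
  by (simp add: falling_def hom_prod hom_minus hom_of_nat)

lemma (in comm_ring_hom) hom_falling_det:
  "hom (falling_det n v m) = falling_det n (\<lambda>i. hom (v i)) m"
proof -
  have "map_mat hom (mat n n (\<lambda>(i, j). falling (m j) (v i))) =
      mat n n (\<lambda>(i, j). falling (m j) (hom (v i)))"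
    by (rule eq_matI) (simp_all add: hom_falling)
  then show ?thesis
    unfolding falling_det_def by (metis hom_det)
qed


section \<open>Shifted Schur polynomials\<close>

definition node :: "nat \<Rightarrow> nat \<Rightarrow> cpoly" where
  "node n i = X i + of_nat (n - Suc i)"

definition exponent :: "nat \<Rightarrow> (nat \<Rightarrow> nat) \<Rightarrow> nat \<Rightarrow> nat" where
  "exponent n \<mu> j = \<mu> j + (n - Suc j)"

lemma shifted_alternant_eq: "shifted_alternant n \<mu> = falling_det n (node n) (exponent n \<mu>)"
  by (simp add: shifted_alternant_def falling_det_def ffact_eq_falling node_def exponent_def)

lemma exponent_zero: "exponent n (\<lambda>_. 0) = (\<lambda>j. n - Suc j)"
  by (simp add: exponent_def fun_eq_iff)

lemma shifted_alternant_zero: "shifted_alternant n (\<lambda>_. 0) = falling_det n (node n) (\<lambda>j. n - Suc j)"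
  by (simp add: shifted_alternant_eq exponent_zero)

lemma ev_node: "ev a (node n i) = a i + of_nat (n - Suc i)"
  by (simp add: node_def ev_add ev.hom_of_nat)

lemma inj_node: "inj_on (node n) {..<n}"
proof (rule inj_onI)
  fix i k assume "i \<in> {..<n}" "k \<in> {..<n}" "node n i = node n k"
  from arg_cong[OF this(3), of "ev (\<lambda>_. 0)"] this(1,2) show "i = k"
    by (auto simp: ev_node)
qed

lemma shifted_alternant_zero_nonzero: "shifted_alternant n (\<lambda>_. 0) \<noteq> 0"
  unfolding shifted_alternant_zero by (rule falling_det_nonzero[OF inj_node])

lemma shifted_schur_poly_unique:
  assumes "q * shifted_alternant n (\<lambda>_. 0) = shifted_alternant n \<mu>"
  shows "shifted_schur_poly n \<mu> = q"
  unfolding shifted_schur_poly_def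
proof (rule the_equality)
  show "q' = q" if "q' * shifted_alternant n (\<lambda>_. 0) = shifted_alternant n \<mu>" for q'
    using mult_right_cancel[OF shifted_alternant_zero_nonzero[of n], of q' q] that assms by simp
qed (rule assms)

lemma shifted_schur_poly_eq: "shifted_schur_poly n \<mu> = dd_det n (node n) (exponent n \<mu>)"
  by (rule shifted_schur_poly_unique)
    (simp add: shifted_alternant_eq falling_det_eq[of n "node n" "exponent n \<mu>"] exponent_zero)

lemma shifted_schur_poly_mult:
  "shifted_schur_poly n \<mu> * shifted_alternant n (\<lambda>_. 0) = shifted_alternant n \<mu>"
  by (simp add: shifted_schur_poly_eq shifted_alternant_eq exponent_zero
      falling_det_eq[of n "node n" "exponent n \<mu>"])

lemma shifted_schur_poly_one_row:
  "n > 0 \<Longrightarrow> shifted_schur_poly n (one_row k) = dd (node n) (n - 1) (k + (n - 1))"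
  using dd_det_one_row[of n "node n" k]
  by (simp add: shifted_schur_poly_eq exponent_def[abs_def])

lemma vars_ddI: "(\<And>i. i \<le> l \<Longrightarrow> vars (v i) \<subseteq> S) \<Longrightarrow> vars (dd v l m) \<subseteq> S"
  by (induction v l m rule: dd.induct) (simp_all add: vars_addI vars_multI vars_diffI)

lemma vars_of_int [simp]: "vars (of_int k) = {}"
  using vars_Con[of "of_int k"] by (simp add: Con.hom_of_int)

lemma vars_detI:
  assumes "\<And>i j. i < n \<Longrightarrow> j < n \<Longrightarrow> vars (f (i, j)) \<subseteq> S"
  shows "vars (det (mat n n f)) \<subseteq> S"
  unfolding det_def'[OF mat_carrier]
proof (intro vars_sumI vars_multI vars_prodI)
  fix p i assume "p \<in> {p. p permutes {0..<n}}" "i \<in> {0..<n}"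
  moreover from this have "p i < n"
    using permutes_in_image[of p "{0..<n}" i] by simp
  ultimately show "vars (mat n n f $$ (i, p i)) \<subseteq> S"
    using assms by simp
qed simp

lemma vars_shifted_schur_poly: "vars (shifted_schur_poly n \<mu>) \<subseteq> {..<n}"
proof -
  have "vars (node n i) \<subseteq> {i}" for i
    unfolding node_def by (intro vars_addI) simp_all
  then show ?thesis
    unfolding shifted_schur_poly_eq dd_det_def
    by (intro vars_detI) (force intro!: vars_ddI)
qed

lemma degree_le_dd:
  assumes "\<And>i. degree_le (v i) 1" "l \<le> m"
  shows "degree_le (dd v l m) (m - l)"
  using assms
proof (induction v l m rule: dd.induct)
  case (2 v m)
  then show ?case
    using degree_le_mult[OF degree_le_diff[OF 2(2)[of 0] degree_le_of_nat[of m]], of "dd v 0 m" m]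
    by simp
next
  case (3 v l m)
  have "degree_le ((v (Suc l) - of_nat m) * dd v (Suc l) m) (m - l)"
  proof (cases "Suc l \<le> m")
    case True
    then show ?thesis
      using degree_le_mult[OF degree_le_diff[OF 3(3)[of "Suc l"] degree_le_of_nat[of m]] 3(1)[OF 3(3)]]
      by (simp add: Suc_diff_Suc)
  qed (simp add: dd_eq_0)
  with 3 show ?case
    by (auto intro: degree_le_add)
qed auto

text \<open>Each term of the determinant has total degree at most the difference of the sum of the
  exponents and the sum of the staircase, which is the number of boxes.\<close>

lemma degree_le_shifted_schur_poly: "degree_le (shifted_schur_poly n \<mu>) (\<Sum>i<n. \<mu> i)"
proof -
  let ?M = "mat n n (\<lambda>(l, j). dd (node n) (n - Suc l) (exponent n \<mu> j))"
  have node: "degree_le (node n i) 1" for i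
    unfolding node_def by (intro degree_le_add degree_le_X degree_le_of_nat)
  have "degree_le (of_int (sign p) * (\<Prod>i = 0..<n. ?M $$ (i, p i))) (\<Sum>i<n. \<mu> i)"
    if p: "p permutes {0..<n}" for p
  proof (cases "\<forall>i<n. n - Suc i \<le> exponent n \<mu> (p i)")
    case True
    have lt: "p i < n" if "i < n" for i
      using permutes_in_image[OF p, of i] that by simp
    have deg: "degree_le (\<Prod>i = 0..<n. ?M $$ (i, p i)) (\<Sum>i = 0..<n. exponent n \<mu> (p i) - (n - Suc i))"
    proof (rule degree_le_prod)
      fix i assume "i \<in> {0..<n}"
      then show "degree_le (?M $$ (i, p i)) (exponent n \<mu> (p i) - (n - Suc i))"
        using True lt degree_le_dd[of "node n" "n - Suc i" "exponent n \<mu> (p i)"] node by simp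
    qed
    have "(\<Sum>i = 0..<n. exponent n \<mu> (p i) - (n - Suc i)) + (\<Sum>i = 0..<n. n - Suc i) =
        (\<Sum>i = 0..<n. exponent n \<mu> (p i))"
      unfolding sum.distrib[symmetric] using True by (intro sum.cong) auto
    also have "\<dots> = (\<Sum>i = 0..<n. exponent n \<mu> i)"
      using sum.permute[OF p, of "exponent n \<mu>"] by (simp add: o_def)
    also have "\<dots> = (\<Sum>i<n. \<mu> i) + (\<Sum>i = 0..<n. n - Suc i)"
      by (simp only: exponent_def sum.distrib lessThan_atLeast0)
    finally have "(\<Sum>i = 0..<n. exponent n \<mu> (p i) - (n - Suc i)) = (\<Sum>i<n. \<mu> i)"
      by (rule add_right_imp_eq)
    with deg have "degree_le (\<Prod>i = 0..<n. ?M $$ (i, p i)) (\<Sum>i<n. \<mu> i)"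
      by (simp only:)
    then show ?thesis
      using degree_le_mult[of "of_int (sign p)" 0] degree_le_Con[of "of_int (sign p)" 0]
      by (fastforce simp: Con.hom_of_int)
  next
    case False
    then obtain i where "i < n" "exponent n \<mu> (p i) < n - Suc i"
      by (auto simp: not_le)
    with permutes_in_image[OF p, of i] have "(\<Prod>i = 0..<n. ?M $$ (i, p i)) = 0"
      by (intro prod_zero bexI[of _ i]) (auto simp: dd_eq_0)
    then show ?thesis by (simp only: mult_zero_right degree_le_0)
  qed
  then show ?thesis
    unfolding shifted_schur_poly_eq dd_det_def det_def'[OF mat_carrier]
    by (intro degree_le_sum) auto
qed

section \<open>Shifted Schur functions are shifted symmetric\<close>

lemma falling_det_cong: "(\<And>i. i < n \<Longrightarrow> v i = w i) \<Longrightarrow> falling_det n v m = falling_det n w m"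
  unfolding falling_det_def by (intro arg_cong[of _ _ det] eq_matI) auto

lemma falling_det_permute:
  assumes "\<pi> permutes {..<n}"
  shows "falling_det n (\<lambda>i. v (\<pi> i)) m = of_int (sign \<pi>) * falling_det n v m"
proof -
  have \<pi>: "\<pi> permutes {0..<n}"
    using assms by (simp add: lessThan_atLeast0)
  have "mat n n (\<lambda>(i, j). falling (m j) (v (\<pi> i))) =
      mat n n (\<lambda>(i, j). mat n n (\<lambda>(i, j). falling (m j) (v i)) $$ (\<pi> i, j))"
    using permutes_in_image[OF \<pi>] by (intro eq_matI) auto
  then show ?thesis
    unfolding falling_det_def by (simp add: det_permute_rows[OF _ \<pi>])
qed

lemma of_int_sign_square: "of_int (sign \<pi>) * of_int (sign \<pi>) = (1 :: 'a::comm_ring_1)"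
  by (simp flip: of_int_mult add: sign_idempotent)

lemma shifted_schur_poly_symmetric:
  "shifted_schur_poly n \<mu> \<in> shifted_symmetric_polys n"
proof -
  let ?shift = "\<lambda>i. X i - Con (of_nat (i + 1))"
  let ?unshift = "\<lambda>i. X i + Con (of_nat (i + 1))"
  let ?q = "shifted_schur_poly n \<mu>"
  let ?D = "\<lambda>\<mu>. falling_det n (\<lambda>i. X i + of_nat n) (exponent n \<mu>)"
  define g where "g = psubst ?unshift ?q"
  have alt: "psubst (\<lambda>i. X (\<pi> i)) (psubst ?unshift (shifted_alternant n \<nu>)) = of_int (sign \<pi>) * ?D \<nu>"
    if "\<pi> permutes {..<n}" for \<pi> \<nu>
  proof -
    have "psubst (\<lambda>i. X (\<pi> i)) (psubst ?unshift (node n i)) = X (\<pi> i) + of_nat n" if "i < n" for i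
    proof -
      have "of_nat (i + 1) + of_nat (n - Suc i) = (of_nat n :: cpoly)"
        unfolding of_nat_add[symmetric] using that by simp
      then show ?thesis
        by (simp only: node_def psubst_add psubst_X psubst_Con Con.hom_of_nat psubst_of_nat add.assoc)
    qed
    then have "psubst (\<lambda>i. X (\<pi> i)) (psubst ?unshift (shifted_alternant n \<nu>)) =
        falling_det n (\<lambda>i. X (\<pi> i) + of_nat n) (exponent n \<nu>)"
      by (auto simp: shifted_alternant_eq psubst.hom_falling_det intro: falling_det_cong)
    then show ?thesis
      using falling_det_permute[OF that, of "\<lambda>i. X i + of_nat n" "exponent n \<nu>"] by simp
  qed
  have alt_id: "psubst ?unshift (shifted_alternant n \<nu>) = ?D \<nu>" for \<nu>
    using alt[OF permutes_id, of \<nu>] by (simp add: sign_id)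
  have mult: "psubst (\<lambda>i. X (\<pi> i)) g * ?D (\<lambda>_. 0) = ?D \<mu>" if "\<pi> permutes {..<n}" for \<pi>
  proof -
    let ?s = "of_int (sign \<pi>) :: cpoly"
    have "psubst (\<lambda>i. X (\<pi> i)) (psubst ?unshift (?q * shifted_alternant n (\<lambda>_. 0))) =
        psubst (\<lambda>i. X (\<pi> i)) (psubst ?unshift (shifted_alternant n \<mu>))"
      by (simp only: shifted_schur_poly_mult)
    then have "psubst (\<lambda>i. X (\<pi> i)) g * (?s * ?D (\<lambda>_. 0)) = ?s * ?D \<mu>"
      by (simp only: psubst_mult alt[OF that] g_def)
    then have "?s * (psubst (\<lambda>i. X (\<pi> i)) g * (?s * ?D (\<lambda>_. 0))) = ?s * (?s * ?D \<mu>)"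
      by (rule arg_cong)
    then have "(?s * ?s) * (psubst (\<lambda>i. X (\<pi> i)) g * ?D (\<lambda>_. 0)) = (?s * ?s) * ?D \<mu>"
      by (simp only: mult_ac)
    then show ?thesis
      by (simp only: of_int_sign_square mult_1_left)
  qed
  have "inj_on (\<lambda>i. X i + of_nat n :: cpoly) {..<n}"
  proof (rule inj_onI)
    fix i k assume "X i + of_nat n = X k + (of_nat n :: cpoly)"
    then have "ev of_nat (X i) = ev of_nat (X k)" by simp
    then show "i = k" by simp
  qed
  then have nonzero: "?D (\<lambda>_. 0) \<noteq> 0"
    unfolding exponent_zero by (rule falling_det_nonzero)
  have "psubst (\<lambda>i. X (\<pi> i)) g = g" if "\<pi> permutes {..<n}" for \<pi>
  proof -
    have "psubst (\<lambda>i. X (\<pi> i)) g * ?D (\<lambda>_. 0) = g * ?D (\<lambda>_. 0)"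
      using mult[OF that] mult[OF permutes_id] by simp
    then show ?thesis
      using nonzero by (simp only: mult_right_cancel[OF nonzero])
  qed
  moreover have "vars g \<subseteq> {..<n}"
    unfolding g_def using vars_shifted_schur_poly[of n \<mu>]
    by (intro vars_psubstI vars_addI) auto
  ultimately have "g \<in> symmetric_polys n"
    by (simp add: symmetric_polys_def)
  moreover have "?q = psubst ?shift g"
    by (simp add: g_def psubst_psubst psubst_add psubst_X psubst_Con)
  ultimately show ?thesis
    unfolding shifted_symmetric_polys_def by blast
qed

lemma falling_zero: "falling m (0 :: 'a::comm_ring_1) = (if m = 0 then 1 else 0)"
proof (cases m)
  case (Suc k)
  have "falling m (0 :: 'a) = 0"
    unfolding falling_def using Suc by (intro prod_zero bexI[of _ 0]) auto
  with Suc show ?thesis by simp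
qed simp

lemma falling_Suc_add_1: "falling (Suc m) (x + 1) = (x + 1) * falling m x"
  unfolding falling_def by (subst prod.lessThan_Suc_shift) simp

lemma det_scale_rows: "det (mat n n (\<lambda>(i, j). c i * f i j)) = (\<Prod>i<n. c i) * det (mat n n (\<lambda>(i, j). f i j))"
proof -
  have "(\<Prod>i = 0..<n. mat n n (\<lambda>(i, j). c i * f i j) $$ (i, p i)) =
      (\<Prod>i<n. c i) * (\<Prod>i = 0..<n. mat n n (\<lambda>(i, j). f i j) $$ (i, p i))"
    if "p permutes {0..<n}" for p
    using permutes_in_image[OF that] by (simp add: prod.distrib lessThan_atLeast0)
  then show ?thesis
    unfolding det_def'[OF mat_carrier] by (simp add: sum_distrib_left mult.left_commute)
qed

lemma falling_det_drop:
  assumes "w n = 0" "\<And>i. i < n \<Longrightarrow> w i = v i + 1" "\<And>j. j < n \<Longrightarrow> m j = Suc (k j)"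
  shows "falling_det (Suc n) w m = (if m n = 0 then (\<Prod>i<n. v i + 1) * falling_det n v k else 0)"
proof -
  let ?A = "mat (Suc n) (Suc n) (\<lambda>(i, j). falling (m j) (w i))"
  have "falling_det (Suc n) w m = (\<Sum>j<Suc n. ?A $$ (n, j) * cofactor ?A n j)"
    unfolding falling_det_def by (rule laplace_expansion_row) auto
  also have "\<dots> = ?A $$ (n, n) * cofactor ?A n n"
    using assms(1,3) by (simp add: falling_zero)
  also have "cofactor ?A n n = det (mat n n (\<lambda>(i, j). (v i + 1) * falling (k j) (v i)))"
    using assms(2,3) unfolding cofactor_def mat_delete_def
    by (auto simp: falling_Suc_add_1 intro!: arg_cong[of _ _ det])
  also have "\<dots> = (\<Prod>i<n. v i + 1) * falling_det n v k"
    unfolding falling_det_def by (rule det_scale_rows)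
  finally show ?thesis
    using assms(1) by (simp add: falling_zero)
qed

text \<open>Setting the last variable to 0 makes the last row of both alternants vanish off the last
  column, and the remaining minors carry the same factor.\<close>

lemma shifted_schur_poly_drop:
  "psubst (\<lambda>i. if i = n then 0 else X i) (shifted_schur_poly (Suc n) \<mu>) =
    (if \<mu> n = 0 then shifted_schur_poly n \<mu> else 0)"
proof -
  let ?\<rho> = "psubst (\<lambda>i. if i = n then 0 else X i)"
  let ?c = "\<Prod>i<n. node n i + 1"
  have alt: "?\<rho> (shifted_alternant (Suc n) \<nu>) = (if \<nu> n = 0 then ?c * shifted_alternant n \<nu> else 0)" for \<nu>
  proof -
    have "?\<rho> (node (Suc n) i) = node n i + 1" if "i < n" for i
    proof -
      have "Suc n - Suc i = Suc (n - Suc i)"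
        using that by simp
      then show ?thesis
        using that by (simp add: node_def psubst_add psubst_X del: diff_Suc_Suc of_nat_diff)
    qed
    then show ?thesis
      unfolding shifted_alternant_eq psubst.hom_falling_det
      by (subst falling_det_drop[where v = "node n" and k = "exponent n \<nu>"])
        (auto simp: node_def psubst_add psubst_X exponent_def Suc_diff_Suc)
  qed
  have "ev (\<lambda>_. 0) ?c \<noteq> 0"
  proof -
    have "complex_of_nat k + 1 \<noteq> 0" for k
      using of_nat_neq_0[of k, where 'a = complex] by (simp add: add.commute)
    then show ?thesis
      by (simp add: ev.hom_prod ev_add ev_node del: of_nat_diff)
  qed
  then have c: "?c \<noteq> 0"
    by (metis ev.hom_zero)
  have "?\<rho> (shifted_schur_poly (Suc n) \<mu>) * (?c * shifted_alternant n (\<lambda>_. 0)) =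
      (if \<mu> n = 0 then ?c * shifted_alternant n \<mu> else 0)"
    unfolding alt[of \<mu>, symmetric] shifted_schur_poly_mult[of "Suc n" \<mu>, symmetric] psubst_mult
    by (simp only: alt[of "\<lambda>_. 0"] if_True simp_thms)
  also have "\<dots> = (if \<mu> n = 0 then shifted_schur_poly n \<mu> else 0) * (?c * shifted_alternant n (\<lambda>_. 0))"
    by (simp add: shifted_schur_poly_mult[of n \<mu>, symmetric] mult_ac)
  finally show ?thesis
    using c shifted_alternant_zero_nonzero[of n] by simp
qed

lemma num_rows_le_iff:
  assumes "young_diagram \<mu>"
  shows "num_rows \<mu> \<le> i \<longleftrightarrow> \<mu> i = 0"
proof -
  have anti: "antimono \<mu>" and fin: "finite {i. \<mu> i \<noteq> 0}"
    using assms by (auto simp: young_diagram_def)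
  show ?thesis
  proof
    assume "num_rows \<mu> \<le> i"
    show "\<mu> i = 0"
    proof (rule ccontr)
      assume "\<mu> i \<noteq> 0"
      then have "\<mu> k \<noteq> 0" if "k \<le> i" for k
        using antimonoD[OF anti that] by simp
      then have "{..i} \<subseteq> {i. \<mu> i \<noteq> 0}"
        by auto
      from card_mono[OF fin this] \<open>num_rows \<mu> \<le> i\<close> show False
        by (simp add: num_rows_def)
    qed
  next
    assume "\<mu> i = 0"
    then have "\<mu> k = 0" if "i \<le> k" for k
      using antimonoD[OF anti that] by simp
    then have "{i. \<mu> i \<noteq> 0} \<subseteq> {..<i}"
      by (metis (mono_tags, lifting) lessThan_iff linorder_not_le mem_Collect_eq subsetI)
    from card_mono[OF _ this] show "num_rows \<mu> \<le> i"
      by (simp add: num_rows_def)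
  qed
qed

text \<open>With one variable per row, setting the last variable to 0 makes the last row of the numerator
  vanish; so the components with fewer variables than rows, which are obtained from that one, are 0.\<close>

lemma shifted_schur_few_variables:
  assumes "young_diagram \<mu>" "n < num_rows \<mu>"
  shows "shifted_schur \<mu> n = 0"
proof -
  obtain k where k: "num_rows \<mu> = Suc k"
    using assms(2) by (cases "num_rows \<mu>") auto
  have "\<mu> k \<noteq> 0"
    using num_rows_le_iff[OF assms(1), of k] k by simp
  then have drop: "psubst (\<lambda>i. if i = k then 0 else X i) (shifted_schur_poly (Suc k) \<mu>) = 0"
    by (simp add: shifted_schur_poly_drop)
  have "psubst (\<lambda>i. if i < n then X i else 0) (shifted_schur_poly (Suc k) \<mu>) =
      psubst (\<lambda>i. if i < n then X i else 0)
        (psubst (\<lambda>i. if i = k then 0 else X i) (shifted_schur_poly (Suc k) \<mu>))"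
    unfolding psubst_psubst
    by (rule arg_cong[of _ _ "\<lambda>\<sigma>. psubst \<sigma> _"]) (use assms(2) k in \<open>auto simp: psubst_X psubst_zero\<close>)
  then show ?thesis
    using assms(2) k drop by (simp add: shifted_schur_def psubst_zero)
qed

lemma shifted_schur_in_shifted_symmetric:
  assumes "young_diagram \<mu>"
  shows "shifted_schur \<mu> \<in> shifted_symmetric"
proof -
  have zero: "0 \<in> shifted_symmetric_polys n" for n
    unfolding shifted_symmetric_polys_def symmetric_polys_def
    by (rule image_eqI[of _ _ 0]) (simp_all add: psubst_zero)
  have few: "shifted_schur \<mu> n = 0" if "n < num_rows \<mu>" for n
    by (rule shifted_schur_few_variables[OF assms that])
  have many: "shifted_schur \<mu> n = shifted_schur_poly n \<mu>" if "num_rows \<mu> \<le> n" for n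
    using that by (simp add: shifted_schur_def)
  have poly: "shifted_schur \<mu> n \<in> shifted_symmetric_polys n" for n
    using few[of n] many[of n] zero[of n] shifted_schur_poly_symmetric[of n \<mu>] by force
  have drop: "psubst (\<lambda>i. if i = n then 0 else X i) (shifted_schur \<mu> (Suc n)) = shifted_schur \<mu> n" for n
    using few[of n] few[of "Suc n"] many[of n] many[of "Suc n"] num_rows_le_iff[OF assms, of n]
    by (cases "num_rows \<mu> \<le> n"; cases "num_rows \<mu> \<le> Suc n")
      (auto simp: shifted_schur_poly_drop psubst_zero)
  have deg: "degree_le (shifted_schur \<mu> n) (\<Sum>i<num_rows \<mu>. \<mu> i)" for n
  proof (cases "num_rows \<mu> \<le> n")
    case True
    have "(\<Sum>i<num_rows \<mu>. \<mu> i) = (\<Sum>i<n. \<mu> i)"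
      using True num_rows_le_iff[OF assms] by (intro sum.mono_neutral_left) auto
    then show ?thesis
      using many[OF True] degree_le_shifted_schur_poly[of n \<mu>] by simp
  qed (use few[of n] in auto)
  show ?thesis
    unfolding shifted_symmetric_def
    by (intro CollectI conjI allI exI[of _ "\<Sum>i<num_rows \<mu>. \<mu> i"]) (rule poly drop deg)+
qed

lemma young_diagram_one_row [simp]: "young_diagram (one_row k)"
proof -
  have "{i. one_row k i \<noteq> 0} \<subseteq> {0}"
    by (auto simp: one_row_def)
  from finite_subset[OF this] show ?thesis
    by (auto simp: young_diagram_def one_row_def antimono_def)
qed

section \<open>Shifted power sums generate the shifted symmetric functions\<close>

text \<open>The subtracted constants are the values at \<open>x = 0\<close>; they make the sequence stable. The shift by
  \<open>1/2\<close> is the one for which transposition of diagrams becomes \<^const>\<open>omega\<close>.\<close>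

definition shifted_power_sum :: "nat \<Rightarrow> nat \<Rightarrow> cpoly" where
  "shifted_power_sum n k = (\<Sum>i<n. (X i - Con (of_nat i + 1 / 2)) ^ (k + 1) -
      Con ((- (of_nat i + 1 / 2)) ^ (k + 1)))"

definition psi :: "cpoly \<Rightarrow> cpoly_seq" where
  "psi g n = psubst (shifted_power_sum n) g"

definition translate :: "complex \<Rightarrow> cpoly \<Rightarrow> cpoly" where
  "translate c = psubst (\<lambda>i. X i + Con c)"

lemma translate_symmetric:
  assumes "g \<in> symmetric_polys n"
  shows "translate c g \<in> symmetric_polys n"
proof -
  have "psubst (\<lambda>i. X (\<pi> i)) (translate c g) = translate c g" if "\<pi> permutes {..<n}" for \<pi>
  proof -
    have "psubst (\<lambda>i. X (\<pi> i)) (translate c g) = translate c (psubst (\<lambda>i. X (\<pi> i)) g)"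
      by (simp add: translate_def psubst_psubst psubst_add psubst_X psubst_Con)
    also have "psubst (\<lambda>i. X (\<pi> i)) g = g"
      using assms that by (simp add: symmetric_polys_def)
    finally show ?thesis .
  qed
  moreover have "vars (translate c g) \<subseteq> {..<n}"
    using assms unfolding translate_def symmetric_polys_def
    by (intro vars_psubstI vars_addI) auto
  ultimately show ?thesis
    by (simp add: symmetric_polys_def)
qed

lemma degree_le_translate: "degree_le g d \<Longrightarrow> degree_le (translate c g) d"
  unfolding translate_def by (intro degree_le_psubst degree_le_add degree_le_X degree_le_Con)

text \<open>Every shift \<open>X i - i - c\<close> gives the same algebra: \<open>c = 1\<close> in the definition,
  \<open>c = 1/2\<close> for the power sums, and \<open>c = - n\<close> for restriction to fewer variables.\<close>

lemma shifted_symmetric_polys_shift: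
  assumes "f \<in> shifted_symmetric_polys n"
  obtains g where "g \<in> symmetric_polys n" "f = psubst (\<lambda>i. X i - Con (of_nat i + c)) g"
    "\<And>d. degree_le f d \<Longrightarrow> degree_le g d"
proof -
  obtain h where h: "h \<in> symmetric_polys n" "f = psubst (\<lambda>i. X i - Con (of_nat (i + 1))) h"
    using assms by (auto simp: shifted_symmetric_polys_def)
  have inv: "h = psubst (\<lambda>i. X i + Con (of_nat (i + 1))) f"
    by (simp add: h(2) psubst_psubst psubst_add psubst.hom_minus psubst_X psubst_Con)
  show ?thesis
  proof (rule that[of "translate (c - 1) h"])
    show "translate (c - 1) h \<in> symmetric_polys n"
      by (rule translate_symmetric[OF h(1)])
    have "X i - Con (of_nat i + c) + Con (c - 1) = X i - Con (of_nat (i + 1))" for i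
      by (simp add: Con_add Con.hom_minus)
    then show "f = psubst (\<lambda>i. X i - Con (of_nat i + c)) (translate (c - 1) h)"
      by (simp only: h(2) translate_def psubst_psubst psubst_add psubst_X psubst_Con)
    show "degree_le (translate (c - 1) h) d" if "degree_le f d" for d
    proof (rule degree_le_translate)
      show "degree_le h d"
        unfolding inv by (intro degree_le_psubst that degree_le_add degree_le_X degree_le_Con)
    qed
  qed
qed

lemma shifted_symmetric_polysI:
  assumes "g \<in> symmetric_polys n"
  shows "psubst (\<lambda>i. X i - Con (of_nat i + c)) g \<in> shifted_symmetric_polys n"
proof -
  have "X i - Con (of_nat (i + 1)) + Con (1 - c) = X i - Con (of_nat i + c)" for i
    by (simp add: Con_add Con.hom_minus)
  then have "psubst (\<lambda>i. X i - Con (of_nat i + c)) g =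
      psubst (\<lambda>i. X i - Con (of_nat (i + 1))) (translate (1 - c) g)"
    by (simp only: translate_def psubst_psubst psubst_add psubst_X psubst_Con)
  then show ?thesis
    unfolding shifted_symmetric_polys_def using translate_symmetric[OF assms] by blast
qed

lemma psi_shifted_symmetric_polys: "psi g n \<in> shifted_symmetric_polys n"
proof -
  define Q where "Q k = (\<Sum>i<n. X i ^ (k + 1) - Con ((- (of_nat i + 1 / 2)) ^ (k + 1)))" for k :: nat
  have "psubst (\<lambda>i. X i - Con (of_nat i + 1 / 2)) (Q k) = shifted_power_sum n k" for k
    by (simp only: Q_def shifted_power_sum_def psubst.hom_sum psubst.hom_minus psubst.hom_power
        psubst_X psubst_Con)
  then have "psi g n = psubst (\<lambda>i. X i - Con (of_nat i + 1 / 2)) (psubst Q g)"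
    by (simp add: psi_def psubst_psubst)
  moreover have "psubst Q g \<in> symmetric_polys n"
  proof -
    have "psubst (\<lambda>i. X (\<pi> i)) (Q k) = Q k" if "\<pi> permutes {..<n}" for \<pi> k
    proof -
      have "(\<Sum>i<n. X (\<pi> i) ^ (k + 1)) = (\<Sum>i<n. X i ^ (k + 1))"
        using sum.permute[OF that, of "\<lambda>i. X i ^ (k + 1)"] by (simp add: o_def)
      then show ?thesis
        by (simp only: Q_def psubst.hom_sum psubst.hom_minus psubst.hom_power psubst_X psubst_Con
            sum_subtractf)
    qed
    moreover have "vars (Q k) \<subseteq> {..<n}" for k
      unfolding Q_def by (intro vars_sumI vars_diffI vars_powerI) auto
    ultimately show ?thesis
      by (simp add: symmetric_polys_def psubst_psubst vars_psubstI)
  qed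
  ultimately show ?thesis
    by (simp only: shifted_symmetric_polysI)
qed

lemma shifted_power_sum_drop:
  "psubst (\<lambda>i. if i = n then 0 else X i) (shifted_power_sum (Suc n) k) = shifted_power_sum n k"
proof -
  let ?c = "of_nat n + 1 / 2 :: complex"
  have last: "(0 - Con ?c) ^ (k + 1) = Con ((- ?c) ^ (k + 1))"
    by (simp only: Con.hom_power Con.hom_uminus diff_0)
  have "psubst (\<lambda>i. if i = n then 0 else X i) (shifted_power_sum (Suc n) k) =
      (\<Sum>i<n. ((if i = n then 0 else X i) - Con (of_nat i + 1 / 2)) ^ (k + 1) -
        Con ((- (of_nat i + 1 / 2)) ^ (k + 1))) + ((0 - Con ?c) ^ (k + 1) - Con ((- ?c) ^ (k + 1)))"
    by (simp only: shifted_power_sum_def sum.lessThan_Suc psubst_add psubst.hom_sum psubst.hom_minus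
        psubst.hom_power psubst_X psubst_Con if_True simp_thms)
  also have "\<dots> = shifted_power_sum n k"
    unfolding last shifted_power_sum_def by (simp cong: sum.cong_simp)
  finally show ?thesis .
qed

text \<open>The filtration of the symmetric functions in which the power sum of degree \<open>k\<close> has degree at most
  \<open>k\<close>, read off from the ordinary degrees of all components.\<close>

definition psi_degree_le :: "cpoly \<Rightarrow> nat \<Rightarrow> bool" where
  "psi_degree_le g d \<longleftrightarrow> (\<forall>n. degree_le (psi g n) d)"

lemma psi_Con: "psi (Con c) n = Con c" and psi_X: "psi (X k) n = shifted_power_sum n k"
  and psi_add: "psi (f + g) n = psi f n + psi g n"
  and psi_diff: "psi (f - g) n = psi f n - psi g n"
  and psi_mult: "psi (f * g) n = psi f n * psi g n"
  by (simp_all add: psi_def psubst_Con psubst_X psubst_add psubst_mult psubst.hom_minus)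

lemma psi_degree_le_Con: "psi_degree_le (Con c) d"
  by (simp add: psi_degree_le_def psi_Con)

lemma psi_degree_le_X: "psi_degree_le (X k) (k + 1)"
  unfolding psi_degree_le_def psi_X shifted_power_sum_def
  using degree_le_power[OF degree_le_diff[OF degree_le_X degree_le_Con], of _ _ "k + 1"]
  by (intro allI degree_le_sum degree_le_diff degree_le_Con) simp

lemma psi_degree_le_add: "psi_degree_le f d \<Longrightarrow> psi_degree_le g d \<Longrightarrow> psi_degree_le (f + g) d"
  and psi_degree_le_diff: "psi_degree_le f d \<Longrightarrow> psi_degree_le g d \<Longrightarrow> psi_degree_le (f - g) d"
  and psi_degree_le_mult: "psi_degree_le f d \<Longrightarrow> psi_degree_le g e \<Longrightarrow> psi_degree_le (f * g) (d + e)"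
  by (simp_all add: psi_degree_le_def psi_add psi_diff psi_mult degree_le_add degree_le_diff
      degree_le_mult)

lemma psi_degree_le_mono: "psi_degree_le f d \<Longrightarrow> d \<le> d' \<Longrightarrow> psi_degree_le f d'"
  unfolding psi_degree_le_def using degree_le_mono by blast

lemma psi_in_shifted_symmetric: "psi g \<in> shifted_symmetric"
proof -
  have "psubst (\<lambda>i. if i = n then 0 else X i) (psi g (Suc n)) = psi g n" for n
    by (simp add: psi_def psubst_psubst shifted_power_sum_drop)
  moreover have "\<exists>d. psi_degree_le g d"
  proof (induction g rule: cpoly_induct_ring)
    case (add f g)
    then obtain d e where "psi_degree_le f d" "psi_degree_le g e" by blast
    then have "psi_degree_le f (max d e)" "psi_degree_le g (max d e)"
      by (auto elim: psi_degree_le_mono)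
    then show ?case
      using psi_degree_le_add by blast
  qed (use psi_degree_le_Con psi_degree_le_X psi_degree_le_mult in blast)+
  ultimately show ?thesis
    using psi_shifted_symmetric_polys by (simp add: shifted_symmetric_def psi_degree_le_def)
qed

text \<open>Only the component in \<open>n\<close> variables is prescribed, but the degree bound holds in every number of
  variables; this is what allows the other components to be compared afterwards.\<close>

definition psi_image :: "nat \<Rightarrow> nat \<Rightarrow> cpoly set" where
  "psi_image n d = {psi g n | g. psi_degree_le g d}"

lemma psi_image_Con: "Con c \<in> psi_image n d"
  unfolding psi_image_def using psi_degree_le_Con[of c d] psi_Con[of c n] by force

lemma psi_imageI: "psi_degree_le g d \<Longrightarrow> psi g n = f \<Longrightarrow> f \<in> psi_image n d"
  by (auto simp: psi_image_def)

lemma psi_imageE: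
  assumes "f \<in> psi_image n d"
  obtains g where "psi_degree_le g d" "f = psi g n"
  using assms by (auto simp: psi_image_def)

lemma psi_image_add: "f \<in> psi_image n d \<Longrightarrow> g \<in> psi_image n d \<Longrightarrow> f + g \<in> psi_image n d"
  by (elim psi_imageE) (simp add: psi_imageI[OF psi_degree_le_add psi_add])

lemma psi_image_diff: "f \<in> psi_image n d \<Longrightarrow> g \<in> psi_image n d \<Longrightarrow> f - g \<in> psi_image n d"
  by (elim psi_imageE) (simp add: psi_imageI[OF psi_degree_le_diff psi_diff])

lemma psi_image_mult: "f \<in> psi_image n d \<Longrightarrow> g \<in> psi_image n e \<Longrightarrow> f * g \<in> psi_image n (d + e)"
  by (elim psi_imageE) (simp add: psi_imageI[OF psi_degree_le_mult psi_mult])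

lemma psi_image_mono: "f \<in> psi_image n d \<Longrightarrow> d \<le> d' \<Longrightarrow> f \<in> psi_image n d'"
  by (elim psi_imageE) (simp add: psi_imageI[OF psi_degree_le_mono])

lemma psi_image_sum: "(\<And>x. x \<in> A \<Longrightarrow> f x \<in> psi_image n d) \<Longrightarrow> sum f A \<in> psi_image n d"
  using psi_image_Con[of 0]
  by (induction A rule: infinite_finite_induct) (simp_all add: psi_image_add)

lemma psi_image_power_sum: "(\<Sum>i<n. (X i - Con (of_nat i + 1 / 2)) ^ b) \<in> psi_image n b"
proof (cases b)
  case 0
  then show ?thesis
    using psi_image_Con[of "of_nat n"] by (simp add: Con.hom_of_nat)
next
  case (Suc k)
  let ?c = "\<Sum>i<n. (- (of_nat i + 1 / 2 :: complex)) ^ (k + 1)"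
  have "psi (X k + Con ?c) n = (\<Sum>i<n. (X i - Con (of_nat i + 1 / 2)) ^ b)"
    unfolding psi_add psi_X psi_Con
    by (simp only: shifted_power_sum_def sum_subtractf Con.hom_sum Suc Suc_eq_plus1 diff_add_cancel)
  moreover have "psi_degree_le (X k + Con ?c) b"
    using psi_degree_le_add[OF psi_degree_le_X psi_degree_le_Con, of k] Suc by simp
  ultimately show ?thesis
    by (intro psi_imageI)
qed

definition distinct_lists :: "nat \<Rightarrow> nat \<Rightarrow> nat list set" where
  "distinct_lists n r = {xs. length xs = r \<and> distinct xs \<and> set xs \<subseteq> {..<n}}"

lemma finite_distinct_lists: "finite (distinct_lists n r)"
  unfolding distinct_lists_def
  by (rule finite_subset[OF _ finite_lists_length_eq[of "{..<n}" r]]) auto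

lemma sum_distinct_lists_Suc:
  "(\<Sum>xs\<in>distinct_lists n (Suc r). f xs) = (\<Sum>xs\<in>distinct_lists n r. \<Sum>i\<in>{..<n} - set xs. f (i # xs))"
proof -
  have "(\<Sum>xs\<in>distinct_lists n r. \<Sum>i\<in>{..<n} - set xs. f (i # xs)) =
      (\<Sum>(xs, i)\<in>(SIGMA xs:distinct_lists n r. {..<n} - set xs). f (i # xs))"
    by (rule sum.Sigma) (simp_all add: finite_distinct_lists)
  also have "\<dots> = (\<Sum>xs\<in>distinct_lists n (Suc r). f xs)"
    by (rule sum.reindex_bij_witness[where i = "\<lambda>xs. (tl xs, hd xs)" and j = "\<lambda>(xs, i). i # xs"])
      (auto simp: distinct_lists_def length_Suc_conv)
  finally show ?thesis by simp
qed

text \<open>Monomial symmetric functions, with one summand for each injection of the index set of the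
  exponents into the variables. Exponents may be 0, so that a list of length \<open>n\<close> describes any monomial
  in \<open>n\<close> variables.\<close>

definition monomial_sum :: "nat \<Rightarrow> (nat \<Rightarrow> cpoly) \<Rightarrow> nat list \<Rightarrow> cpoly" where
  "monomial_sum n z as = (\<Sum>xs\<in>distinct_lists n (length as). \<Prod>j<length as. z (xs ! j) ^ (as ! j))"

text \<open>The new index runs over all variables except those already used; each exception merges the new
  exponent with an old one. This expresses monomial symmetric functions by power sums, by induction on
  the number of exponents.\<close>

lemma monomial_sum_Cons:
  "monomial_sum n z (b # as) = (\<Sum>i<n. z i ^ b) * monomial_sum n z as -
     (\<Sum>j<length as. monomial_sum n z (as[j := as ! j + b]))"
proof -
  let ?r = "length as"
  let ?m = "\<lambda>xs. \<Prod>j<?r. z (xs ! j) ^ (as ! j)"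
  have update: "z (xs ! j) ^ b * ?m xs = (\<Prod>k<?r. z (xs ! k) ^ (as[j := as ! j + b] ! k))"
    if "j < ?r" for xs j
  proof -
    have "(\<Prod>k<?r. z (xs ! k) ^ (as[j := as ! j + b] ! k)) =
        (\<Prod>k<?r. (if k = j then z (xs ! j) ^ b else 1) * z (xs ! k) ^ (as ! k))"
      by (intro prod.cong) (auto simp: nth_list_update power_add)
    also have "\<dots> = z (xs ! j) ^ b * ?m xs"
      using that by (simp add: prod.distrib)
    finally show ?thesis by simp
  qed
  have compl: "(\<Sum>i\<in>{..<n} - set xs. z i ^ b) = (\<Sum>i<n. z i ^ b) - (\<Sum>j<?r. z (xs ! j) ^ b)"
    if "xs \<in> distinct_lists n ?r" for xs
  proof -
    have xs: "length xs = ?r" "distinct xs" "set xs \<subseteq> {..<n}"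
      using that by (auto simp: distinct_lists_def)
    have "(\<Sum>i\<in>set xs. z i ^ b) = (\<Sum>j<?r. z (xs ! j) ^ b)"
      using sum.reindex_bij_betw[OF bij_betw_nth[OF xs(2) refl refl], of "\<lambda>i. z i ^ b"] xs(1) by simp
    then show ?thesis
      using sum_diff[of "{..<n}" "set xs" "\<lambda>i. z i ^ b"] xs(3) by simp
  qed
  have "monomial_sum n z (b # as) =
      (\<Sum>xs\<in>distinct_lists n ?r. \<Sum>i\<in>{..<n} - set xs. z i ^ b * ?m xs)"
    unfolding monomial_sum_def length_Cons sum_distinct_lists_Suc
    by (simp add: prod.lessThan_Suc_shift del: prod.lessThan_Suc)
  also have "\<dots> = (\<Sum>xs\<in>distinct_lists n ?r. (\<Sum>i<n. z i ^ b) * ?m xs - (\<Sum>j<?r. z (xs ! j) ^ b * ?m xs))"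
    by (intro sum.cong refl) (simp add: sum_distrib_right[symmetric] compl left_diff_distrib)
  also have "\<dots> = (\<Sum>i<n. z i ^ b) * monomial_sum n z as -
      (\<Sum>j<?r. \<Sum>xs\<in>distinct_lists n ?r. z (xs ! j) ^ b * ?m xs)"
    unfolding monomial_sum_def sum_subtractf sum_distrib_left by (subst (2) sum.swap) simp
  also have "(\<Sum>j<?r. \<Sum>xs\<in>distinct_lists n ?r. z (xs ! j) ^ b * ?m xs) =
      (\<Sum>j<?r. monomial_sum n z (as[j := as ! j + b]))"
    unfolding monomial_sum_def by (intro sum.cong refl) (simp_all add: update)
  finally show ?thesis .
qed

lemma psi_image_monomial_sum:
  "monomial_sum n (\<lambda>i. X i - Con (of_nat i + 1 / 2)) as \<in> psi_image n (sum_list as)"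
proof (induction "length as" arbitrary: as)
  case 0
  moreover have "distinct_lists n 0 = {[]}"
    by (auto simp: distinct_lists_def)
  ultimately show ?case
    using psi_image_Con[of 1] by (simp add: monomial_sum_def)
next
  case (Suc r)
  then obtain b cs where as: "as = b # cs" and r: "length cs = r"
    by (cases as) auto
  have "monomial_sum n (\<lambda>i. X i - Con (of_nat i + 1 / 2)) (cs[j := cs ! j + b]) \<in>
      psi_image n (b + sum_list cs)" if "j < length cs" for j
    using Suc(1)[of "cs[j := cs ! j + b]"] r that by (simp add: sum_list_update add.commute)
  then have "(\<Sum>j<length cs. monomial_sum n (\<lambda>i. X i - Con (of_nat i + 1 / 2)) (cs[j := cs ! j + b])) \<in>
      psi_image n (b + sum_list cs)"
    by (intro psi_image_sum) simp
  then show ?case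
    unfolding as monomial_sum_Cons sum_list.Cons
    using Suc(1)[of cs] r by (intro psi_image_diff psi_image_mult[OF psi_image_power_sum]) simp_all
qed

lemma sum_permutations_eq_monomial_sum:
  "(\<Sum>\<pi> | \<pi> permutes {..<n}. \<Prod>i<n. z (\<pi> i) ^ e i) = monomial_sum n z (map e [0..<n])"
  unfolding monomial_sum_def
proof (rule sum.reindex_bij_witness[where j = "\<lambda>\<pi>. map \<pi> [0..<n]" and
      i = "\<lambda>xs i. if i < n then xs ! i else i"], goal_cases)
  case (1 \<pi>)
  then have "\<pi> i = i" if "\<not> i < n" for i
    using that by (auto simp: permutes_def)
  then show ?case by auto
next
  case (2 \<pi>)
  then have "\<pi> permutes {0..<n}"
    by (simp add: lessThan_atLeast0)
  from permutes_inj_on[OF this, of "{0..<n}"] permutes_image[OF this] show ?case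
    by (simp add: distinct_lists_def distinct_map lessThan_atLeast0)
next
  case (3 xs)
  then show ?case
    by (auto simp: distinct_lists_def intro: nth_equalityI)
next
  case (4 xs)
  then have xs: "length xs = n" "distinct xs" "set xs \<subseteq> {..<n}"
    by (auto simp: distinct_lists_def)
  have "set xs = {..<n}"
    using xs by (intro card_subset_eq) (simp_all add: distinct_card)
  then have "bij_betw (nth xs) {..<n} {..<n}"
    using bij_betw_nth[OF xs(2) refl refl] xs(1) by simp
  then have "bij_betw (\<lambda>i. if i < n then xs ! i else i) {..<n} {..<n}"
    by (subst bij_betw_cong[where g = "nth xs"]) auto
  from bij_imp_permutes[OF this] show ?case
    by simp
next
  case (5 \<pi>)
  then show ?case by simp
qed

text \<open>A symmetric polynomial is the average of its permuted copies, hence a combination of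
  monomial symmetric functions.\<close>

lemma shifted_symmetric_polys_psi_image:
  assumes "f \<in> shifted_symmetric_polys n" "degree_le f d"
  shows "f \<in> psi_image n d"
proof -
  let ?z = "\<lambda>i. X i - Con (of_nat i + 1 / 2)"
  let ?P = "{\<pi>. \<pi> permutes {..<n}}"
  obtain g where g: "g \<in> symmetric_polys n" "f = psubst ?z g" "degree_le g d"
    using shifted_symmetric_polys_shift[OF assms(1), where c = "1 / 2"] assms(2) by metis
  have perm: "f = psubst (\<lambda>i. ?z (\<pi> i)) g" if "\<pi> \<in> ?P" for \<pi>
  proof -
    have "g = psubst (\<lambda>i. X (\<pi> i)) g"
      using g(1) that by (simp add: symmetric_polys_def)
    then have "f = psubst ?z (psubst (\<lambda>i. X (\<pi> i)) g)"
      using g(2) by simp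
    then show ?thesis
      by (simp only: psubst_psubst psubst_X)
  qed
  have expand: "psubst (\<lambda>i. ?z (\<pi> i)) g = (\<Sum>m\<in>Poly_Mapping.keys g.
      Con (Poly_Mapping.lookup g m) * (\<Prod>i<n. ?z (\<pi> i) ^ Poly_Mapping.lookup m i))" for \<pi>
  proof -
    have "Poly_Mapping.keys m \<subseteq> {..<n}" if "m \<in> Poly_Mapping.keys g" for m
      using g(1) that by (auto simp: symmetric_polys_def vars_def)
    then show ?thesis
      unfolding psubst_def by (intro sum.cong refl) (simp add: prod_lookup_superset)
  qed
  have "of_nat (fact n) * f = (\<Sum>\<pi>\<in>?P. f)"
    by (simp add: card_permutations[of _ n])
  also have "\<dots> = (\<Sum>\<pi>\<in>?P. psubst (\<lambda>i. ?z (\<pi> i)) g)"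
    by (rule sum.cong[OF refl perm])
  also have "\<dots> = (\<Sum>m\<in>Poly_Mapping.keys g. Con (Poly_Mapping.lookup g m) *
      monomial_sum n ?z (map (Poly_Mapping.lookup m) [0..<n]))"
    unfolding expand sum_permutations_eq_monomial_sum[where z = ?z, symmetric] sum_distrib_left
    by (rule sum.swap)
  also have "\<dots> \<in> psi_image n d"
  proof (rule psi_image_sum)
    fix m assume m: "m \<in> Poly_Mapping.keys g"
    then have "Poly_Mapping.keys m \<subseteq> {..<n}"
      using g(1) by (auto simp: symmetric_polys_def vars_def)
    then have "mdeg m = (\<Sum>i<n. Poly_Mapping.lookup m i)"
      unfolding mdeg_def by (intro sum.mono_neutral_left) (auto simp: in_keys_iff)
    then have "sum_list (map (Poly_Mapping.lookup m) [0..<n]) = mdeg m"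
      by (simp add: interv_sum_list_conv_sum_set_nat lessThan_atLeast0)
    then have "0 + sum_list (map (Poly_Mapping.lookup m) [0..<n]) \<le> d"
      using g(3) m by (simp add: degree_le_def)
    then show "Con (Poly_Mapping.lookup g m) *
        monomial_sum n ?z (map (Poly_Mapping.lookup m) [0..<n]) \<in> psi_image n d"
      using psi_image_mult[OF psi_image_Con psi_image_monomial_sum] psi_image_mono by blast
  qed
  finally have "Con (1 / fact n) * (of_nat (fact n) * f) \<in> psi_image n (0 + d)"
    by (intro psi_image_mult psi_image_Con)
  moreover have "Con (1 / fact n) * of_nat (fact n) = 1"
  proof -
    have "Con (1 / fact n) * of_nat (fact n) = Con (1 / fact n * of_nat (fact n))"
      by (simp only: Con_mult Con.hom_of_nat)
    then show ?thesis by simp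
  qed
  ultimately show ?thesis
    by (metis add_0 mult.assoc mult_1)
qed

lemma lookup_psubst_zero:
  "Poly_Mapping.lookup (psubst (\<lambda>i. if i = j then 0 else X i) f) m =
    (if j \<in> Poly_Mapping.keys m then 0 else Poly_Mapping.lookup f m)"
proof (induction f rule: cpoly_induct)
  case (single k c)
  show ?case
  proof (cases "j \<in> Poly_Mapping.keys k")
    case True
    then have "(\<Prod>i\<in>Poly_Mapping.keys k. (if i = j then 0 else X i) ^ Poly_Mapping.lookup k i) = 0"
      by (intro prod_zero bexI[of _ j]) (simp_all add: in_keys_iff)
    then have "psubst (\<lambda>i. if i = j then 0 else X i) (Poly_Mapping.single k c) = 0"
      by (simp only: psubst_single mult_zero_right)
    with True show ?thesis
      by (auto simp: lookup_single when_def)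
  next
    case False
    then have "(\<Prod>i\<in>Poly_Mapping.keys k. (if i = j then 0 else X i) ^ Poly_Mapping.lookup k i) =
        (\<Prod>i\<in>Poly_Mapping.keys k. X i ^ Poly_Mapping.lookup k i)"
      by (intro prod.cong) auto
    then have "psubst (\<lambda>i. if i = j then 0 else X i) (Poly_Mapping.single k c) = Poly_Mapping.single k c"
      by (simp only: psubst_single single_eq_Con_prod[of k c, symmetric])
    with False show ?thesis
      by (auto simp: lookup_single when_def)
  qed
qed (simp add: psubst_add lookup_add)

text \<open>In the coordinates in which the last variable is \<open>X n\<close> itself, every monomial contains the
  last variable, hence by symmetry all \<open>n + 1\<close> variables; this exceeds the degree.\<close>

lemma shifted_symmetric_poly_eq_0:
  assumes "f \<in> shifted_symmetric_polys (Suc n)" "degree_le f n"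
    and "psubst (\<lambda>i. if i = n then 0 else X i) f = 0"
  shows "f = 0"
proof -
  let ?z = "\<lambda>i. X i - Con (of_nat i + - of_nat n)"
  let ?kill = "\<lambda>j. psubst (\<lambda>i. if i = j then 0 else X i)"
  obtain g where g: "g \<in> symmetric_polys (Suc n)" "f = psubst ?z g" "degree_le g n"
    using shifted_symmetric_polys_shift[OF assms(1), where c = "- of_nat n"] assms(2) by metis
  have "?kill n g = psubst (\<lambda>i. X i + Con (of_nat i + - of_nat n)) (?kill n f)"
    unfolding g(2) psubst_psubst
    by (rule arg_cong[of _ _ "\<lambda>\<sigma>. psubst \<sigma> g"])
      (auto simp: fun_eq_iff psubst.hom_minus psubst_add psubst_X psubst_Con psubst_zero)
  then have kill: "?kill n g = 0"
    using assms(3) by (simp add: psubst_zero)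
  have "?kill j g = 0" if "j < Suc n" for j
  proof -
    let ?\<tau> = "Transposition.transpose j n"
    have "?\<tau> permutes {..<Suc n}"
      using that by (intro permutes_swap_id) auto
    then have "?kill j g = ?kill j (psubst (\<lambda>i. X (?\<tau> i)) g)"
      using g(1) by (simp add: symmetric_polys_def)
    also have "\<dots> = psubst (\<lambda>i. X (?\<tau> i)) (?kill n g)"
      unfolding psubst_psubst
      by (rule arg_cong[of _ _ "\<lambda>\<sigma>. psubst \<sigma> g"])
        (auto simp: fun_eq_iff psubst_X psubst_zero Transposition.transpose_def)
    finally show ?thesis
      by (simp add: kill psubst_zero)
  qed
  have all: "{..<Suc n} \<subseteq> Poly_Mapping.keys m" if "m \<in> Poly_Mapping.keys g" for m
  proof
    fix j assume "j \<in> {..<Suc n}"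
    then have "Poly_Mapping.lookup (?kill j g) m = 0"
      using \<open>\<And>j. j < Suc n \<Longrightarrow> ?kill j g = 0\<close> by simp
    then show "j \<in> Poly_Mapping.keys m"
      using that unfolding lookup_psubst_zero in_keys_iff[of m g] by (auto split: if_splits)
  qed
  have "m \<notin> Poly_Mapping.keys g" for m
  proof
    assume m: "m \<in> Poly_Mapping.keys g"
    have "Suc n = (\<Sum>i\<in>{..<Suc n}. 1)" by simp
    also have "\<dots> \<le> (\<Sum>i\<in>{..<Suc n}. Poly_Mapping.lookup m i)"
      using all[OF m] by (intro sum_mono) (auto simp: in_keys_iff Suc_le_eq)
    also have "\<dots> \<le> mdeg m"
      unfolding mdeg_def using all[OF m] by (intro sum_mono2) auto
    also have "mdeg m \<le> n"
      using g(3) m by (simp add: degree_le_def)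
    finally show False by simp
  qed
  then have "g = 0"
    by (metis all_not_in_conv keys_eq_empty)
  then show ?thesis
    by (simp add: g(2) psubst_zero)
qed

lemma shifted_symmetric_polys_diff:
  assumes "f \<in> shifted_symmetric_polys n" "g \<in> shifted_symmetric_polys n"
  shows "f - g \<in> shifted_symmetric_polys n"
proof -
  obtain f' g' where fg: "f' \<in> symmetric_polys n" "f = psubst (\<lambda>i. X i - Con (of_nat (i + 1))) f'"
      "g' \<in> symmetric_polys n" "g = psubst (\<lambda>i. X i - Con (of_nat (i + 1))) g'"
    using assms unfolding shifted_symmetric_polys_def by blast
  then have "f' - g' \<in> symmetric_polys n"
    by (simp add: symmetric_polys_def vars_diffI psubst.hom_minus)
  moreover have "f - g = psubst (\<lambda>i. X i - Con (of_nat (i + 1))) (f' - g')"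
    by (simp only: fg psubst.hom_minus)
  ultimately show ?thesis
    unfolding shifted_symmetric_polys_def by blast
qed

text \<open>It suffices to represent the component with as many variables as the degree: the other
  components follow from it by the preceding lemma and by stability.\<close>

theorem psi_surj:
  assumes "f \<in> shifted_symmetric"
  shows "\<exists>g. psi g = f"
proof -
  let ?drop = "\<lambda>n. psubst (\<lambda>i. if i = n then 0 else X i)"
  obtain d where d: "\<And>n. degree_le (f n) d"
    using assms by (auto simp: shifted_symmetric_def)
  have f: "f n \<in> shifted_symmetric_polys n" "?drop n (f (Suc n)) = f n" for n
    using assms by (auto simp: shifted_symmetric_def)
  obtain g where g: "psi_degree_le g d" "f d = psi g d"
    using shifted_symmetric_polys_psi_image[OF f(1) d, of d] by (elim psi_imageE)
  define e where "e n = f n - psi g n" for n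
  have e_drop: "?drop n (e (Suc n)) = e n" for n
  proof -
    have "?drop n (psi g (Suc n)) = psi g n"
      using psi_in_shifted_symmetric[of g] by (simp only: shifted_symmetric_def mem_Collect_eq)
    then show ?thesis
      by (simp only: e_def psubst.hom_minus f(2))
  qed
  have e_deg: "degree_le (e n) d" for n
    unfolding e_def by (rule degree_le_diff[OF d]) (use g(1) in \<open>simp add: psi_degree_le_def\<close>)
  have e_sym: "e n \<in> shifted_symmetric_polys n" for n
    unfolding e_def by (intro shifted_symmetric_polys_diff f psi_shifted_symmetric_polys)
  have "e n = 0" for n
  proof (cases "d \<le> n")
    case True
    then show ?thesis
    proof (induction n rule: dec_induct)
      case base
      show ?case by (simp add: e_def g)
    next
      case (step n)
      show ?case
        by (rule shifted_symmetric_poly_eq_0[OF e_sym degree_le_mono[OF e_deg step.hyps(1)]])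
          (simp only: e_drop step.IH)
    qed
  next
    case False
    then have "n \<le> d" by simp
    then show ?thesis
    proof (induction n rule: inc_induct)
      case base
      show ?case by (simp add: e_def g)
    next
      case (step n)
      have "e n = ?drop n (e (Suc n))"
        by (rule e_drop [symmetric])
      then show ?case
        by (simp only: step.IH psubst_zero)
    qed
  qed
  then have "psi g = f"
    by (simp add: e_def fun_eq_iff)
  then show ?thesis ..
qed

section \<open>Density of partitions and of power sum values\<close>

lemma digits_unique:
  fixes a c :: "nat \<Rightarrow> nat"
  assumes "\<And>i. i < n \<Longrightarrow> a i < b" "\<And>i. i < n \<Longrightarrow> c i < b"
    and "(\<Sum>i<n. a i * b ^ i) = (\<Sum>i<n. c i * b ^ i)" "i < n"
  shows "a i = c i"
  using assms
proof (induction n arbitrary: a c i)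
  case (Suc n)
  have split: "(\<Sum>i<Suc n. f i * b ^ i) = f 0 + b * (\<Sum>i<n. f (Suc i) * b ^ i)" for f :: "nat \<Rightarrow> nat"
    by (subst sum.lessThan_Suc_shift) (simp add: sum_distrib_left mult_ac)
  have eq: "a 0 + b * (\<Sum>i<n. a (Suc i) * b ^ i) = c 0 + b * (\<Sum>i<n. c (Suc i) * b ^ i)"
    using Suc.prems(3) by (simp only: split)
  have lt: "a 0 < b" "c 0 < b"
    using Suc.prems(1,2) by simp_all
  have "(a 0 + b * (\<Sum>i<n. a (Suc i) * b ^ i)) mod b = a 0"
    "(c 0 + b * (\<Sum>i<n. c (Suc i) * b ^ i)) mod b = c 0"
    using lt by simp_all
  then have zero: "a 0 = c 0"
    using eq by simp
  then have "(\<Sum>i<n. a (Suc i) * b ^ i) = (\<Sum>i<n. c (Suc i) * b ^ i)"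
    using eq lt by simp
  then have "a (Suc i) = c (Suc i)" if "i < n" for i
    using Suc.IH[of "\<lambda>i. a (Suc i)" "\<lambda>i. c (Suc i)" i] Suc.prems(1,2) that by simp
  with zero show ?case
    using Suc.prems(4) by (cases i) simp_all
qed simp

text \<open>Kronecker substitution: inserting the powers of \<open>T\<close> with exponents \<open>b ^ (n - 1 - i)\<close>, for a
  bound \<open>b\<close> on the exponents, sends distinct monomials to distinct powers of \<open>T\<close>, so the result is a
  nonzero polynomial in \<open>T\<close> and has only finitely many roots. For \<open>T \<ge> 1\<close> the point is a partition.\<close>

lemma partition_not_root:
  assumes "f \<noteq> 0" "vars f \<subseteq> {..<n}"
  shows "\<exists>\<nu>. young_diagram \<nu> \<and> num_rows \<nu> \<le> n \<and> ev (\<lambda>i. of_nat (\<nu> i)) f \<noteq> 0"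
proof -
  have keys: "Poly_Mapping.keys m \<subseteq> {..<n}" if "m \<in> Poly_Mapping.keys f" for m
    using assms(2) that by (auto simp: vars_def)
  define b where "b = Suc (\<Sum>m\<in>Poly_Mapping.keys f. mdeg m)"
  have b: "Poly_Mapping.lookup m i < b" if "m \<in> Poly_Mapping.keys f" for m i
  proof -
    have "Poly_Mapping.lookup m i \<le> mdeg m"
    proof (cases "i \<in> Poly_Mapping.keys m")
      case True
      then show ?thesis
        unfolding mdeg_def by (intro member_le_sum) auto
    qed (simp add: in_keys_iff)
    also have "mdeg m \<le> (\<Sum>m\<in>Poly_Mapping.keys f. mdeg m)"
      using that by (intro member_le_sum) auto
    finally show ?thesis by (simp add: b_def)
  qed
  define w where "w m = (\<Sum>i<n. Poly_Mapping.lookup m i * b ^ (n - Suc i))" for m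
  have w_inj: "m = m'" if "m \<in> Poly_Mapping.keys f" "m' \<in> Poly_Mapping.keys f" "w m = w m'" for m m'
  proof (rule poly_mapping_eqI)
    fix i
    have w: "w m = (\<Sum>i<n. Poly_Mapping.lookup m (n - Suc i) * b ^ i)" for m
      unfolding w_def by (subst sum.nat_diff_reindex[symmetric]) (simp cong: sum.cong_simp)
    show "Poly_Mapping.lookup m i = Poly_Mapping.lookup m' i"
    proof (cases "i < n")
      case True
      have "Poly_Mapping.lookup m (n - Suc (n - Suc i)) = Poly_Mapping.lookup m' (n - Suc (n - Suc i))"
        by (rule digits_unique[where n = n and b = b and i = "n - Suc i"])
          (use that b True in \<open>auto simp: w\<close>)
      with True show ?thesis by (simp add: Suc_diff_Suc)
    next
      case False
      then have "i \<notin> Poly_Mapping.keys m" "i \<notin> Poly_Mapping.keys m'"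
        using keys that by auto
      then show ?thesis by (simp add: in_keys_iff)
    qed
  qed
  define q where "q = (\<Sum>m\<in>Poly_Mapping.keys f. Polynomial.monom (Poly_Mapping.lookup f m) (w m))"
  obtain m0 where m0: "m0 \<in> Poly_Mapping.keys f"
    using assms(1) by (metis all_not_in_conv keys_eq_empty)
  have "Polynomial.coeff q (w m0) = (\<Sum>m\<in>Poly_Mapping.keys f. if m = m0 then Poly_Mapping.lookup f m else 0)"
    unfolding q_def coeff_sum by (intro sum.cong) (use w_inj m0 in auto)
  then have "Polynomial.coeff q (w m0) \<noteq> 0"
    using m0 by (simp add: in_keys_iff)
  then have "q \<noteq> 0" by auto
  then have "finite {x. poly q x = 0}"
    by (rule poly_roots_finite)
  moreover have "infinite ((of_nat :: nat \<Rightarrow> complex) ` {1..})"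
    by (simp add: finite_image_iff inj_on_def infinite_Ici)
  ultimately obtain T :: nat where T: "T \<ge> 1" "poly q (of_nat T) \<noteq> 0"
    by (metis (mono_tags, lifting) atLeast_iff finite_subset image_subsetI mem_Collect_eq)
  define \<nu> where "\<nu> i = (if i < n then T ^ (b ^ (n - Suc i)) else 0)" for i
  have "poly q (of_nat T) = (\<Sum>m\<in>Poly_Mapping.keys f. Poly_Mapping.lookup f m *
      (\<Prod>i\<in>Poly_Mapping.keys m. of_nat (\<nu> i) ^ Poly_Mapping.lookup m i))"
    unfolding q_def poly_sum
  proof (intro sum.cong refl)
    fix m assume m: "m \<in> Poly_Mapping.keys f"
    have "(\<Prod>i\<in>Poly_Mapping.keys m. of_nat (\<nu> i) ^ Poly_Mapping.lookup m i) =
        (\<Prod>i<n. (of_nat (\<nu> i) :: complex) ^ Poly_Mapping.lookup m i)"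
      using keys[OF m] by (intro prod.mono_neutral_left) (auto simp: in_keys_iff)
    also have "\<dots> = (\<Prod>i<n. of_nat T ^ (Poly_Mapping.lookup m i * b ^ (n - Suc i)))"
      by (intro prod.cong) (simp_all add: \<nu>_def power_mult[symmetric] mult.commute)
    also have "\<dots> = of_nat T ^ w m"
      by (simp add: w_def power_sum)
    finally show "poly (Polynomial.monom (Poly_Mapping.lookup f m) (w m)) (of_nat T) =
        Poly_Mapping.lookup f m * (\<Prod>i\<in>Poly_Mapping.keys m. of_nat (\<nu> i) ^ Poly_Mapping.lookup m i)"
      by (simp add: poly_monom)
  qed
  then have "ev (\<lambda>i. of_nat (\<nu> i)) f \<noteq> 0"
    using T(2) by (simp add: ev_altdef)
  moreover have young: "young_diagram \<nu>"
  proof -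
    have "\<nu> k \<le> \<nu> i" if "i \<le> k" for i k
      using that T(1) by (auto simp: \<nu>_def b_def intro!: power_increasing diff_le_mono2)
    then have "antimono \<nu>"
      by (auto simp: antimono_def)
    moreover have "{i. \<nu> i \<noteq> 0} \<subseteq> {..<n}"
      by (auto simp: \<nu>_def split: if_splits)
    then have "finite {i. \<nu> i \<noteq> 0}"
      by (rule finite_subset) simp
    ultimately show ?thesis
      by (simp add: young_diagram_def)
  qed
  moreover have "num_rows \<nu> \<le> n"
    unfolding num_rows_le_iff[OF young] by (simp add: \<nu>_def)
  ultimately show ?thesis by blast
qed

text \<open>The expansion of \<open>s / (1 - s z)\<close>, the logarithmic derivative of \<open>1 / (1 - s z)\<close>.\<close>

definition geometric :: "'a::comm_ring_1 \<Rightarrow> 'a fps" where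
  "geometric s = Abs_fps (\<lambda>k. s ^ (k + 1))"

lemma geometric_mult: "geometric s * (1 - fps_const s * fps_X) = fps_const s"
proof (rule fps_ext)
  fix m
  have "geometric s * (1 - fps_const s * fps_X) = geometric s - fps_X * (fps_const s * geometric s)"
    by (simp add: algebra_simps)
  then show "fps_nth (geometric s * (1 - fps_const s * fps_X)) m = fps_nth (fps_const s) m"
    by (cases m) (simp_all add: geometric_def)
qed

lemma fps_deriv_linear_factor:
  fixes F :: "'a::comm_ring_1 fps"
  shows "fps_deriv (F * (1 - fps_const s * fps_X)) = fps_deriv F * (1 - fps_const s * fps_X) - F * fps_const s"
proof -
  have deriv: "fps_deriv (1 - fps_const s * fps_X) = - fps_const s"
    by simp
  show ?thesis
    unfolding fps_deriv_mult deriv by (simp only: mult_minus_right uminus_add_conv_diff)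
qed

lemma poly_linear_factors:
  fixes q :: "complex poly"
  assumes "degree q \<le> n" "Polynomial.coeff q 0 = 1"
  shows "\<exists>z. q = (\<Prod>i<n. [:1, - z i:])"
  using assms
proof (induction n arbitrary: q)
  case 0
  then show ?case
    by (auto elim!: degree_eq_zeroE)
next
  case (Suc n)
  show ?case
  proof (cases "degree q = 0")
    case True
    then have "q = (\<Prod>i<Suc n. [:1, - 0:])"
      using Suc.prems by (auto elim!: degree_eq_zeroE simp: pCons_one)
    then show ?thesis
      by (intro exI[of _ "\<lambda>_. 0"]) simp
  next
    case False
    then obtain r where r: "poly q r = 0"
      using fundamental_theorem_of_algebra[of q] by (auto simp: constant_degree)
    then obtain q' where q': "q = [:- r, 1:] * q'"
      by (auto simp: poly_eq_0_iff_dvd)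
    have "r \<noteq> 0"
      using Suc.prems(2) r by (auto simp: poly_0_coeff_0)
    define q2 where "q2 = Polynomial.smult (- r) q'"
    have q2: "q = [:1, - (1 / r):] * q2"
    proof -
      have "Polynomial.smult (- r) [:1, - (1 / r):] = [:- r, 1:]"
        using \<open>r \<noteq> 0\<close> by simp
      then show ?thesis
        unfolding q' q2_def by (metis mult_smult_left mult_smult_right)
    qed
    have "q' \<noteq> 0"
      using q' Suc.prems(2) by auto
    then have "degree q = degree [:- r, 1:] + degree q'"
      unfolding q' by (intro degree_mult_eq) auto
    then have "degree q = Suc (degree q2)"
      using \<open>r \<noteq> 0\<close> by (simp add: q2_def)
    moreover have "Polynomial.coeff q2 0 = 1"
      using Suc.prems(2) by (simp add: q2 coeff_mult)
    ultimately obtain z where "q2 = (\<Prod>i<n. [:1, - z i:])"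
      using Suc.IH[of q2] Suc.prems(1) by auto
    then have "q = (\<Prod>i<Suc n. [:1, - (z(n := 1 / r)) i:])"
      unfolding q2 by (simp add: mult.commute)
    then show ?thesis by blast
  qed
qed

fun newton_coeff :: "(nat \<Rightarrow> complex) \<Rightarrow> nat \<Rightarrow> complex" where
  "newton_coeff w 0 = 1"
| "newton_coeff w (Suc m) = - (\<Sum>j\<le>m. w j * newton_coeff w (m - j)) / of_nat (Suc m)"

text \<open>Newton's identities determine the polynomial with constant coefficient 1 whose reciprocal
  roots have the prescribed power sums; it splits over the complex numbers.\<close>

lemma power_sums_surj: "\<exists>z. \<forall>k<n. (\<Sum>i<n. z i ^ (k + 1)) = (w k :: complex)"
proof -
  let ?e = "newton_coeff w"
  define q where "q = (\<Sum>m\<le>n. Polynomial.monom (?e m) m)"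
  have coeff_q: "Polynomial.coeff q m = (if m \<le> n then ?e m else 0)" for m
    by (auto simp: q_def coeff_sum)
  have "degree q \<le> n"
    by (rule degree_le) (simp add: coeff_q)
  then obtain z where z: "q = (\<Prod>i<n. [:1, - z i:])"
    using poly_linear_factors[of q n] by (auto simp: coeff_q)
  define p where "p k = (\<Sum>i<n. z i ^ (k + 1))" for k
  define F where "F = (\<Prod>i<n. 1 - fps_const (z i) * fps_X)"
  have F: "fps_of_poly q = F"
    unfolding z F_def fps_of_poly_prod by (intro prod.cong) (simp_all add: fps_of_poly_pCons mult.commute)
  have "fps_deriv (\<Prod>i<k. 1 - fps_const (z i) * fps_X) =
      - (\<Sum>i<k. geometric (z i)) * (\<Prod>i<k. 1 - fps_const (z i) * fps_X)" for k
  proof (induction k)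
    case (Suc k)
    let ?P = "\<Prod>i<k. 1 - fps_const (z i) * fps_X"
    let ?l = "1 - fps_const (z k) * fps_X"
    have "fps_deriv (\<Prod>i<Suc k. 1 - fps_const (z i) * fps_X) = fps_deriv ?P * ?l - ?P * fps_const (z k)"
      by (simp only: prod.lessThan_Suc fps_deriv_linear_factor)
    also have "\<dots> = - (\<Sum>i<k. geometric (z i)) * ?P * ?l - ?P * (geometric (z k) * ?l)"
      by (simp only: Suc geometric_mult)
    also have "\<dots> = - (\<Sum>i<Suc k. geometric (z i)) * (?P * ?l)"
    proof -
      have "- S * P * l - P * (G * l) = - (S + G) * (P * l)" for S P l G :: "complex fps"
        by (simp add: algebra_simps)
      then show ?thesis
        unfolding sum.lessThan_Suc .
    qed
    finally show ?case
      by (simp only: prod.lessThan_Suc)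
  qed simp
  then have "fps_deriv F = - (\<Sum>i<n. geometric (z i)) * F"
    by (simp add: F_def)
  moreover have "(\<Sum>i<n. geometric (z i)) = Abs_fps p"
    by (rule fps_ext) (simp add: fps_sum_nth geometric_def p_def)
  ultimately have "fps_nth (fps_deriv F) k = fps_nth (- (Abs_fps p * F)) k" for k
    by simp
  then have newton: "of_nat (Suc k) * fps_nth F (Suc k) = - (\<Sum>j\<le>k. p j * fps_nth F (k - j))" for k
    by (simp add: fps_mult_nth atLeast0AtMost)
  have F_nth: "fps_nth F m = ?e m" if "m \<le> n" for m
    using that by (simp add: F[symmetric] coeff_q)
  have "p k = w k" if "k < n" for k
    using that
  proof (induction k rule: less_induct)
    case (less k)
    have "of_nat (Suc k) * ?e (Suc k) = - (\<Sum>j\<le>k. w j * ?e (k - j))"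
      using of_nat_neq_0[of k, where 'a = complex] by (simp del: of_nat_Suc)
    moreover have "of_nat (Suc k) * ?e (Suc k) = - (\<Sum>j\<le>k. p j * ?e (k - j))"
      using newton[of k] F_nth less.prems by (simp del: newton_coeff.simps of_nat_Suc)
    ultimately have "(\<Sum>j\<le>k. p j * ?e (k - j)) = (\<Sum>j\<le>k. w j * ?e (k - j))"
      by simp
    moreover have "(\<Sum>j<k. p j * ?e (k - j)) = (\<Sum>j<k. w j * ?e (k - j))"
      using less by (intro sum.cong) auto
    ultimately show ?case
      by (simp add: lessThan_Suc_atMost[symmetric])
  qed
  then show ?thesis
    unfolding p_def by blast
qed

text \<open>A nonzero \<open>g\<close> has a point where it does not vanish, and some choice of the variables gives the
  shifted power sums the coordinates of that point.\<close>

theorem psi_inj: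
  assumes "psi g = 0"
  shows "g = 0"
proof (rule ccontr)
  assume "g \<noteq> 0"
  obtain n where n: "vars g \<subseteq> {..<n}"
    using finite_nat_set_iff_bounded[of "vars g"] by auto
  obtain \<nu> where \<nu>: "ev (\<lambda>i. of_nat (\<nu> i)) g \<noteq> 0"
    using partition_not_root[OF \<open>g \<noteq> 0\<close> n] by blast
  obtain z :: "nat \<Rightarrow> complex" where z: "\<And>k. k < n \<Longrightarrow> (\<Sum>i<n. z i ^ (k + 1)) =
      of_nat (\<nu> k) + (\<Sum>i<n. (- (of_nat i + 1 / 2)) ^ (k + 1))"
    using power_sums_surj[of n "\<lambda>k. of_nat (\<nu> k) + (\<Sum>i<n. (- (of_nat i + 1 / 2)) ^ (k + 1))"] by blast
  define x where "x i = z i + (of_nat i + 1 / 2)" for i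
  have "ev x (shifted_power_sum n k) = of_nat (\<nu> k)" if "k < n" for k
  proof -
    have "ev x (shifted_power_sum n k) =
        (\<Sum>i<n. (x i - (of_nat i + 1 / 2)) ^ (k + 1)) - (\<Sum>i<n. (- (of_nat i + 1 / 2)) ^ (k + 1))"
      by (simp only: shifted_power_sum_def ev.hom_sum ev.hom_minus ev.hom_power ev_X ev_Con sum_subtractf)
    also have "\<dots> = of_nat (\<nu> k)"
      using z[OF that] by (simp add: x_def)
    finally show ?thesis .
  qed
  then have "ev x (psi g n) = ev (\<lambda>i. of_nat (\<nu> i)) g"
    unfolding psi_def ev_psubst using n by (intro ev_cong) auto
  with \<nu> assms show False by simp
qed

section \<open>The generating series of the one-row functions\<close>

definition coeff_map :: "('a::comm_ring_1 \<Rightarrow> 'b::comm_ring_1) \<Rightarrow> 'a fps \<Rightarrow> 'b fps" where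
  "coeff_map h F = Abs_fps (\<lambda>n. h (fps_nth F n))"

lemma coeff_map_nth [simp]: "fps_nth (coeff_map h F) n = h (fps_nth F n)"
  by (simp add: coeff_map_def)

lemma (in comm_ring_hom) coeff_map_mult: "coeff_map hom (F * G) = coeff_map hom F * coeff_map hom G"
  by (rule fps_ext) (simp add: fps_mult_nth hom_sum hom_mult)

lemma (in comm_ring_hom) coeff_map_power: "coeff_map hom (F ^ k) = coeff_map hom F ^ k"
proof (induction k)
  case 0
  show ?case by (rule fps_ext) simp
qed (simp add: coeff_map_mult)

lemma (in comm_ring_hom) coeff_map_deriv: "coeff_map hom (fps_deriv F) = fps_deriv (coeff_map hom F)"
  by (rule fps_ext) (simp add: hom_mult hom_of_nat hom_add)

lemma (in comm_ring_hom) coeff_map_compose: "coeff_map hom (F oo G) = coeff_map hom F oo coeff_map hom G"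
  by (rule fps_ext) (simp add: fps_compose_nth hom_sum hom_mult coeff_map_power[symmetric])

lemma fps_deriv_exp_series: "fps_deriv exp_series = exp_series"
proof (rule fps_ext)
  fix n
  have "of_nat (n + 1) * Con (1 / fact (n + 1)) = Con (of_nat (n + 1) * (1 / fact (n + 1)))"
    by (simp only: Con_mult Con.hom_of_nat)
  also have "of_nat (n + 1) * (1 / fact (n + 1)) = (1 / fact n :: complex)"
    using of_nat_neq_0[of n, where 'a = complex] by (simp add: field_simps del: of_nat_Suc)
  finally show "fps_nth (fps_deriv exp_series) n = fps_nth exp_series n"
    by (simp only: fps_deriv_nth exp_series_def fps_nth_Abs_fps)
qed

lemma H_nth_0: "fps_nth H 0 = 1"
  by (simp add: H_def exp_series_def)

lemma fps_deriv_H: "fps_deriv H = H * Abs_fps X"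
proof -
  let ?L = "Abs_fps (\<lambda>k. if k = 0 then 0 else Con (1 / of_nat k) * power_sum k)"
  have "fps_deriv H = (fps_deriv exp_series oo ?L) * fps_deriv ?L"
    unfolding H_def by (rule fps_compose_deriv) simp
  also have "fps_deriv exp_series oo ?L = H"
    by (simp add: fps_deriv_exp_series H_def)
  also have "fps_deriv ?L = Abs_fps X"
  proof (rule fps_ext)
    fix k
    have "of_nat (k + 1) * Con (1 / of_nat (k + 1)) = Con (of_nat (k + 1) * (1 / of_nat (k + 1)))"
      by (simp only: Con_mult Con.hom_of_nat)
    also have "of_nat (k + 1) * (1 / of_nat (k + 1)) = (1 :: complex)"
      using of_nat_neq_0[of k, where 'a = complex] by (simp del: of_nat_Suc)
    finally have "of_nat (k + 1) * Con (1 / of_nat (k + 1)) = 1"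
      by (simp only: Con_1)
    then have "of_nat (k + 1) * (Con (1 / of_nat (k + 1)) * X k) = X k"
      by (simp only: mult.assoc[symmetric] mult_1)
    then show "fps_nth (fps_deriv ?L) k = fps_nth (Abs_fps X) k"
      by (simp add: power_sum_def del: of_nat_Suc of_nat_add)
  qed
  finally show ?thesis .
qed

lemma fps_linear_ode_unique:
  fixes Y Z B :: "cpoly fps"
  assumes "fps_deriv Y = Y * B" "fps_deriv Z = Z * B" "fps_nth Y 0 = fps_nth Z 0"
  shows "Y = Z"
proof -
  define D where "D = Y - Z"
  have D: "fps_deriv D = D * B" "fps_nth D 0 = 0"
    using assms by (simp_all add: D_def left_diff_distrib)
  have "fps_nth D n = 0" for n
  proof (induction n rule: less_induct)
    case (less n)
    show ?case
    proof (cases n)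
      case (Suc m)
      have "of_nat (m + 1) * fps_nth D (m + 1) = fps_nth (D * B) m"
        by (simp only: D(1)[symmetric] fps_deriv_nth)
      also have "\<dots> = 0"
        unfolding fps_mult_nth using less Suc by (intro sum.neutral) auto
      finally show ?thesis
        using Suc of_nat_neq_0[of m, where 'a = cpoly] by (simp del: of_nat_Suc)
    qed (use D in simp)
  qed
  then have "D = 0"
    by (intro fps_ext) simp
  then show ?thesis
    by (simp add: D_def)
qed

definition H_in :: "nat \<Rightarrow> cpoly fps" where
  "H_in n = coeff_map (psubst (shifted_power_sum n)) H"

definition H_shifted_in :: "nat \<Rightarrow> cpoly fps" where
  "H_shifted_in n = coeff_map (psubst (shifted_power_sum n)) H_shifted"

lemma fps_deriv_H_in: "fps_deriv (H_in n) = H_in n * Abs_fps (shifted_power_sum n)"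
proof -
  have "coeff_map (psubst (shifted_power_sum n)) (Abs_fps X) = Abs_fps (shifted_power_sum n)"
    by (rule fps_ext) (simp add: psubst_X)
  then show ?thesis
    unfolding H_in_def psubst.coeff_map_deriv[symmetric] fps_deriv_H psubst.coeff_map_mult by simp
qed

lemma H_in_nth_0: "fps_nth (H_in n) 0 = 1"
  by (simp add: H_in_def H_nth_0)

text \<open>A further variable contributes \<open>(1 - s\<^sub>0 z) / (1 - s z)\<close>; both sides of the
  cross-multiplied identity solve the same linear differential equation.\<close>

lemma H_in_Suc:
  "H_in (Suc n) * (1 - fps_const (X n - Con (of_nat n + 1 / 2)) * fps_X) =
    H_in n * (1 - fps_const (Con (- (of_nat n + 1 / 2))) * fps_X)"
proof -
  let ?s = "X n - Con (of_nat n + 1 / 2)" and ?t = "Con (- (of_nat n + 1 / 2))"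
  let ?A = "\<lambda>n. Abs_fps (shifted_power_sum n)"
  have A: "?A (Suc n) = ?A n + geometric ?s - geometric ?t"
    by (rule fps_ext) (simp only: shifted_power_sum_def geometric_def sum.lessThan_Suc fps_nth_Abs_fps
        fps_add_nth fps_sub_nth Con.hom_power add_diff_eq)
  have ring: "K * (a + s - t) * l - K * (s * l) = K * l * (a - t)" for K a s t l :: "cpoly fps"
    by (simp add: algebra_simps)
  have ring': "K * a * l - K * (t * l) = K * l * (a - t)" for K a t l :: "cpoly fps"
    by (simp add: algebra_simps)
  show ?thesis
  proof (rule fps_linear_ode_unique)
    show "fps_deriv (H_in (Suc n) * (1 - fps_const ?s * fps_X)) =
        H_in (Suc n) * (1 - fps_const ?s * fps_X) * (?A n - geometric ?t)"
      unfolding fps_deriv_linear_factor fps_deriv_H_in A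
      by (subst (2) geometric_mult[symmetric]) (rule ring)
    show "fps_deriv (H_in n * (1 - fps_const ?t * fps_X)) =
        H_in n * (1 - fps_const ?t * fps_X) * (?A n - geometric ?t)"
      unfolding fps_deriv_linear_factor fps_deriv_H_in
      by (subst (2) geometric_mult[symmetric]) (rule ring')
  qed (simp add: H_in_nth_0)
qed

lemma shift_half_mult: "shift_half * (1 + fps_const (Con (1 / 2)) * fps_X) = fps_X"
proof (rule fps_ext)
  fix m
  have "shift_half * (1 + fps_const (Con (1 / 2)) * fps_X) =
      shift_half + fps_X * (fps_const (Con (1 / 2)) * shift_half)"
    by (simp add: algebra_simps)
  moreover have "fps_nth (shift_half + fps_X * (fps_const (Con (1 / 2)) * shift_half)) m = fps_nth fps_X m"
  proof (cases m)
    case (Suc k)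
    show ?thesis
    proof (cases k)
      case 0
      then show ?thesis by (simp add: Suc shift_half_def)
    next
      case (Suc j)
      have "Con ((- 1 / 2) ^ Suc j) + Con (1 / 2) * Con ((- 1 / 2) ^ j) = Con ((- 1 / 2) ^ Suc j + 1 / 2 * (- 1 / 2) ^ j)"
        by (simp only: Con_add Con_mult)
      then show ?thesis
        using \<open>m = Suc k\<close> Suc by (simp add: shift_half_def)
    qed
  qed (simp add: shift_half_def)
  ultimately show "fps_nth (shift_half * (1 + fps_const (Con (1 / 2)) * fps_X)) m = fps_nth fps_X m"
    by simp
qed

lemma shift_half_nth_0: "fps_nth shift_half 0 = 0"
  by (simp add: shift_half_def)

lemma H_shifted_in_eq: "H_shifted_in n = H_in n oo shift_half"
proof -
  have "coeff_map (psubst (shifted_power_sum n)) shift_half = shift_half"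
    by (rule fps_ext) (simp add: shift_half_def psubst_Con psubst_zero)
  then show ?thesis
    by (simp add: H_shifted_in_def H_shifted_def psubst.coeff_map_compose H_in_def)
qed

lemma compose_shift_half_linear:
  "((1 - fps_const s * fps_X) oo shift_half) * (1 + fps_const (Con (1 / 2)) * fps_X) =
    1 + fps_const (Con (1 / 2) - s) * fps_X"
proof -
  let ?q = "1 + fps_const (Con (1 / 2)) * fps_X"
  have "(1 - fps_const s * fps_X) oo shift_half = 1 - fps_const s * shift_half"
    by (simp add: fps_compose_sub_distrib fps_compose_mult_distrib[OF shift_half_nth_0]
        fps_X_fps_compose_startby0 shift_half_nth_0)
  then have "((1 - fps_const s * fps_X) oo shift_half) * ?q = ?q - fps_const s * (shift_half * ?q)"
    by (simp only: left_diff_distrib mult_1 mult.assoc)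
  also have "\<dots> = 1 + fps_const (Con (1 / 2) - s) * fps_X"
    unfolding shift_half_mult by (simp add: algebra_simps flip: fps_const_sub)
  finally show ?thesis .
qed

text \<open>The preceding identity in the variable \<open>z / (1 + z/2)\<close>, where it becomes
  \<open>(1 + (n - x\<^sub>n) z) H\<^sub>n = (1 + n z) H\<^sub>n\<^sub>-\<^sub>1\<close> with \<open>n\<close> the larger number of variables.\<close>

lemma H_shifted_in_Suc:
  "fps_nth (H_shifted_in (Suc n)) (Suc m) + (of_nat (Suc n) - X n) * fps_nth (H_shifted_in (Suc n)) m =
    fps_nth (H_shifted_in n) (Suc m) + of_nat (Suc n) * fps_nth (H_shifted_in n) m"
proof -
  let ?s = "X n - Con (of_nat n + 1 / 2)" and ?t = "Con (- (of_nat n + 1 / 2))"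
  let ?q = "1 + fps_const (Con (1 / 2)) * fps_X"
  have nth: "fps_nth (K * (1 + fps_const c * fps_X)) (Suc m) = fps_nth K (Suc m) + c * fps_nth K m"
    for K :: "cpoly fps" and c
  proof -
    have "K * (1 + fps_const c * fps_X) = K + fps_X * (fps_const c * K)"
      by (simp add: algebra_simps)
    then show ?thesis by simp
  qed
  have "(H_in (Suc n) oo shift_half) * ((1 - fps_const ?s * fps_X) oo shift_half) =
      (H_in n oo shift_half) * ((1 - fps_const ?t * fps_X) oo shift_half)"
    unfolding fps_compose_mult_distrib[OF shift_half_nth_0, symmetric] H_in_Suc ..
  then have "H_shifted_in (Suc n) * (((1 - fps_const ?s * fps_X) oo shift_half) * ?q) =
      H_shifted_in n * (((1 - fps_const ?t * fps_X) oo shift_half) * ?q)"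
    unfolding H_shifted_in_eq mult.assoc[symmetric] by simp
  then have "fps_nth (H_shifted_in (Suc n) * (1 + fps_const (Con (1 / 2) - ?s) * fps_X)) (Suc m) =
      fps_nth (H_shifted_in n * (1 + fps_const (Con (1 / 2) - ?t) * fps_X)) (Suc m)"
    unfolding compose_shift_half_linear by simp
  moreover have "Con (1 / 2) - ?t = of_nat (Suc n)"
  proof -
    have "Con (1 / 2) - ?t = Con (1 / 2 - - (of_nat n + 1 / 2))"
      by (simp only: Con.hom_minus)
    also have "1 / 2 - - (of_nat n + 1 / 2) = (of_nat (Suc n) :: complex)"
      by simp
    finally show ?thesis by (simp only: Con.hom_of_nat)
  qed
  moreover have "Con (1 / 2) - ?s = of_nat (Suc n) - X n"
  proof -
    have "Con (1 / 2) - ?s = Con (1 / 2 + (of_nat n + 1 / 2)) - X n"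
      by (simp only: Con_add) simp
    also have "1 / 2 + (of_nat n + 1 / 2) = (of_nat (Suc n) :: complex)"
      by simp
    finally show ?thesis by (simp only: Con.hom_of_nat)
  qed
  ultimately show ?thesis
    unfolding nth by (simp only:)
qed

lemma H_shifted_in_nth_0: "fps_nth (H_shifted_in n) 0 = 1"
  by (simp add: H_shifted_in_eq H_in_nth_0)

lemma H_shifted_in_0: "H_shifted_in 0 = 1"
proof -
  have "shifted_power_sum 0 = (\<lambda>_. 0)"
    by (simp add: shifted_power_sum_def fun_eq_iff)
  then have "fps_deriv (H_in 0) = H_in 0 * 0"
    unfolding fps_deriv_H_in by (simp add: fps_zero_def)
  then have "H_in 0 = 1"
    by (rule fps_linear_ode_unique) (simp_all add: H_in_nth_0)
  then show ?thesis
    by (simp add: H_shifted_in_eq)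
qed

text \<open>Translating the nodes means translating the function, and
  \<open>(t + 1)\<^sup>\<down>\<^sup>m = t\<^sup>\<down>\<^sup>m + m t\<^sup>\<down>\<^sup>m\<^sup>-\<^sup>1\<close>.\<close>

lemma dd_translate:
  fixes v :: "nat \<Rightarrow> 'a::comm_ring_1"
  shows "dd (\<lambda>i. v i + 1) l m = dd v l m + of_nat m * dd v l (m - 1)"
proof (induction v l m rule: dd.induct)
  case (2 v m)
  have eq: "(v 0 + 1 - of_nat m) * (of_nat m * dd v 0 (m - 1)) = of_nat m * dd v 0 m"
    by (cases m) (simp_all add: algebra_simps)
  have "dd (\<lambda>i. v i + 1) 0 (Suc m) = (v 0 + 1 - of_nat m) * (dd v 0 m + of_nat m * dd v 0 (m - 1))"
    by (simp only: dd.simps 2)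
  also have "\<dots> = (v 0 - of_nat m) * dd v 0 m + of_nat (Suc m) * dd v 0 m"
    unfolding distrib_left[of "v 0 + 1 - of_nat m"] eq by (simp add: algebra_simps)
  finally show ?case by simp
next
  case (3 v l m)
  let ?D = "dd v (Suc l)" and ?d = "dd v l"
  have eq: "(v (Suc l) + 1 - of_nat m) * (of_nat m * ?D (m - 1)) + of_nat m * ?d (m - 1) = of_nat m * ?D m"
    by (cases m) (simp_all add: algebra_simps)
  have "dd (\<lambda>i. v i + 1) (Suc l) (Suc m) =
      (v (Suc l) + 1 - of_nat m) * (?D m + of_nat m * ?D (m - 1)) + (?d m + of_nat m * ?d (m - 1))"
    by (simp only: dd.simps 3)
  also have "\<dots> = (v (Suc l) + 1 - of_nat m) * ?D m + ?d m +
      ((v (Suc l) + 1 - of_nat m) * (of_nat m * ?D (m - 1)) + of_nat m * ?d (m - 1))"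
    unfolding distrib_left[of "v (Suc l) + 1 - of_nat m"] by (simp only: ac_simps)
  also have "\<dots> = (v (Suc l) - of_nat m) * ?D m + ?d m + of_nat (Suc m) * ?D m"
    unfolding eq by (simp add: algebra_simps)
  finally show ?case by simp
qed simp

definition h_in :: "nat \<Rightarrow> nat \<Rightarrow> cpoly" where
  "h_in n k = h_star k n"

lemma h_in_0: "h_in n 0 = 1"
proof -
  have "one_row 0 = (\<lambda>_. 0)"
    by (simp add: one_row_def fun_eq_iff)
  moreover have "shifted_schur_poly n (\<lambda>_. 0) = 1"
    by (rule shifted_schur_poly_unique) simp
  ultimately show ?thesis
    by (simp add: h_in_def h_star_def shifted_schur_def num_rows_def)
qed

lemma num_rows_one_row: "num_rows (one_row (Suc k)) = 1"
proof -
  have "{i. one_row (Suc k) i \<noteq> 0} = {0}"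
    by (auto simp: one_row_def)
  then show ?thesis
    by (simp add: num_rows_def)
qed

lemma h_in_no_variables: "h_in 0 (Suc k) = 0"
  unfolding h_in_def h_star_def
  by (rule shifted_schur_few_variables) (simp_all add: num_rows_one_row)

lemma h_in_eq_dd: "h_in (Suc n) k = dd (node (Suc n)) n (k + n)"
proof -
  have "num_rows (one_row k) \<le> Suc n"
    by (subst num_rows_le_iff) (simp_all add: one_row_def)
  then show ?thesis
    by (simp add: h_in_def h_star_def shifted_schur_def shifted_schur_poly_one_row)
qed

text \<open>The Leibniz recursion at the last node. The divided difference over the remaining nodes is the
  one for one variable less, with all nodes translated by 1.\<close>

lemma h_in_Suc:
  "h_in (Suc n) (Suc k) + (of_nat (k + n) - X n) * h_in (Suc n) k =
    h_in n (Suc k) + of_nat (k + n) * h_in n k"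
proof (cases n)
  case 0
  have "of_nat k * h_in 0 k = 0"
    by (cases k) (simp_all add: h_in_no_variables)
  then show ?thesis
    using 0 by (simp add: h_in_eq_dd node_def h_in_no_variables left_diff_distrib)
next
  case (Suc p)
  have nodes: "dd (node (Suc n)) p m = dd (\<lambda>i. node n i + 1) p m" for m
  proof (rule dd_cong)
    fix i assume "i \<le> p"
    then have "Suc n - Suc i = Suc (n - Suc i)"
      using Suc by simp
    then show "node (Suc n) i = node n i + 1"
      by (simp add: node_def del: diff_Suc_Suc of_nat_diff)
  qed
  have last: "node (Suc n) n = X n"
    by (simp add: node_def)
  have "h_in (Suc n) (Suc k) = (X n - of_nat (k + n)) * h_in (Suc n) k + dd (node (Suc n)) p (k + n)"
    unfolding h_in_eq_dd using last Suc by simp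
  also have "dd (node (Suc n)) p (k + n) = h_in n (Suc k) + of_nat (k + n) * h_in n k"
    unfolding nodes dd_translate unfolding Suc h_in_eq_dd by simp
  finally show ?thesis
    by (simp add: algebra_simps)
qed

lemma inv_falling_0: "inv_falling 0 = 1"
  by (simp add: inv_falling_def)

lemma inv_falling_Suc_mult:
  "inv_falling (Suc k) * (1 - fps_const (of_nat k) * fps_X) = fps_X * inv_falling k"
proof -
  let ?l = "1 - fps_const (of_nat k :: complex) * fps_X"
  have "inverse ?l * ?l = 1"
    by (rule inverse_mult_eq_1) simp
  then show ?thesis
    by (simp add: inv_falling_def fps_inverse_mult mult.assoc)
qed

lemma inv_falling_Suc:
  "fps_nth (inv_falling (Suc k)) (Suc m) =
    fps_nth (inv_falling k) m + of_nat k * fps_nth (inv_falling (Suc k)) m"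
proof -
  have "inv_falling (Suc k) = fps_X * (fps_const (of_nat k) * inv_falling (Suc k)) + fps_X * inv_falling k"
    using inv_falling_Suc_mult[of k] by (simp add: algebra_simps)
  then have "fps_nth (inv_falling (Suc k)) (Suc m) =
      fps_nth (fps_X * (fps_const (of_nat k) * inv_falling (Suc k)) + fps_X * inv_falling k) (Suc m)"
    by simp
  then show ?thesis by simp
qed

lemma inv_falling_eq_0: "m < k \<Longrightarrow> fps_nth (inv_falling k) m = 0"
  by (simp add: inv_falling_def fps_X_power_mult_nth)

definition H_star_in :: "nat \<Rightarrow> nat \<Rightarrow> cpoly" where
  "H_star_in n m = (\<Sum>k\<le>m. Con (fps_nth (inv_falling k) m) * h_in n k)"

lemma sum_seq_apply: "(\<Sum>x\<in>A. f x) n = (\<Sum>x\<in>A. f x n)"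
  by (induction A rule: infinite_finite_induct) simp_all

lemma H_star_nth: "fps_nth H_star m n = H_star_in n m"
proof (cases m)
  case 0
  then show ?thesis
    by (simp add: H_star_def H_star_in_def inv_falling_0 h_in_0)
next
  case (Suc j)
  have "H_star_in n m = Con (fps_nth (inv_falling 0) m) * h_in n 0 +
      (\<Sum>k=1..m. Con (fps_nth (inv_falling k) m) * h_in n k)"
    unfolding H_star_in_def atMost_atLeast0 by (subst sum.atLeast_Suc_atMost) simp_all
  then show ?thesis
    using Suc by (simp add: H_star_def sum_seq_apply Con_seq_def h_in_def inv_falling_0)
qed

text \<open>For \<open>k = 0\<close> the truncated difference \<open>k - 1\<close> is 0 and not \<open>-1\<close>. The error is the summand
  \<open>h_in n 0 = 1\<close>, which does not depend on \<open>n\<close> and so cancels in the recursion below.\<close>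

lemma H_star_in_Suc:
  "H_star_in n (Suc m) = (\<Sum>k\<le>m. Con (fps_nth (inv_falling k) m) * (h_in n (Suc k) + of_nat (k - 1) * h_in n k))"
proof -
  let ?c = "\<lambda>k m. fps_nth (inv_falling k) m"
  have "H_star_in n (Suc m) = (\<Sum>k\<le>m. Con (?c (Suc k) (Suc m)) * h_in n (Suc k))"
    unfolding H_star_in_def by (subst sum.atMost_Suc_shift) (simp add: inv_falling_0)
  also have "\<dots> = (\<Sum>k\<le>m. Con (?c k m) * h_in n (Suc k)) +
      (\<Sum>k\<le>m. of_nat k * Con (?c (Suc k) m) * h_in n (Suc k))"
    by (simp only: inv_falling_Suc Con_add Con_mult Con.hom_of_nat distrib_right sum.distrib)
  also have "(\<Sum>k\<le>m. of_nat k * Con (?c (Suc k) m) * h_in n (Suc k)) =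
      (\<Sum>k\<le>Suc m. of_nat (k - 1) * Con (?c k m) * h_in n k)"
    by (subst sum.atMost_Suc_shift) simp
  also have "\<dots> = (\<Sum>k\<le>m. of_nat (k - 1) * Con (?c k m) * h_in n k)"
    by (simp add: inv_falling_eq_0)
  finally show ?thesis
    by (simp add: sum.distrib distrib_left mult_ac)
qed

lemma H_star_in_recursion:
  "H_star_in (Suc n) (Suc m) + (of_nat (Suc n) - X n) * H_star_in (Suc n) m =
    H_star_in n (Suc m) + of_nat (Suc n) * H_star_in n m"
proof -
  have summand: "h_in (Suc n) (Suc k) + of_nat (k - 1) * h_in (Suc n) k + (of_nat (Suc n) - X n) * h_in (Suc n) k =
      h_in n (Suc k) + of_nat (k - 1) * h_in n k + of_nat (Suc n) * h_in n k" for k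
  proof (cases k)
    case 0
    then show ?thesis
      using h_in_Suc[of n 0] by (simp add: h_in_0 algebra_simps)
  next
    case (Suc j)
    then have "of_nat (k - 1) + of_nat (Suc n) = (of_nat (k + n) :: cpoly)"
      by simp
    then show ?thesis
      using h_in_Suc[of n k] by (simp only: add.assoc distrib_right[symmetric] add_diff_eq)
  qed
  have "H_star_in (Suc n) (Suc m) + (of_nat (Suc n) - X n) * H_star_in (Suc n) m =
      (\<Sum>k\<le>m. Con (fps_nth (inv_falling k) m) * (h_in (Suc n) (Suc k) +
        of_nat (k - 1) * h_in (Suc n) k + (of_nat (Suc n) - X n) * h_in (Suc n) k))"
    unfolding H_star_in_Suc H_star_in_def[of _ m] sum_distrib_left sum.distrib[symmetric]
    by (intro sum.cong) (simp_all add: algebra_simps)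
  also have "\<dots> = H_star_in n (Suc m) + of_nat (Suc n) * H_star_in n m"
    unfolding summand H_star_in_Suc H_star_in_def[of _ m] sum_distrib_left sum.distrib[symmetric]
    by (intro sum.cong) (simp_all add: algebra_simps)
  finally show ?thesis .
qed

lemma H_shifted_in_eq_H_star_in: "fps_nth (H_shifted_in n) m = H_star_in n m"
proof (induction n arbitrary: m)
  case 0
  have "(\<Sum>k\<le>m. Con (fps_nth (inv_falling k) m) * h_in 0 k) = Con (fps_nth (inv_falling 0) m)"
  proof -
    have "(\<Sum>k\<le>m. Con (fps_nth (inv_falling k) m) * h_in 0 k) =
        (\<Sum>k\<le>m. if k = 0 then Con (fps_nth (inv_falling 0) m) else 0)"
      by (intro sum.cong refl) (auto simp: h_in_0 h_in_no_variables gr0_conv_Suc)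
    then show ?thesis by simp
  qed
  then show ?case
    by (simp add: H_shifted_in_0 H_star_in_def inv_falling_0)
next
  case (Suc n)
  show ?case
  proof (induction m)
    case 0
    show ?case
      by (simp add: H_shifted_in_nth_0 H_star_in_def inv_falling_0 h_in_0)
  next
    case (Suc m)
    show ?case
      using H_shifted_in_Suc[of n m] H_star_in_recursion[of n m]
      unfolding \<open>\<And>m. fps_nth (H_shifted_in n) m = H_star_in n m\<close> Suc
      by (metis add_right_cancel)
  qed
qed

theorem psi_H_shifted: "psi (fps_nth H_shifted m) = fps_nth H_star m"
proof
  fix n
  have "psi (fps_nth H_shifted m) n = fps_nth (H_shifted_in n) m"
    by (simp add: psi_def H_shifted_in_def)
  then show "psi (fps_nth H_shifted m) n = fps_nth H_star m n"
    by (simp add: H_shifted_in_eq_H_star_in H_star_nth)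
qed

section \<open>The isomorphism with the symmetric functions\<close>

text \<open>A ring endomorphism that fixes \<open>H(u + 1/2)\<close> fixes \<open>H(u)\<close> and hence its logarithmic
  derivative, whose coefficients are the power sums.\<close>

lemma endomorphism_fixing_H_shifted:
  assumes "comm_ring_hom \<theta>" "\<And>c. \<theta> (Con c) = Con c"
    and "\<And>m. \<theta> (fps_nth H_shifted m) = fps_nth H_shifted m"
  shows "\<theta> f = f"
proof -
  interpret \<theta>: comm_ring_hom \<theta> by fact
  let ?m = "coeff_map \<theta>"
  have "?m H_shifted = H_shifted"
    by (rule fps_ext) (simp add: assms(3))
  moreover have "?m shift_half = shift_half"
    by (rule fps_ext) (simp add: shift_half_def assms(2))
  ultimately have "?m H oo shift_half = H oo shift_half"
    by (simp add: H_shifted_def \<theta>.coeff_map_compose)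
  then have "(?m H - H) oo shift_half = 0"
    by (simp add: fps_compose_sub_distrib)
  moreover have "fps_nth shift_half 1 \<noteq> 0"
    by (simp add: shift_half_def)
  then have "shift_half \<noteq> 0" by auto
  ultimately have H: "?m H = H"
    using fps_compose_eq_0_iff[OF shift_half_nth_0, of "?m H - H"] by simp
  have "H * ?m (Abs_fps X) = ?m (fps_deriv H)"
    by (simp only: fps_deriv_H \<theta>.coeff_map_mult H)
  also have "\<dots> = fps_deriv (?m H)"
    by (rule \<theta>.coeff_map_deriv)
  also have "\<dots> = H * Abs_fps X"
    by (simp only: H fps_deriv_H)
  finally have "?m (Abs_fps X) = Abs_fps X"
    using H_nth_0 by (metis fps_zero_nth mult_left_cancel zero_neq_one)
  then have "\<theta> (X k) = X k" for k
    by (metis coeff_map_nth fps_nth_Abs_fps)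
  then show ?thesis
    by (induction f rule: cpoly_induct_ring) (simp_all add: assms(2) \<theta>.hom_add \<theta>.hom_mult)
qed

lemma psi_Con_seq: "psi (Con c) = Con_seq c"
  by (simp add: fun_eq_iff psi_Con Con_seq_def)

lemma psi_add_seq: "psi (f + g) = psi f + psi g" and psi_mult_seq: "psi (f * g) = psi f * psi g"
  by (simp_all add: fun_eq_iff psi_add psi_mult)

lemma inj_psi: "inj psi"
proof (rule injI)
  fix f g assume "psi f = psi g"
  then have "psi (f - g) = 0"
    by (simp add: fun_eq_iff psi_diff)
  then show "f = g"
    using psi_inj by fastforce
qed

text \<open>The inverse of \<^const>\<open>psi\<close> has all properties demanded of \<^const>\<open>phi\<close>. A competitor composed with
  \<^const>\<open>psi\<close> is an endomorphism that fixes \<^const>\<open>H_shifted\<close>, hence the identity.\<close>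

theorem phi_psi: "phi (psi g) = g"
proof -
  define \<chi> where "\<chi> = restrict (inv_into UNIV psi) shifted_symmetric"
  have \<chi>: "\<chi> (psi g) = g" for g
    by (simp add: \<chi>_def psi_in_shifted_symmetric inv_f_f[OF inj_psi])
  have surj: "\<exists>g. f = psi g" if "f \<in> shifted_symmetric" for f
    using psi_surj[OF that] by blast
  have iso: "is_algebra_iso \<chi>"
    unfolding is_algebra_iso_def
  proof (intro conjI ballI allI)
    show "bij_betw \<chi> shifted_symmetric UNIV"
    proof (rule bij_betw_byWitness[where f' = psi])
      show "\<forall>f\<in>shifted_symmetric. psi (\<chi> f) = f"
        using surj \<chi> by metis
    qed (use \<chi> psi_in_shifted_symmetric in auto)
    show "\<chi> (Con_seq c) = Con c" for c
      using \<chi>[of "Con c"] by (simp add: psi_Con_seq)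
    fix f g assume "f \<in> shifted_symmetric" "g \<in> shifted_symmetric"
    then obtain a b where "f = psi a" "g = psi b"
      using surj by blast
    then show "\<chi> (f + g) = \<chi> f + \<chi> g" "\<chi> (f * g) = \<chi> f * \<chi> g"
      by (simp_all only: \<chi> psi_add_seq[symmetric] psi_mult_seq[symmetric])
  qed
  have "phi = \<chi>"
    unfolding phi_def
  proof (rule the_equality)
    show "\<chi> \<in> extensional shifted_symmetric \<and> is_algebra_iso \<chi> \<and>
        (\<forall>m. \<chi> (fps_nth H_star m) = fps_nth H_shifted m)"
      using iso by (simp add: psi_H_shifted[symmetric] \<chi>) (simp add: \<chi>_def)
  next
    fix \<Psi>
    assume \<Psi>: "\<Psi> \<in> extensional shifted_symmetric \<and> is_algebra_iso \<Psi> \<and>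
        (\<forall>m. \<Psi> (fps_nth H_star m) = fps_nth H_shifted m)"
    define \<theta> where "\<theta> g = \<Psi> (psi g)" for g
    have Con: "\<theta> (Con c) = Con c" for c
      using \<Psi> by (simp add: \<theta>_def psi_Con_seq is_algebra_iso_def)
    have "comm_ring_hom \<theta>"
    proof
      show "\<theta> (f + g) = \<theta> f + \<theta> g" "\<theta> (f * g) = \<theta> f * \<theta> g" for f g
        using \<Psi> psi_in_shifted_symmetric
        by (simp_all add: \<theta>_def psi_add_seq psi_mult_seq is_algebra_iso_def)
      show "\<theta> 0 = 0" "\<theta> 1 = 1"
        using Con[of 0] Con[of 1] by simp_all
    qed
    moreover have "\<theta> (fps_nth H_shifted m) = fps_nth H_shifted m" for m
      using \<Psi> by (simp add: \<theta>_def psi_H_shifted)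
    ultimately have \<theta>: "\<Psi> (psi g) = g" for g
      using endomorphism_fixing_H_shifted[of \<theta> g] Con by (simp add: \<theta>_def)
    show "\<Psi> = \<chi>"
    proof (rule extensionalityI)
      show "\<Psi> \<in> extensional shifted_symmetric"
        using \<Psi> by simp
      show "\<chi> \<in> extensional shifted_symmetric"
        by (simp add: \<chi>_def)
      fix f assume "f \<in> shifted_symmetric"
      then obtain g where "f = psi g"
        using surj by blast
      then show "\<Psi> f = \<chi> f"
        by (simp add: \<theta> \<chi>)
    qed
  qed
  from fun_cong[OF this, of "psi g"] show ?thesis
    unfolding \<chi> .
qed

lemma psi_Fs:
  assumes "young_diagram \<mu>"
  shows "psi (Fs \<mu>) = shifted_schur \<mu>"
proof -
  obtain g where "psi g = shifted_schur \<mu>"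
    using psi_surj[OF shifted_schur_in_shifted_symmetric[OF assms]] by blast
  then show ?thesis
    by (metis Fs_def phi_psi)
qed

section \<open>Young diagrams and transposition\<close>

definition boxes :: "(nat \<Rightarrow> nat) \<Rightarrow> (nat \<times> nat) set" where
  "boxes \<mu> = {(i, j). j < \<mu> i}"

lemma less_transposed_iff:
  assumes "young_diagram \<mu>"
  shows "i < transposed \<mu> j \<longleftrightarrow> j < \<mu> i"
proof -
  have anti: "antimono \<mu>" and fin: "finite {i. \<mu> i \<noteq> 0}"
    using assms by (auto simp: young_diagram_def)
  have fin_j: "finite {i. j < \<mu> i}"
    by (rule finite_subset[OF _ fin]) auto
  show ?thesis
  proof
    assume "j < \<mu> i"
    have "{..i} \<subseteq> {i. j < \<mu> i}"
    proof
      fix k assume "k \<in> {..i}"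
      then have "\<mu> i \<le> \<mu> k"
        by (intro antimonoD[OF anti]) simp
      with \<open>j < \<mu> i\<close> show "k \<in> {i. j < \<mu> i}" by simp
    qed
    from card_mono[OF fin_j this] show "i < transposed \<mu> j"
      by (simp add: transposed_def)
  next
    assume less: "i < transposed \<mu> j"
    show "j < \<mu> i"
    proof (rule ccontr)
      assume "\<not> j < \<mu> i"
      have "{i. j < \<mu> i} \<subseteq> {..<i}"
      proof
        fix k assume "k \<in> {i. j < \<mu> i}"
        then have "\<not> \<mu> k \<le> \<mu> i"
          using \<open>\<not> j < \<mu> i\<close> by simp
        then have "\<not> i \<le> k"
          using antimonoD[OF anti, of i k] by blast
        then show "k \<in> {..<i}" by simp
      qed
      from card_mono[OF _ this] less show False
        by (simp add: transposed_def)
    qed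
  qed
qed

lemma young_diagram_transposed:
  assumes "young_diagram \<mu>"
  shows "young_diagram (transposed \<mu>)"
proof -
  have "transposed \<mu> k \<le> transposed \<mu> j" if "j \<le> k" for j k
  proof (rule ccontr)
    assume "\<not> transposed \<mu> k \<le> transposed \<mu> j"
    then have "transposed \<mu> j < transposed \<mu> k" by simp
    then have "k < \<mu> (transposed \<mu> j)"
      by (simp only: less_transposed_iff[OF assms])
    then have "transposed \<mu> j < transposed \<mu> j"
      using that by (simp only: less_transposed_iff[OF assms])
    then show False by simp
  qed
  then have "antimono (transposed \<mu>)"
    by (simp add: antimono_def)
  moreover have "{j. transposed \<mu> j \<noteq> 0} = {..<\<mu> 0}"
    using less_transposed_iff[OF assms, of 0] by auto
  ultimately show ?thesis
    by (simp add: young_diagram_def)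
qed

lemma transposed_transposed:
  assumes "young_diagram \<mu>"
  shows "transposed (transposed \<mu>) = \<mu>"
proof
  fix i
  have "j < transposed (transposed \<mu>) i \<longleftrightarrow> j < \<mu> i" for j
    by (simp add: less_transposed_iff assms young_diagram_transposed)
  then show "transposed (transposed \<mu>) i = \<mu> i"
    by (metis linorder_neqE_nat less_irrefl)
qed

lemma transposed_zero: "transposed (\<lambda>_. 0) = (\<lambda>_. 0)"
  by (simp add: transposed_def fun_eq_iff)

lemma young_diagram_zero: "young_diagram (\<lambda>_. 0)"
  by (simp add: young_diagram_def antimono_def)

lemma boxes_transposed:
  assumes "young_diagram \<mu>"
  shows "boxes (transposed \<mu>) = prod.swap ` boxes \<mu>"
  by (auto simp: boxes_def less_transposed_iff[OF assms] image_iff)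

lemma boxes_eq_Sigma:
  assumes "young_diagram \<mu>" "num_rows \<mu> \<le> n"
  shows "boxes \<mu> = (SIGMA i:{..<n}. {..<\<mu> i})"
proof -
  have "\<mu> i = 0" if "\<not> i < n" for i
    using num_rows_le_iff[OF assms(1), of i] assms(2) that by simp
  then show ?thesis
    by (force simp: boxes_def)
qed

lemma card_boxes:
  "young_diagram \<mu> \<Longrightarrow> num_rows \<mu> \<le> n \<Longrightarrow> card (boxes \<mu>) = (\<Sum>i<n. \<mu> i)"
  by (simp add: boxes_eq_Sigma)

lemma card_boxes_transposed: "young_diagram \<mu> \<Longrightarrow> card (boxes (transposed \<mu>)) = card (boxes \<mu>)"
  by (simp add: boxes_transposed card_image)

lemma num_rows_le_card_boxes:
  assumes "young_diagram \<mu>"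
  shows "num_rows \<mu> \<le> card (boxes \<mu>)"
proof -
  have "num_rows \<mu> = (\<Sum>i<num_rows \<mu>. 1)" by simp
  also have "\<dots> \<le> (\<Sum>i<num_rows \<mu>. \<mu> i)"
  proof (rule sum_mono)
    fix i assume "i \<in> {..<num_rows \<mu>}"
    then show "1 \<le> \<mu> i"
      using num_rows_le_iff[OF assms, of i] by auto
  qed
  also have "\<dots> = card (boxes \<mu>)"
    by (rule card_boxes[OF assms order_refl, symmetric])
  finally show ?thesis .
qed

definition covers :: "(nat \<Rightarrow> nat) \<Rightarrow> (nat \<Rightarrow> nat) set" where
  "covers \<mu> = {\<nu>. young_diagram \<nu> \<and> boxes \<mu> \<subseteq> boxes \<nu> \<and> card (boxes \<nu>) = Suc (card (boxes \<mu>))}"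

lemma boxes_subset_iff: "boxes \<mu> \<subseteq> boxes \<nu> \<longleftrightarrow> (\<forall>i. \<mu> i \<le> \<nu> i)"
proof
  assume sub: "boxes \<mu> \<subseteq> boxes \<nu>"
  show "\<forall>i. \<mu> i \<le> \<nu> i"
  proof
    fix i
    have "j < \<nu> i" if "j < \<mu> i" for j
      using sub that by (auto simp: boxes_def)
    then show "\<mu> i \<le> \<nu> i"
      by (metis not_less less_irrefl)
  qed
next
  assume "\<forall>i. \<mu> i \<le> \<nu> i"
  then show "boxes \<mu> \<subseteq> boxes \<nu>"
    by (auto simp: boxes_def intro: less_le_trans)
qed

lemma transposed_covers:
  assumes "young_diagram \<mu>" "\<nu> \<in> covers \<mu>"
  shows "transposed \<nu> \<in> covers (transposed \<mu>)"
proof -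
  have \<nu>: "young_diagram \<nu>" "boxes \<mu> \<subseteq> boxes \<nu>" "card (boxes \<nu>) = Suc (card (boxes \<mu>))"
    using assms(2) by (auto simp: covers_def)
  have "boxes (transposed \<mu>) \<subseteq> boxes (transposed \<nu>)"
    unfolding boxes_transposed[OF assms(1)] boxes_transposed[OF \<nu>(1)] by (rule image_mono[OF \<nu>(2)])
  then show ?thesis
    by (simp add: covers_def young_diagram_transposed \<nu> card_boxes_transposed assms(1))
qed

lemma sum_covers_transposed:
  assumes "young_diagram \<mu>"
  shows "(\<Sum>\<nu>\<in>covers (transposed \<mu>). f \<nu>) = (\<Sum>\<nu>\<in>covers \<mu>. f (transposed \<nu>))"
proof (rule sum.reindex_bij_witness[where i = transposed and j = transposed])
  fix \<nu> assume \<nu>: "\<nu> \<in> covers (transposed \<mu>)"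
  then show inv: "transposed (transposed \<nu>) = \<nu>"
    by (simp add: covers_def transposed_transposed)
  show "transposed \<nu> \<in> covers \<mu>"
    using transposed_covers[OF young_diagram_transposed[OF assms] \<nu>] by (simp add: transposed_transposed assms)
  show "f (transposed (transposed \<nu>)) = f \<nu>"
    by (simp add: inv)
next
  fix \<nu> assume \<nu>: "\<nu> \<in> covers \<mu>"
  then show "transposed (transposed \<nu>) = \<nu>"
    by (simp add: covers_def transposed_transposed)
  show "transposed \<nu> \<in> covers (transposed \<mu>)"
    by (rule transposed_covers[OF assms \<nu>])
qed

definition add_box :: "(nat \<Rightarrow> nat) \<Rightarrow> nat \<Rightarrow> nat \<Rightarrow> nat" where
  "add_box \<mu> j = \<mu>(j := Suc (\<mu> j))"

text \<open>The \<open>n\<close> rows include the first empty one, so that a box in a new row is counted.\<close>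

lemma covers_eq:
  assumes "young_diagram \<mu>" "num_rows \<mu> < n"
  shows "covers \<mu> = add_box \<mu> ` {j. j < n \<and> young_diagram (add_box \<mu> j)}"
proof
  show "covers \<mu> \<subseteq> add_box \<mu> ` {j. j < n \<and> young_diagram (add_box \<mu> j)}"
  proof
    fix \<nu> assume "\<nu> \<in> covers \<mu>"
    then have \<nu>: "young_diagram \<nu>" "\<And>i. \<mu> i \<le> \<nu> i" "card (boxes \<nu>) = Suc (card (boxes \<mu>))"
      by (auto simp: covers_def boxes_subset_iff)
    define N where "N = max (num_rows \<mu>) (num_rows \<nu>)"
    have "(\<Sum>i<N. \<nu> i - \<mu> i) = (\<Sum>i<N. \<nu> i) - (\<Sum>i<N. \<mu> i)"
      by (rule sum_subtractf_nat) (simp add: \<nu>(2))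
    also have "\<dots> = card (boxes \<nu>) - card (boxes \<mu>)"
      using card_boxes[OF \<nu>(1), of N] card_boxes[OF assms(1), of N] by (simp add: N_def)
    finally have "(\<Sum>i<N. \<nu> i - \<mu> i) = 1"
      using \<nu>(3) by simp
    then obtain j where j: "j < N" "\<nu> j - \<mu> j = 1" "\<And>i. i < N \<Longrightarrow> i \<noteq> j \<Longrightarrow> \<nu> i - \<mu> i = 0"
      unfolding sum_eq_1_iff[OF finite_lessThan] by auto
    have "\<nu> i = add_box \<mu> j i" for i
    proof (cases "i < N")
      case True
      then show ?thesis
        using j(2) j(3)[of i] \<nu>(2)[of i] by (auto simp: add_box_def)
    next
      case False
      then have "\<nu> i = 0" "\<mu> i = 0"
        using num_rows_le_iff[OF \<nu>(1), of i] num_rows_le_iff[OF assms(1), of i] by (auto simp: N_def)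
      with False j(1) show ?thesis
        by (auto simp: add_box_def)
    qed
    then have eq: "\<nu> = add_box \<mu> j" by blast
    have "j < n"
    proof (rule ccontr)
      assume "\<not> j < n"
      then have "\<mu> (j - 1) = 0" "j - 1 \<noteq> j"
        using num_rows_le_iff[OF assms(1), of "j - 1"] assms(2) by auto
      then have "\<nu> (j - 1) = 0" "\<nu> j \<noteq> 0"
        by (simp_all add: eq add_box_def)
      moreover have "\<nu> j \<le> \<nu> (j - 1)"
        using \<nu>(1) by (auto simp: young_diagram_def antimono_def)
      ultimately show False by simp
    qed
    with eq \<nu>(1) show "\<nu> \<in> add_box \<mu> ` {j. j < n \<and> young_diagram (add_box \<mu> j)}"
      by blast
  qed
next
  show "add_box \<mu> ` {j. j < n \<and> young_diagram (add_box \<mu> j)} \<subseteq> covers \<mu>"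
  proof
    fix \<nu> assume "\<nu> \<in> add_box \<mu> ` {j. j < n \<and> young_diagram (add_box \<mu> j)}"
    then obtain j where j: "j < n" "young_diagram \<nu>" "\<nu> = add_box \<mu> j" by blast
    define N where "N = max (Suc j) (max (num_rows \<mu>) (num_rows \<nu>))"
    have "card (boxes \<nu>) = (\<Sum>i<N. \<mu> i + (if i = j then 1 else 0))"
      using card_boxes[OF j(2), of N] by (auto simp: N_def j(3) add_box_def intro!: sum.cong)
    also have "\<dots> = Suc (card (boxes \<mu>))"
      using card_boxes[OF assms(1), of N] by (simp add: sum.distrib N_def)
    finally show "\<nu> \<in> covers \<mu>"
      using j(2) by (simp add: covers_def boxes_subset_iff j(3) add_box_def)
  qed
qed

lemma not_young_add_box:
  assumes "young_diagram \<mu>" "\<not> young_diagram (add_box \<mu> j)"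
  shows "j > 0 \<and> \<mu> (j - 1) = \<mu> j"
proof (rule ccontr)
  assume *: "\<not> (j > 0 \<and> \<mu> (j - 1) = \<mu> j)"
  have anti: "\<mu> k \<le> \<mu> i" if "i \<le> k" for i k
    using assms(1) that by (auto simp: young_diagram_def antimono_def)
  have "add_box \<mu> j k \<le> add_box \<mu> j i" if "i \<le> k" for i k
  proof (cases "k = j \<and> i \<noteq> j")
    case True
    then have "i \<le> j - 1" "j > 0"
      using that by auto
    then have "\<mu> (j - 1) \<le> \<mu> i" "\<mu> j \<le> \<mu> (j - 1)" "\<mu> (j - 1) \<noteq> \<mu> j"
      using * anti by auto
    with True show ?thesis
      by (simp add: add_box_def)
  next
    case False
    then show ?thesis
      using anti[OF that] by (auto simp: add_box_def)
  qed
  moreover have "{i. add_box \<mu> j i \<noteq> 0} \<subseteq> insert j {i. \<mu> i \<noteq> 0}"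
    by (auto simp: add_box_def)
  then have "finite {i. add_box \<mu> j i \<noteq> 0}"
    by (rule finite_subset) (use assms(1) in \<open>simp add: young_diagram_def\<close>)
  ultimately have "young_diagram (add_box \<mu> j)"
    by (simp add: young_diagram_def antimono_def)
  with assms(2) show False ..
qed


section \<open>The values of shifted Schur functions at partitions\<close>

lemma falling_det_expand:
  "falling_det n v m =
    (\<Sum>p | p permutes {..<n}. of_int (sign p) * (\<Prod>i<n. falling (m (p i)) (v i)))"
proof -
  have "(\<Prod>i = 0..<n. mat n n (\<lambda>(i, j). falling (m j) (v i)) $$ (i, p i)) = (\<Prod>i<n. falling (m (p i)) (v i))"
    if "p permutes {0..<n}" for p
    using permutes_in_image[OF that] by (simp add: lessThan_atLeast0)
  then show ?thesis
    unfolding falling_det_def det_def'[OF mat_carrier] by (simp add: lessThan_atLeast0)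
qed

text \<open>Raising the exponent \<open>m (p i)\<close> by 1 multiplies the summand of \<open>p\<close> by \<open>v i - m (p i)\<close>, and the sum
  of these factors over \<open>i\<close> is the same for all \<open>p\<close>.\<close>

lemma falling_det_pieri:
  "(\<Sum>j<n. falling_det n v (m(j := Suc (m j)))) =
    ((\<Sum>i<n. v i) - (\<Sum>j<n. of_nat (m j))) * falling_det n v m"
proof -
  let ?t = "\<lambda>m p. \<Prod>i<n. falling (m (p i)) (v i)"
  have "(\<Sum>j<n. ?t (m(j := Suc (m j))) p) = ((\<Sum>i<n. v i) - (\<Sum>j<n. of_nat (m j))) * ?t m p"
    if p: "p permutes {..<n}" for p
  proof -
    have raise: "?t (m(p i := Suc (m (p i)))) p = (v i - of_nat (m (p i))) * ?t m p" if "i < n" for i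
    proof -
      have "p k = p i \<longleftrightarrow> k = i" for k
        using permutes_inj[OF p] by (auto dest: injD)
      then have "?t (m(p i := Suc (m (p i)))) p =
          (\<Prod>k<n. (if k = i then v i - of_nat (m (p i)) else 1) * falling (m (p k)) (v k))"
        by (intro prod.cong) (auto simp: falling_Suc mult.commute)
      also have "\<dots> = (v i - of_nat (m (p i))) * ?t m p"
        using that by (simp add: prod.distrib)
      finally show ?thesis .
    qed
    have "(\<Sum>j<n. ?t (m(j := Suc (m j))) p) = (\<Sum>i<n. ?t (m(p i := Suc (m (p i)))) p)"
      using sum.permute[OF p, of "\<lambda>j. ?t (m(j := Suc (m j))) p"] by (simp only: o_def)
    also have "\<dots> = (\<Sum>i<n. (v i - of_nat (m (p i))) * ?t m p)"
      by (intro sum.cong refl raise) simp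
    also have "\<dots> = ((\<Sum>i<n. v i) - (\<Sum>i<n. of_nat (m (p i)))) * ?t m p"
      by (simp only: sum_distrib_right[symmetric] sum_subtractf)
    also have "(\<Sum>i<n. of_nat (m (p i))) = (\<Sum>j<n. of_nat (m j) :: 'a)"
      using sum.permute[OF p, of "\<lambda>j. of_nat (m j) :: 'a"] by (simp only: o_def)
    finally show ?thesis .
  qed
  then have "(\<Sum>p | p permutes {..<n}. of_int (sign p) * (\<Sum>j<n. ?t (m(j := Suc (m j))) p)) =
      (\<Sum>p | p permutes {..<n}. ((\<Sum>i<n. v i) - (\<Sum>j<n. of_nat (m j))) * (of_int (sign p) * ?t m p))"
    by (intro sum.cong refl) (simp add: mult.left_commute)
  then show ?thesis
    unfolding falling_det_expand sum_distrib_left by (subst sum.swap) simp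
qed

lemma falling_det_equal_exponents:
  assumes "i < n" "j < n" "i \<noteq> j" "m i = m j"
  shows "falling_det n v m = 0"
  unfolding falling_det_def
  by (rule det_identical_columns[OF mat_carrier assms(3,1,2)]) (use assms in \<open>auto intro: eq_vecI\<close>)

definition schur_value :: "nat \<Rightarrow> (nat \<Rightarrow> nat) \<Rightarrow> (nat \<Rightarrow> nat) \<Rightarrow> complex" where
  "schur_value n \<nu> \<mu> = ev (\<lambda>i. of_nat (\<nu> i)) (shifted_schur_poly n \<mu>)"

lemma schur_value_mult:
  "schur_value n \<nu> \<mu> * falling_det n (\<lambda>i. of_nat (exponent n \<nu> i)) (exponent n (\<lambda>_. 0)) =
    falling_det n (\<lambda>i. of_nat (exponent n \<nu> i)) (exponent n \<mu>)"
proof -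
  have "ev (\<lambda>i. of_nat (\<nu> i)) (node n i) = of_nat (exponent n \<nu> i)" for i
    by (simp only: ev_node exponent_def of_nat_add)
  then have alt: "ev (\<lambda>i. of_nat (\<nu> i)) (shifted_alternant n \<mu>) =
      falling_det n (\<lambda>i. of_nat (exponent n \<nu> i)) (exponent n \<mu>)" for \<mu>
    by (simp only: shifted_alternant_eq ev.hom_falling_det)
  show ?thesis
    unfolding schur_value_def alt[symmetric] ev_mult[symmetric] shifted_schur_poly_mult ..
qed

lemma exponent_less_iff:
  assumes "young_diagram \<mu>" "i < n" "j < n"
  shows "exponent n \<mu> i < exponent n \<mu> j \<longleftrightarrow> j < i"
proof -
  have less: "exponent n \<mu> k < exponent n \<mu> l" if "l < k" "k < n" for k l
  proof -
    have "\<mu> k \<le> \<mu> l"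
      using assms(1) that by (auto simp: young_diagram_def antimono_def)
    with that show ?thesis
      by (simp add: exponent_def)
  qed
  show ?thesis
    using less[of j i] less[of i j] assms(2,3) by (cases i j rule: linorder_cases) auto
qed

lemma vandermonde_value_nonzero:
  assumes "young_diagram \<nu>"
  shows "falling_det n (\<lambda>i. of_nat (exponent n \<nu> i) :: complex) (exponent n (\<lambda>_. 0)) \<noteq> 0"
  unfolding exponent_zero
proof (rule falling_det_nonzero, rule inj_onI)
  fix i j assume ij: "i \<in> {..<n}" "j \<in> {..<n}"
    and "of_nat (exponent n \<nu> i) = (of_nat (exponent n \<nu> j) :: complex)"
  then have "exponent n \<nu> i = exponent n \<nu> j"
    by simp
  then show "i = j"
    using exponent_less_iff[OF assms, of i n j] exponent_less_iff[OF assms, of j n i] ij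
    by (cases i j rule: linorder_cases) auto
qed

lemma schur_value_zero:
  assumes "young_diagram \<nu>"
  shows "schur_value n \<nu> (\<lambda>_. 0) = 1"
  using schur_value_mult[of n \<nu> "\<lambda>_. 0"] vandermonde_value_nonzero[OF assms, of n] by simp

lemma falling_of_nat_eq_0: "k < m \<Longrightarrow> falling m (of_nat k :: 'a::comm_ring_1) = 0"
  unfolding falling_def by (rule prod_zero) auto

text \<open>A nonvanishing summand of the determinant needs \<open>exponent n \<mu> (p i) \<le> exponent n \<nu> i\<close> for
  all \<open>i\<close>. If \<open>\<mu>\<close> has at least as many boxes as \<open>\<nu>\<close>, all these are equalities; since both sides
  decrease strictly in their index, \<open>p\<close> is then increasing, hence the identity.\<close>

lemma schur_value_vanish:
  assumes "young_diagram \<nu>" "young_diagram \<mu>" "num_rows \<nu> \<le> n" "num_rows \<mu> \<le> n"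
    and "card (boxes \<nu>) \<le> card (boxes \<mu>)" "\<nu> \<noteq> \<mu>"
  shows "schur_value n \<nu> \<mu> = 0"
proof -
  have "(\<Prod>i<n. falling (exponent n \<mu> (p i)) (of_nat (exponent n \<nu> i) :: complex)) = 0"
    if p: "p permutes {..<n}" for p
  proof (rule ccontr)
    assume nonzero: "(\<Prod>i<n. falling (exponent n \<mu> (p i)) (of_nat (exponent n \<nu> i) :: complex)) \<noteq> 0"
    have p_less: "p i < n" if "i < n" for i
      using permutes_in_image[OF p, of i] that by simp
    have le: "exponent n \<mu> (p i) \<le> exponent n \<nu> i" if "i < n" for i
    proof (rule ccontr)
      assume "\<not> exponent n \<mu> (p i) \<le> exponent n \<nu> i"
      then have "falling (exponent n \<mu> (p i)) (of_nat (exponent n \<nu> i) :: complex) = 0"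
        by (intro falling_of_nat_eq_0) simp
      with nonzero that show False by auto
    qed
    have sum_exponent: "(\<Sum>i<n. exponent n \<kappa> i) = card (boxes \<kappa>) + (\<Sum>i<n. n - Suc i)"
      if "young_diagram \<kappa>" "num_rows \<kappa> \<le> n" for \<kappa>
      unfolding card_boxes[OF that] exponent_def by (rule sum.distrib)
    have "(\<Sum>i<n. exponent n \<mu> (p i)) = (\<Sum>i<n. exponent n \<mu> i)"
      using sum.permute[OF p, of "exponent n \<mu>"] by (simp only: o_def)
    then have "(\<Sum>i<n. exponent n \<nu> i) \<le> (\<Sum>i<n. exponent n \<mu> (p i))"
      using assms(5) by (simp add: sum_exponent assms)
    moreover have "(\<Sum>i<n. exponent n \<mu> (p i)) \<le> (\<Sum>i<n. exponent n \<nu> i)"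
      by (rule sum_mono) (simp add: le)
    ultimately have sum_eq: "(\<Sum>i<n. exponent n \<mu> (p i)) = (\<Sum>i<n. exponent n \<nu> i)"
      by simp
    have eq: "exponent n \<mu> (p i) = exponent n \<nu> i" if "i < n" for i
      by (rule sum_mono_inv[OF sum_eq]) (use le that in auto)
    have mono: "p i < p j" if "i < j" "j < n" for i j
      using exponent_less_iff[OF assms(1), of j n i] exponent_less_iff[OF assms(2), of "p j" n "p i"]
        eq[of i] eq[of j] p_less[of i] p_less[of j] that by simp
    have ge: "i \<le> p i" if "i < n" for i
      using that
    proof (induction i)
      case (Suc i)
      then show ?case
        using mono[of i "Suc i"] by simp
    qed simp
    have sum_id: "(\<Sum>i<n. i) = (\<Sum>i<n. p i)"
      using sum.permute[OF p, of "\<lambda>i. i"] by (simp only: o_def)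
    have id: "i = p i" if "i < n" for i
      by (rule sum_mono_inv[OF sum_id]) (use ge that in auto)
    have "\<mu> i = \<nu> i" for i
    proof (cases "i < n")
      case True
      then show ?thesis
        using eq[OF True] id[OF True] by (simp add: exponent_def)
    next
      case False
      then show ?thesis
        using num_rows_le_iff[OF assms(1), of i] num_rows_le_iff[OF assms(2), of i] assms(3,4) by simp
    qed
    then have "\<mu> = \<nu>" by (rule ext)
    with assms(6) show False by simp
  qed
  then have "falling_det n (\<lambda>i. of_nat (exponent n \<nu> i) :: complex) (exponent n \<mu>) = 0"
    unfolding falling_det_expand by (intro sum.neutral) simp
  then show ?thesis
    using schur_value_mult[of n \<nu> \<mu>] vandermonde_value_nonzero[OF assms(1), of n] by simp
qed

text \<open>Raising an exponent adds a box. Where this does not give a diagram, two exponents coincide and the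
  alternant vanishes; the condition \<open>num_rows \<mu> < n\<close> leaves room for a new row.\<close>

lemma schur_value_pieri:
  assumes "young_diagram \<nu>" "young_diagram \<mu>" "num_rows \<nu> \<le> n" "num_rows \<mu> < n"
  shows "(\<Sum>\<kappa>\<in>covers \<mu>. schur_value n \<nu> \<kappa>) =
    (of_nat (card (boxes \<nu>)) - of_nat (card (boxes \<mu>))) * schur_value n \<nu> \<mu>"
proof -
  let ?v = "\<lambda>i. of_nat (exponent n \<nu> i) :: complex"
  let ?A = "\<lambda>\<mu>. falling_det n ?v (exponent n \<mu>)"
  let ?Y = "{j. j < n \<and> young_diagram (add_box \<mu> j)}"
  have exponent_add_box: "exponent n (add_box \<mu> j) = (exponent n \<mu>)(j := Suc (exponent n \<mu> j))" for j
    by (auto simp: exponent_def add_box_def fun_eq_iff)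
  have zero: "?A (add_box \<mu> j) = 0" if j: "j < n" "\<not> young_diagram (add_box \<mu> j)" for j
  proof -
    have *: "j > 0" "\<mu> (j - 1) = \<mu> j"
      using not_young_add_box[OF assms(2) j(2)] by auto
    then have "exponent n (add_box \<mu> j) (j - 1) = exponent n (add_box \<mu> j) j"
    proof -
      have "n - Suc (j - 1) = Suc (n - Suc j)"
        using j(1) *(1) by simp
      then show ?thesis
        using * by (simp add: exponent_def add_box_def)
    qed
    then show ?thesis
      using * j(1) by (intro falling_det_equal_exponents[of "j - 1" n j]) auto
  qed
  have inj: "inj_on (add_box \<mu>) ?Y"
  proof (rule inj_onI)
    fix i j assume "add_box \<mu> i = add_box \<mu> j"
    from fun_cong[OF this, of i] show "i = j"
      by (auto simp: add_box_def split: if_splits)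
  qed
  have sum_v: "(\<Sum>i<n. of_nat (exponent n \<kappa> i) :: complex) = of_nat (card (boxes \<kappa>) + (\<Sum>i<n. n - Suc i))"
    if "young_diagram \<kappa>" "num_rows \<kappa> \<le> n" for \<kappa>
    unfolding card_boxes[OF that] of_nat_sum[symmetric] exponent_def sum.distrib ..
  have "(\<Sum>\<kappa>\<in>covers \<mu>. schur_value n \<nu> \<kappa>) * ?A (\<lambda>_. 0) = (\<Sum>\<kappa>\<in>covers \<mu>. ?A \<kappa>)"
    unfolding sum_distrib_right schur_value_mult ..
  also have "\<dots> = (\<Sum>j\<in>?Y. ?A (add_box \<mu> j))"
    unfolding covers_eq[OF assms(2,4)] by (subst sum.reindex[OF inj]) simp
  also have "\<dots> = (\<Sum>j<n. ?A (add_box \<mu> j))"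
    by (rule sum.mono_neutral_left) (auto simp: zero)
  also have "\<dots> = ((\<Sum>i<n. ?v i) - (\<Sum>j<n. of_nat (exponent n \<mu> j))) * ?A \<mu>"
    unfolding exponent_add_box by (rule falling_det_pieri)
  also have "\<dots> = (of_nat (card (boxes \<nu>)) - of_nat (card (boxes \<mu>))) * ?A \<mu>"
    using assms by (simp add: sum_v)
  also have "\<dots> = ((of_nat (card (boxes \<nu>)) - of_nat (card (boxes \<mu>))) * schur_value n \<nu> \<mu>) * ?A (\<lambda>_. 0)"
    by (simp only: mult.assoc schur_value_mult)
  finally show ?thesis
    using vandermonde_value_nonzero[OF assms(1), of n] by simp
qed

text \<open>The Pieri recursion determines a function on the diagrams with at most \<open>N\<close> boxes
  by its values on those with exactly that many boxes.\<close>

lemma pieri_recursion_zero: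
  fixes K :: "(nat \<Rightarrow> nat) \<Rightarrow> complex"
  assumes rec: "\<And>\<mu>. young_diagram \<mu> \<Longrightarrow> card (boxes \<mu>) < N \<Longrightarrow>
      (\<Sum>\<kappa>\<in>covers \<mu>. K \<kappa>) = (of_nat N - of_nat (card (boxes \<mu>))) * K \<mu>"
    and top: "\<And>\<mu>. young_diagram \<mu> \<Longrightarrow> card (boxes \<mu>) = N \<Longrightarrow> K \<mu> = 0"
  shows "young_diagram \<mu> \<Longrightarrow> card (boxes \<mu>) \<le> N \<Longrightarrow> K \<mu> = 0"
proof (induction "N - card (boxes \<mu>)" arbitrary: \<mu>)
  case 0
  then show ?case by (intro top) simp_all
next
  case (Suc k)
  then have less: "card (boxes \<mu>) < N" by simp
  have "K \<kappa> = 0" if "\<kappa> \<in> covers \<mu>" for \<kappa>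
    using that Suc.hyps(2) less by (intro Suc.hyps(1)) (auto simp: covers_def)
  then have "(of_nat N - of_nat (card (boxes \<mu>))) * K \<mu> = 0"
    using rec[OF Suc.prems(1) less] by simp
  then show ?case
    using less by simp
qed

text \<open>For fixed \<open>\<nu>\<close> both sides satisfy the same Pieri recursion in \<open>\<mu>\<close>, because transposition
  preserves the covering relation, and on diagrams of the size of \<open>\<nu>\<close> both vanish except at \<open>\<nu>\<close>
  itself. So they are proportional, and they agree at the empty diagram.\<close>

theorem schur_value_transposed:
  assumes \<nu>: "young_diagram \<nu>" "card (boxes \<nu>) < n"
    and \<mu>: "young_diagram \<mu>" "num_rows \<mu> \<le> n" "num_rows (transposed \<mu>) \<le> n"
  shows "schur_value n (transposed \<nu>) (transposed \<mu>) = schur_value n \<nu> \<mu>"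
proof -
  let ?N = "card (boxes \<nu>)"
  note \<nu>' = young_diagram_transposed[OF \<nu>(1)] card_boxes_transposed[OF \<nu>(1)]
  define F where "F = schur_value n \<nu>"
  define G where "G \<kappa> = schur_value n (transposed \<nu>) (transposed \<kappa>)" for \<kappa>
  have rows: "num_rows \<nu> \<le> n" "num_rows (transposed \<nu>) \<le> n"
    using num_rows_le_card_boxes[OF \<nu>(1)] num_rows_le_card_boxes[OF \<nu>'(1)] \<nu>'(2) \<nu>(2) by simp_all
  have small_rows: "num_rows \<kappa> < n" "num_rows (transposed \<kappa>) < n"
    if "young_diagram \<kappa>" "card (boxes \<kappa>) \<le> ?N" for \<kappa>
    using num_rows_le_card_boxes[OF that(1)] num_rows_le_card_boxes[OF young_diagram_transposed[OF that(1)]]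
      card_boxes_transposed[OF that(1)] that(2) \<nu>(2) by simp_all
  have F_rec: "(\<Sum>\<kappa>'\<in>covers \<kappa>. F \<kappa>') = (of_nat ?N - of_nat (card (boxes \<kappa>))) * F \<kappa>"
    if "young_diagram \<kappa>" "card (boxes \<kappa>) < ?N" for \<kappa>
    unfolding F_def
    by (rule schur_value_pieri[OF \<nu>(1) that(1) rows(1)]) (use small_rows[of \<kappa>] that in simp)
  have G_rec: "(\<Sum>\<kappa>'\<in>covers \<kappa>. G \<kappa>') = (of_nat ?N - of_nat (card (boxes \<kappa>))) * G \<kappa>"
    if "young_diagram \<kappa>" "card (boxes \<kappa>) < ?N" for \<kappa>
    unfolding G_def sum_covers_transposed[OF that(1), symmetric]
    using schur_value_pieri[OF \<nu>'(1) young_diagram_transposed[OF that(1)] rows(2)] small_rows[of \<kappa>] that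
    by (simp add: card_boxes_transposed \<nu>(1))
  have F_top: "F \<kappa> = 0" if "young_diagram \<kappa>" "num_rows \<kappa> \<le> n" "?N \<le> card (boxes \<kappa>)" "\<kappa> \<noteq> \<nu>" for \<kappa>
    unfolding F_def by (rule schur_value_vanish[OF \<nu>(1) that(1) rows(1) that(2,3)]) (use that in simp)
  have G_top: "G \<kappa> = 0"
    if "young_diagram \<kappa>" "num_rows (transposed \<kappa>) \<le> n" "?N \<le> card (boxes \<kappa>)" "\<kappa> \<noteq> \<nu>" for \<kappa>
  proof -
    have "transposed \<nu> \<noteq> transposed \<kappa>"
    proof
      assume "transposed \<nu> = transposed \<kappa>"
      then have "transposed (transposed \<nu>) = transposed (transposed \<kappa>)"
        by (rule arg_cong)
      then show False
        using that(4) by (simp only: transposed_transposed[OF \<nu>(1)] transposed_transposed[OF that(1)])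
    qed
    moreover have "card (boxes (transposed \<nu>)) \<le> card (boxes (transposed \<kappa>))"
      using that(3) by (simp add: card_boxes_transposed \<nu>(1) that(1))
    ultimately show ?thesis
      unfolding G_def
      by (intro schur_value_vanish[OF \<nu>'(1) young_diagram_transposed[OF that(1)] rows(2) that(2)])
  qed
  have zero: "young_diagram (\<lambda>_. 0)" "card (boxes (\<lambda>_. 0)) \<le> ?N" "F (\<lambda>_. 0) = 1" "G (\<lambda>_. 0) = 1"
    using schur_value_zero[OF \<nu>(1)] schur_value_zero[OF \<nu>'(1)]
    by (simp_all only: young_diagram_zero F_def G_def transposed_zero) (simp add: boxes_def)
  have "F \<nu> \<noteq> 0"
  proof
    assume "F \<nu> = 0"
    have "F \<kappa> = 0" if "young_diagram \<kappa>" "card (boxes \<kappa>) = ?N" for \<kappa>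
      using \<open>F \<nu> = 0\<close> F_top[OF that(1)] small_rows[OF that(1)] that(2) by (cases "\<kappa> = \<nu>") simp_all
    then have "F (\<lambda>_. 0) = 0"
      using pieri_recursion_zero[of ?N F "\<lambda>_. 0", OF F_rec _ zero(1,2)] by blast
    with zero(3) show False by simp
  qed
  have proportional: "G \<nu> * F \<kappa> - F \<nu> * G \<kappa> = 0" if "young_diagram \<kappa>" "card (boxes \<kappa>) \<le> ?N" for \<kappa>
  proof (rule pieri_recursion_zero[OF _ _ that])
    fix \<kappa> assume \<kappa>: "young_diagram \<kappa>" "card (boxes \<kappa>) < ?N"
    show "(\<Sum>\<kappa>'\<in>covers \<kappa>. G \<nu> * F \<kappa>' - F \<nu> * G \<kappa>') =
        (of_nat ?N - of_nat (card (boxes \<kappa>))) * (G \<nu> * F \<kappa> - F \<nu> * G \<kappa>)"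
      unfolding sum_subtractf sum_distrib_left[symmetric] F_rec[OF \<kappa>] G_rec[OF \<kappa>]
      by (simp only: right_diff_distrib mult.left_commute)
  next
    fix \<kappa> assume "young_diagram \<kappa>" "card (boxes \<kappa>) = ?N"
    then show "G \<nu> * F \<kappa> - F \<nu> * G \<kappa> = 0"
      using F_top[of \<kappa>] G_top[of \<kappa>] small_rows[of \<kappa>] by (cases "\<kappa> = \<nu>") simp_all
  qed
  have "G \<nu> = F \<nu>"
    using proportional[OF zero(1,2)] zero(3,4) by simp
  show ?thesis
  proof (cases "card (boxes \<mu>) \<le> ?N")
    case True
    then have "G \<mu> = F \<mu>"
      using proportional[OF \<mu>(1) True] \<open>G \<nu> = F \<nu>\<close> \<open>F \<nu> \<noteq> 0\<close> by simp
    then show ?thesis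
      by (simp add: F_def G_def)
  next
    case False
    then have "\<mu> \<noteq> \<nu>" by auto
    then have "F \<mu> = 0" "G \<mu> = 0"
      using F_top[of \<mu>] G_top[of \<mu>] \<mu> False by simp_all
    then show ?thesis
      by (simp add: F_def G_def)
  qed
qed

section \<open>Duality\<close>

text \<open>The value of the power sum of degree \<open>k + 1\<close> at a diagram, as a sum over boxes of a function of
  the content. Written in Frobenius coordinates it is the super power sum.\<close>

definition content_sum :: "(nat \<Rightarrow> nat) \<Rightarrow> nat \<Rightarrow> complex" where
  "content_sum \<nu> k = (\<Sum>(i, j)\<in>boxes \<nu>.
      (of_nat j - of_nat i + 1 / 2) ^ (k + 1) - (of_nat j - of_nat i - 1 / 2) ^ (k + 1))"

lemma ev_shifted_power_sum:
  assumes "young_diagram \<nu>" "num_rows \<nu> \<le> n"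
  shows "ev (\<lambda>i. of_nat (\<nu> i)) (shifted_power_sum n k) = content_sum \<nu> k"
proof -
  have "ev (\<lambda>i. of_nat (\<nu> i)) (shifted_power_sum n k) =
      (\<Sum>i<n. (of_nat (\<nu> i) - (of_nat i + 1 / 2)) ^ (k + 1) - (- (of_nat i + 1 / 2)) ^ (k + 1))"
    by (simp only: shifted_power_sum_def ev.hom_sum ev.hom_minus ev.hom_power ev_X ev_Con)
  also have "\<dots> = (\<Sum>i<n. \<Sum>j<\<nu> i. (of_nat j - of_nat i + 1 / 2) ^ (k + 1) - (of_nat j - of_nat i - 1 / 2) ^ (k + 1))"
  proof (rule sum.cong[OF refl])
    fix i
    let ?f = "\<lambda>j. (of_nat j - (of_nat i + 1 / 2) :: complex) ^ (k + 1)"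
    have "?f (\<nu> i) - ?f 0 = (\<Sum>j<\<nu> i. ?f (Suc j) - ?f j)"
      by (rule sum_lessThan_telescope [symmetric])
    also have "\<dots> = (\<Sum>j<\<nu> i. (of_nat j - of_nat i + 1 / 2) ^ (k + 1) - (of_nat j - of_nat i - 1 / 2) ^ (k + 1))"
    proof (rule sum.cong[OF refl])
      fix j
      have "of_nat (Suc j) - (of_nat i + 1 / 2) = (of_nat j - of_nat i + 1 / 2 :: complex)"
        "of_nat j - (of_nat i + 1 / 2) = (of_nat j - of_nat i - 1 / 2 :: complex)"
        by simp_all
      then show "?f (Suc j) - ?f j =
          (of_nat j - of_nat i + 1 / 2) ^ (k + 1) - (of_nat j - of_nat i - 1 / 2) ^ (k + 1)"
        by (simp only:)
    qed
    finally show "(of_nat (\<nu> i) - (of_nat i + 1 / 2)) ^ (k + 1) - (- (of_nat i + 1 / 2)) ^ (k + 1) =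
        (\<Sum>j<\<nu> i. (of_nat j - of_nat i + 1 / 2) ^ (k + 1) - (of_nat j - of_nat i - 1 / 2 :: complex) ^ (k + 1))"
      by (simp only: of_nat_0 diff_0)
  qed
  also have "\<dots> = content_sum \<nu> k"
    unfolding content_sum_def boxes_eq_Sigma[OF assms] by (rule sum.Sigma) simp_all
  finally show ?thesis .
qed

lemma ev_psi:
  assumes "young_diagram \<nu>" "num_rows \<nu> \<le> n"
  shows "ev (\<lambda>i. of_nat (\<nu> i)) (psi g n) = ev (content_sum \<nu>) g"
  unfolding psi_def ev_psubst ev_shifted_power_sum[OF assms] ..

lemma content_sum_transposed:
  assumes "young_diagram \<nu>"
  shows "content_sum (transposed \<nu>) k = (-1) ^ k * content_sum \<nu> k"
proof -
  have flip: "(of_nat i - of_nat j + 1 / 2) ^ (k + 1) - (of_nat i - of_nat j - 1 / 2) ^ (k + 1) =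
      (-1) ^ k * ((of_nat j - of_nat i + 1 / 2) ^ (k + 1) - (of_nat j - of_nat i - 1 / 2 :: complex) ^ (k + 1))"
    for i j
  proof -
    have e: "of_nat i - of_nat j + 1 / 2 = - (of_nat j - of_nat i - 1 / 2 :: complex)"
      "of_nat i - of_nat j - 1 / 2 = - (of_nat j - of_nat i + 1 / 2 :: complex)"
      by (simp_all only: minus_diff_eq minus_add_distrib diff_diff_eq2 diff_conv_add_uminus minus_add minus_minus ac_simps)
    have neg: "(- a) ^ (k + 1) = - ((-1) ^ k * a ^ (k + 1))" for a :: complex
      by (subst power_minus) simp
    show ?thesis
      unfolding e neg right_diff_distrib by simp
  qed
  have "content_sum (transposed \<nu>) k = (\<Sum>(i, j)\<in>boxes \<nu>.
      (of_nat i - of_nat j + 1 / 2) ^ (k + 1) - (of_nat i - of_nat j - 1 / 2) ^ (k + 1))"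
    unfolding content_sum_def boxes_transposed[OF assms]
    by (subst sum.reindex) (simp_all add: case_prod_unfold)
  also have "\<dots> = (-1) ^ k * content_sum \<nu> k"
    unfolding content_sum_def sum_distrib_left case_prod_unfold by (rule sum.cong[OF refl flip])
  finally show ?thesis .
qed

lemma ev_omega:
  assumes "young_diagram \<nu>"
  shows "ev (content_sum \<nu>) (omega g) = ev (content_sum (transposed \<nu>)) g"
  unfolding omega_def ev_psubst content_sum_transposed[OF assms, abs_def] by (simp only: ev_mult ev_Con ev_X)

lemma eq_0_if_values_0:
  assumes "\<And>\<nu>. young_diagram \<nu> \<Longrightarrow> ev (content_sum \<nu>) g = 0"
  shows "g = 0"
proof (rule psi_inj, rule ext)
  fix n
  have "vars (psi g n) \<subseteq> {..<n}"
    unfolding psi_def shifted_power_sum_def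
    by (intro vars_psubstI vars_sumI vars_diffI vars_powerI) auto
  then show "psi g n = 0 n"
    using partition_not_root[of "psi g n" n] ev_psi assms by (metis zero_fun_def)
qed

lemma ev_Fs:
  assumes "young_diagram \<nu>" "young_diagram \<mu>" "num_rows \<nu> \<le> n" "num_rows \<mu> \<le> n"
  shows "ev (content_sum \<nu>) (Fs \<mu>) = schur_value n \<nu> \<mu>"
  using ev_psi[OF assms(1,3), of "Fs \<mu>"] assms(4)
  by (simp add: psi_Fs[OF assms(2)] shifted_schur_def schur_value_def)

theorem proposition2p2:
  fixes \<mu> :: "nat \<Rightarrow> nat"
  assumes "young_diagram \<mu>"
  shows "omega (Fs \<mu>) = Fs (transposed \<mu>)"
proof -
  note \<mu>' = young_diagram_transposed[OF assms]
  have "ev (content_sum \<nu>) (omega (Fs \<mu>) - Fs (transposed \<mu>)) = 0" if \<nu>: "young_diagram \<nu>" for \<nu>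
  proof -
    note \<nu>' = young_diagram_transposed[OF \<nu>]
    define n where "n = Suc (max (card (boxes \<nu>)) (max (num_rows \<mu>) (num_rows (transposed \<mu>))))"
    have rows: "num_rows \<nu> \<le> n" "num_rows (transposed \<nu>) \<le> n"
      using num_rows_le_card_boxes[OF \<nu>] num_rows_le_card_boxes[OF \<nu>'] card_boxes_transposed[OF \<nu>]
      by (simp_all add: n_def)
    have n: "card (boxes \<nu>) < n" "num_rows \<mu> \<le> n" "num_rows (transposed \<mu>) \<le> n"
      by (simp_all add: n_def)
    have "ev (content_sum \<nu>) (omega (Fs \<mu>)) = schur_value n (transposed \<nu>) \<mu>"
      by (simp only: ev_omega[OF \<nu>] ev_Fs[OF \<nu>' assms rows(2) n(2)])
    also have "\<dots> = schur_value n \<nu> (transposed \<mu>)"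
      using schur_value_transposed[OF \<nu> n(1) \<mu>'] n by (simp add: transposed_transposed[OF assms])
    also have "\<dots> = ev (content_sum \<nu>) (Fs (transposed \<mu>))"
      by (rule ev_Fs[OF \<nu> \<mu>' rows(1) n(3), symmetric])
    finally show ?thesis
      by (simp add: ev.hom_minus)
  qed
  then have "omega (Fs \<mu>) - Fs (transposed \<mu>) = 0"
    by (rule eq_0_if_values_0)
  then show ?thesis by simp
qed

end
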